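(* Let $n\ge 3$. Let $\Gamma\subset\mathbb{R}^n$ be an open, convex, connected, symmetric cone with vertex at $0$ such that $\Gamma_n^+\subseteq\Gamma\subseteq\Gamma_1^+$, and let $f\in C^\infty(\Gamma)\cap C^0(\overline{\Gamma})$ be concave, homogeneous of degree one and symmetric in the $\lambda_i$, with $f>0$ in $\Gamma$, $f=0$ on $\partial\Gamma$, and $f_{\lambda_i}>0$ in $\Gamma$ for $1\le i\le n$. Let $M=M_0\cup M_1\cup\dots\cup M_m$ be a smooth $n$-manifold, where $M_0$ is a compact region and $M_1,\dots,M_m$ are mutually disjoint non-compact ends such that each $M_i$ ($1\le i\le m$) is disjoint from $M_0$ except along their common boundary. Suppose each end splits as a product $M_i=[0,\infty)\times N_i$ for some closed $(n-1)$-manifold $N_i$, with $r$ the coordinate on $[0,\infty)$, and that $N_i$ admits an Einstein metric $h_i$ with Einstein constant $(n-2)k_i$, $k_i\in\{-1,0,1\}$ (that is, $\operatorname{Ric}_{h_i}=(n-2)k_ih_i$). Let $g_0$ be a smooth Riemannian metric on $M$ such that $$g_0|_{M_i}=dr^2+\Phi_i^2(r)\,h_i\qquad(1\le i\le m),$$ where each $\Phi_i$ is a positive (smooth) function on $[0,\infty)$ satisfying $$\frac{\Phi_i'(r)^2-k_i}{2\Phi_i(r)^2}\ge\varepsilon>0\qquad\text{and}\qquad\frac{2\Phi_i(r)\Phi_i''(r)}{\Phi_i'(r)^2-k_i}\ge-\mu_\Gamma^++1+\delta$$ for $r$ sufficiently large and for some positive constants $\varepsilon$ and $\delta$. Then $g_0$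 is a complete metric, and there exist a constant $c>0$ and a compact set $K_0\subset M$ such that $\lambda(-g_0^{-1}A_{g_0})\in\Gamma$ and $f(\lambda(-g_0^{-1}A_{g_0}))\ge c>0$ on $M\setminus K_0$.
   Context: For a Riemannian metric $g$ on an $n$-manifold, $A_g=\frac{1}{n-2}\left(\operatorname{Ric}_g-\frac{R_g}{2(n-1)}g\right)$ is the Schouten tensor, where $\operatorname{Ric}_g$ and $R_g$ are the Ricci and scalar curvatures, and $\lambda(-g^{-1}A_g)\in\mathbb{R}^n$ denotes the vector of eigenvalues of the $(1,1)$-tensor $-g^{-1}A_g$ (order irrelevant by symmetry of $\Gamma$ and $f$). $\Gamma_n^+=\{\lambda\in\mathbb{R}^n:\lambda_i>0\ \forall i\}$ and $\Gamma_1^+=\{\lambda\in\mathbb{R}^n:\lambda_1+\dots+\lambda_n>0\}$. The number $\mu_\Gamma^+\in[0,n-1]$ is uniquely determined by $(-\mu_\Gamma^+,1,\dots,1)\in\partial\Gamma$. *)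

theory Defs
  imports "HOL-Analysis.Analysis"
begin

section \<open>Smooth maps\<close>

text \<open>\<open>Ck_on k S f\<close> is meant for open \<open>S\<close>.\<close>

primrec Ck_on :: "nat \<Rightarrow> 'a::euclidean_space set \<Rightarrow> ('a \<Rightarrow> 'b::real_normed_vector) \<Rightarrow> bool" where
  "Ck_on 0 S f \<longleftrightarrow> continuous_on S f"
| "Ck_on (Suc k) S f \<longleftrightarrow> (\<forall>x\<in>S. f differentiable (at x)) \<and>
     (\<forall>v. Ck_on k S (\<lambda>x. frechet_derivative f (at x) v))"

text \<open>Smoothness on an arbitrary set (such as a half-space or a closed interval) means the
  existence of local smooth extensions; on an open set this is ordinary smoothness.\<close>

definition smooth_on :: "'a::euclidean_space set \<Rightarrow> ('a \<Rightarrow> 'b::real_normed_vector) \<Rightarrow> bool" where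
  "smooth_on S f \<longleftrightarrow>
     (\<forall>x\<in>S. \<exists>U f'. open U \<and> x \<in> U \<and> (\<forall>k. Ck_on k U f') \<and> (\<forall>y\<in>S \<inter> U. f' y = f y))"


section \<open>Smooth manifolds\<close>

text \<open>A manifold is a topology \<open>X\<close> together with an atlas of charts \<open>(U, x)\<close>, where \<open>x\<close> maps
  the open set \<open>U\<close> to coordinate space; \<open>x\<close> is irrelevant outside \<open>U\<close>.\<close>

type_synonym ('a, 'n) chart = "'a set \<times> ('a \<Rightarrow> real ^ 'n)"

definition chart_on :: "'a topology \<Rightarrow> ('a, 'n::finite) chart \<Rightarrow> bool" where
  "chart_on X c \<longleftrightarrow> openin X (fst c) \<and> open (snd c ` fst c) \<and>
     homeomorphic_map (subtopology X (fst c)) (top_of_set (snd c ` fst c)) (snd c)"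

definition chart_inv :: "('a, 'n::finite) chart \<Rightarrow> real ^ 'n \<Rightarrow> 'a" where
  "chart_inv c = inv_into (fst c) (snd c)"

definition smooth_manifold :: "'a topology \<Rightarrow> ('a, 'n::finite) chart set \<Rightarrow> bool" where
  "smooth_manifold X A \<longleftrightarrow>
     Hausdorff_space X \<and> second_countable X \<and>
     (\<forall>c\<in>A. chart_on X c) \<and> topspace X = (\<Union>c\<in>A. fst c) \<and>
     (\<forall>c\<in>A. \<forall>c'\<in>A. smooth_on (snd c ` (fst c \<inter> fst c')) (snd c' \<circ> chart_inv c))"


section \<open>Riemannian metrics and curvature\<close>

text \<open>A metric assigns to each chart \<open>c\<close> and each point \<open>p\<close> of its domain the Gram matrix
  \<open>G c p\<close> of the coordinate vector fields. The last clause is the transformation law of a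
  \<open>(0,2)\<close>-tensor; \<open>G c p\<close> is irrelevant for \<open>p\<close> outside the domain of \<open>c\<close>.\<close>

type_synonym ('a, 'n) metric = "('a, 'n) chart \<Rightarrow> 'a \<Rightarrow> real ^ 'n ^ 'n"

definition coord_metric ::
  "('a, 'n::finite) metric \<Rightarrow> ('a, 'n) chart \<Rightarrow> real ^ 'n \<Rightarrow> real ^ 'n ^ 'n" where
  "coord_metric G c = G c \<circ> chart_inv c"

definition riemannian_metric :: "('a, 'n::finite) chart set \<Rightarrow> ('a, 'n) metric \<Rightarrow> bool" where
  "riemannian_metric A G \<longleftrightarrow>
     (\<forall>c\<in>A. smooth_on (snd c ` fst c) (coord_metric G c)) \<and>
     (\<forall>c\<in>A. \<forall>p\<in>fst c. transpose (G c p) = G c p \<and> (\<forall>v. v \<noteq> 0 \<longrightarrow> v \<bullet> (G c p *v v) > 0)) \<and>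
     (\<forall>c\<in>A. \<forall>c'\<in>A. \<forall>p\<in>fst c \<inter> fst c'.
        let J = matrix (frechet_derivative (snd c' \<circ> chart_inv c) (at (snd c p)))
        in G c p = transpose J ** G c' p ** J)"

definition partial :: "'n::finite \<Rightarrow> (real ^ 'n \<Rightarrow> real) \<Rightarrow> real ^ 'n \<Rightarrow> real" where
  "partial i F y = frechet_derivative F (at y) (axis i 1)"

text \<open>\<open>christoffel G k i j y\<close> is $\Gamma^k_{ij}$.\<close>

definition christoffel ::
  "(real ^ 'n::finite \<Rightarrow> real ^ 'n ^ 'n) \<Rightarrow> 'n \<Rightarrow> 'n \<Rightarrow> 'n \<Rightarrow> real ^ 'n \<Rightarrow> real" where
  "christoffel G k i j y = 1/2 * (\<Sum>l\<in>UNIV. matrix_inv (G y) $ k $ l *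
     (partial i (\<lambda>z. G z $ j $ l) y + partial j (\<lambda>z. G z $ i $ l) y - partial l (\<lambda>z. G z $ i $ j) y))"

text \<open>\<open>riemann G l k i j y\<close> is $R^l{}_{kij}$, with the convention
  $R(\partial_i,\partial_j)\partial_k = R^l{}_{kij}\,\partial_l$ and
  $R(X,Y)=[\nabla_X,\nabla_Y]-\nabla_{[X,Y]}$; round spheres have positive Ricci curvature.\<close>

definition riemann ::
  "(real ^ 'n::finite \<Rightarrow> real ^ 'n ^ 'n) \<Rightarrow> 'n \<Rightarrow> 'n \<Rightarrow> 'n \<Rightarrow> 'n \<Rightarrow> real ^ 'n \<Rightarrow> real" where
  "riemann G l k i j y =
     partial i (christoffel G l j k) y - partial j (christoffel G l i k) y +
     (\<Sum>m\<in>UNIV. christoffel G l i m y * christoffel G m j k y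
              - christoffel G l j m y * christoffel G m i k y)"

definition ricci :: "(real ^ 'n::finite \<Rightarrow> real ^ 'n ^ 'n) \<Rightarrow> real ^ 'n \<Rightarrow> real ^ 'n ^ 'n" where
  "ricci G y = (\<chi> j k. \<Sum>l\<in>UNIV. riemann G l k l j y)"

definition scalar_curvature :: "(real ^ 'n::finite \<Rightarrow> real ^ 'n ^ 'n) \<Rightarrow> real ^ 'n \<Rightarrow> real" where
  "scalar_curvature G y = (\<Sum>i\<in>UNIV. \<Sum>j\<in>UNIV. matrix_inv (G y) $ i $ j * ricci G y $ i $ j)"

definition schouten :: "(real ^ 'n::finite \<Rightarrow> real ^ 'n ^ 'n) \<Rightarrow> real ^ 'n \<Rightarrow> real ^ 'n ^ 'n" where
  "schouten G y = (1 / (real CARD('n) - 2)) *\<^sub>R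
     (ricci G y - (scalar_curvature G y / (2 * (real CARD('n) - 1))) *\<^sub>R G y)"

text \<open>The matrix of the endomorphism $-g^{-1}A_g$ at \<open>p\<close> in the chart \<open>c\<close>.\<close>

definition neg_schouten_endo ::
  "('a, 'n::finite) metric \<Rightarrow> ('a, 'n) chart \<Rightarrow> 'a \<Rightarrow> real ^ 'n ^ 'n" where
  "neg_schouten_endo G c p = - (matrix_inv (G c p) ** schouten (coord_metric G c) (snd c p))"

text \<open>\<open>l\<close> lists the eigenvalues of \<open>B\<close> with algebraic multiplicity, in some order.\<close>

definition eigenvalue_vector :: "real ^ 'n ^ 'n::finite \<Rightarrow> real ^ 'n \<Rightarrow> bool" where
  "eigenvalue_vector B l \<longleftrightarrow> (\<forall>t. det (mat t - B) = (\<Prod>i\<in>UNIV. t - l $ i))"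

definition einstein_metric ::
  "('a, 'n::finite) chart set \<Rightarrow> ('a, 'n) metric \<Rightarrow> real \<Rightarrow> bool" where
  "einstein_metric A G \<kappa> \<longleftrightarrow> riemannian_metric A G \<and>
     (\<forall>c\<in>A. \<forall>p\<in>fst c. ricci (coord_metric G c) (snd c p) = \<kappa> *\<^sub>R G c p)"


section \<open>Completeness\<close>

definition smooth_curve ::
  "'a topology \<Rightarrow> ('a, 'n::finite) chart set \<Rightarrow> real \<Rightarrow> real \<Rightarrow> (real \<Rightarrow> 'a) \<Rightarrow> bool" where
  "smooth_curve X A a b \<gamma> \<longleftrightarrow> continuous_map (top_of_set {a..b}) X \<gamma> \<and>
     (\<forall>c\<in>A. smooth_on {t\<in>{a..b}. \<gamma> t \<in> fst c} (snd c \<circ> \<gamma>))"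

definition piecewise_smooth_curve ::
  "'a topology \<Rightarrow> ('a, 'n::finite) chart set \<Rightarrow> real \<Rightarrow> real \<Rightarrow> (real \<Rightarrow> 'a) \<Rightarrow> bool" where
  "piecewise_smooth_curve X A a b \<gamma> \<longleftrightarrow>
     (\<exists>(m::nat) s. m > 0 \<and> s 0 = a \<and> s m = b \<and>
        (\<forall>j<m. s j < s (Suc j) \<and> smooth_curve X A (s j) (s (Suc j)) \<gamma>))"

text \<open>By the transformation law of the metric, the speed does not depend on the chosen chart.
  Its values at the finitely many break points do not affect the length.\<close>

definition speed ::
  "('a, 'n::finite) chart set \<Rightarrow> ('a, 'n) metric \<Rightarrow> (real \<Rightarrow> 'a) \<Rightarrow> real \<Rightarrow> real" where
  "speed A G \<gamma> t =
     (let c = (SOME c. c \<in> A \<and> \<gamma> t \<in> fst c);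
          v = vector_derivative (snd c \<circ> \<gamma>) (at t)
      in sqrt (v \<bullet> (G c (\<gamma> t) *v v)))"

definition riemannian_length ::
  "('a, 'n::finite) chart set \<Rightarrow> ('a, 'n) metric \<Rightarrow> real \<Rightarrow> real \<Rightarrow> (real \<Rightarrow> 'a) \<Rightarrow> real" where
  "riemannian_length A G a b \<gamma> = integral {a..b} (speed A G \<gamma>)"

text \<open>The manifold is not assumed to be connected: the distance between points of different
  components is infinite.\<close>

definition riemannian_dist ::
  "'a topology \<Rightarrow> ('a, 'n::finite) chart set \<Rightarrow> ('a, 'n) metric \<Rightarrow> 'a \<Rightarrow> 'a \<Rightarrow> ereal" where
  "riemannian_dist X A G p q = Inf {ereal (riemannian_length A G a b \<gamma>) |a b \<gamma>.
     piecewise_smooth_curve X A a b \<gamma> \<and> \<gamma> a = p \<and> \<gamma> b = q}"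

definition complete_metric ::
  "'a topology \<Rightarrow> ('a, 'n::finite) chart set \<Rightarrow> ('a, 'n) metric \<Rightarrow> bool" where
  "complete_metric X A G \<longleftrightarrow>
     (\<forall>\<sigma>::nat \<Rightarrow> 'a.
        range \<sigma> \<subseteq> topspace X \<and>
        (\<forall>e>0. \<exists>K. \<forall>i\<ge>K. \<forall>j\<ge>K. riemannian_dist X A G (\<sigma> i) (\<sigma> j) < ereal e) \<longrightarrow>
        (\<exists>p\<in>topspace X. (\<lambda>i. riemannian_dist X A G (\<sigma> i) p) \<longlonglongrightarrow> 0))"


section \<open>Ends with a product structure\<close>

text \<open>\<open>\<phi>\<close> is a map from $[0,\infty)\times N$ to \<open>X\<close>; below it is read in a chart \<open>d\<close> of \<open>N\<close> and
  a chart \<open>c\<close> of \<open>X\<close>.\<close>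

definition end_coords ::
  "('a, 'n::finite) chart \<Rightarrow> ('b, 'k::finite) chart \<Rightarrow> (real \<times> 'b \<Rightarrow> 'a)
     \<Rightarrow> real \<times> (real ^ 'k) \<Rightarrow> real ^ 'n" where
  "end_coords c d \<phi> = (\<lambda>(r, y). snd c (\<phi> (r, chart_inv d y)))"

definition end_dom ::
  "('a, 'n::finite) chart \<Rightarrow> ('b, 'k::finite) chart \<Rightarrow> (real \<times> 'b \<Rightarrow> 'a) \<Rightarrow> (real \<times> (real ^ 'k)) set" where
  "end_dom c d \<phi> = {(r, y). 0 \<le> r \<and> y \<in> snd d ` fst d \<and> \<phi> (r, chart_inv d y) \<in> fst c}"

text \<open>A smooth embedding of the manifold with boundary $[0,\infty)\times N$. At points with
  \<open>r = 0\<close> the (unique) derivative is one-sided in \<open>r\<close>.\<close>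

definition smooth_end_embedding ::
  "'a topology \<Rightarrow> ('a, 'n::finite) chart set \<Rightarrow> 'b topology \<Rightarrow> ('b, 'k::finite) chart set
     \<Rightarrow> (real \<times> 'b \<Rightarrow> 'a) \<Rightarrow> bool" where
  "smooth_end_embedding X A N B \<phi> \<longleftrightarrow>
     embedding_map (prod_topology (top_of_set {0..}) N) X \<phi> \<and>
     (\<forall>c\<in>A. \<forall>d\<in>B. smooth_on (end_dom c d \<phi>) (end_coords c d \<phi>) \<and>
        (\<forall>z\<in>end_dom c d \<phi>. \<exists>D. (end_coords c d \<phi> has_derivative D) (at z within end_dom c d \<phi>) \<and> inj D))"

text \<open>The pullback of \<open>G\<close> under \<open>\<phi>\<close> is $dr^2+\Phi(r)^2\,h$.\<close>

definition warped_product_on_end ::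
  "('a, 'n::finite) chart set \<Rightarrow> ('a, 'n) metric \<Rightarrow> ('b, 'k::finite) chart set \<Rightarrow> ('b, 'k) metric
     \<Rightarrow> (real \<times> 'b \<Rightarrow> 'a) \<Rightarrow> (real \<Rightarrow> real) \<Rightarrow> bool" where
  "warped_product_on_end A G B h \<phi> \<Phi> \<longleftrightarrow>
     (\<forall>c\<in>A. \<forall>d\<in>B. \<forall>(r, y)\<in>end_dom c d \<phi>.
        \<exists>D. (end_coords c d \<phi> has_derivative D) (at (r, y) within end_dom c d \<phi>) \<and>
          (\<forall>s v s' v'. D (s, v) \<bullet> (G c (\<phi> (r, chart_inv d y)) *v D (s', v')) =
             s * s' + (\<Phi> r)\<^sup>2 * (v \<bullet> (h d (chart_inv d y) *v v'))))"


section \<open>Cones\<close>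

definition positive_cone :: "(real ^ 'n::finite) set" where
  "positive_cone = {x. \<forall>i. x $ i > 0}"

definition positive_trace_cone :: "(real ^ 'n::finite) set" where
  "positive_trace_cone = {x. (\<Sum>i\<in>UNIV. x $ i) > 0}"

definition permute_coords :: "('n \<Rightarrow> 'n) \<Rightarrow> real ^ 'n::finite \<Rightarrow> real ^ 'n" where
  "permute_coords \<sigma> x = (\<chi> i. x $ \<sigma> i)"

definition mu_plus :: "(real ^ 'n::finite) set \<Rightarrow> real" where
  "mu_plus \<Gamma> = (THE \<mu>. 0 \<le> \<mu> \<and> \<mu> \<le> real CARD('n) - 1 \<and>
     (\<forall>i. (\<chi> j. if j = i then - \<mu> else 1) \<in> frontier \<Gamma>))"

lemma mu_plus_unique_exists:
  fixes \<Gamma> :: "(real ^ 'n::finite) set"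
  assumes "open \<Gamma>" "convex \<Gamma>"
    and sym: "\<And>x \<sigma>. x \<in> \<Gamma> \<Longrightarrow> bij \<sigma> \<Longrightarrow> permute_coords \<sigma> x \<in> \<Gamma>"
    and lo: "positive_cone \<subseteq> \<Gamma>" and up: "\<Gamma> \<subseteq> positive_trace_cone"
  shows "\<exists>!\<mu>. 0 \<le> \<mu> \<and> \<mu> \<le> real CARD('n) - 1 \<and>
     (\<forall>i. (\<chi> j. if j = i then - \<mu> else 1) \<in> frontier \<Gamma>)"
proof -
  define e :: "'n \<Rightarrow> real \<Rightarrow> real ^ 'n" where "e i \<mu> = (\<chi> j. if j = i then - \<mu> else 1)" for i \<mu>
  have one: "(\<chi> j. 1) \<in> \<Gamma>" using lo by (auto simp: positive_cone_def)
  have fr: "frontier \<Gamma> = closure \<Gamma> - \<Gamma>"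
    using \<open>open \<Gamma>\<close> by (simp add: frontier_def interior_open)
  have less: False if "a < b" "e i a \<in> frontier \<Gamma>" "e i b \<in> frontier \<Gamma>" "0 \<le> a" for a b i
  proof -
    define t where "t = (b - a) / (b + 1)"
    have t: "0 < t" "t \<le> 1" using that by (auto simp: t_def field_simps)
    have "e i b - t *\<^sub>R (e i b - (\<chi> j. 1)) \<in> interior \<Gamma>"
      by (rule mem_interior_closure_convex_shrink[OF \<open>convex \<Gamma>\<close> _ _ t])
         (use that one \<open>open \<Gamma>\<close> in \<open>auto simp: fr interior_open\<close>)
    moreover have "t * (b + 1) = b - a" using that by (simp add: t_def)
    then have "e i b - t *\<^sub>R (e i b - (\<chi> j. 1)) = e i a"
      by (auto simp: e_def vec_eq_iff algebra_simps)
    ultimately show False using that \<open>open \<Gamma>\<close> by (auto simp: fr interior_open)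
  qed
  obtain i0 :: 'n where True by simp
  let ?S = "e i0 ` {-1 .. real CARD('n) - 1}"
  have ce: "continuous_on T (e i)" for i T
  proof -
    have "continuous_on T (\<lambda>x::real. if j = i then - x else 1)" for j
      by (cases "j = i") (auto intro!: continuous_intros)
    then show ?thesis unfolding e_def by (intro continuous_on_vec_lambda)
  qed
  have sum: "(\<Sum>j\<in>UNIV. e i \<mu> $ j) = real CARD('n) - 1 - \<mu>" for i \<mu>
    by (simp add: e_def sum.If_cases Compl_eq_Diff_UNIV card_Diff_singleton of_nat_diff)
  have conn: "connected ?S" by (intro connected_continuous_image ce) auto
  have "e i0 (-1) \<in> \<Gamma>" using one by (simp add: e_def if_distrib cong: if_cong)
  moreover have "e i0 (-1) \<in> ?S" by (intro imageI) simp
  ultimately have ne: "?S \<inter> \<Gamma> \<noteq> {}" by blast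
  have "e i0 (real CARD('n) - 1) \<notin> \<Gamma>"
    using up sum[of i0 "real CARD('n) - 1"] by (auto simp: positive_trace_cone_def)
  moreover have "e i0 (real CARD('n) - 1) \<in> ?S" by (intro imageI) simp
  ultimately have "?S - \<Gamma> \<noteq> {}" by blast
  then have "?S \<inter> frontier \<Gamma> \<noteq> {}"
    using connected_Int_frontier[OF conn ne] by blast
  then obtain \<mu> where \<mu>: "-1 \<le> \<mu>" "\<mu> \<le> real CARD('n) - 1" "e i0 \<mu> \<in> frontier \<Gamma>" by auto
  have "0 \<le> \<mu>"
  proof (rule ccontr)
    assume "\<not> 0 \<le> \<mu>"
    then have "e i0 \<mu> \<in> positive_cone" by (auto simp: positive_cone_def e_def)
    then show False using lo \<mu> by (auto simp: fr)
  qed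
  have "e i \<mu> \<in> frontier \<Gamma>" for i
  proof -
    let ?\<sigma> = "Transposition.transpose i i0"
    have pe: "permute_coords ?\<sigma> (e i0 \<mu>) = e i \<mu>" "permute_coords ?\<sigma> (e i \<mu>) = e i0 \<mu>"
      by (auto simp: permute_coords_def e_def vec_eq_iff Transposition.transpose_def)
    have "continuous_on (closure \<Gamma>) (permute_coords ?\<sigma>)"
      unfolding permute_coords_def by (intro continuous_on_vec_lambda continuous_intros)
    then have "permute_coords ?\<sigma> ` closure \<Gamma> \<subseteq> closure (permute_coords ?\<sigma> ` \<Gamma>)"
      by (rule image_closure_subset) (auto intro: closure_subset[THEN subsetD])
    also have "\<dots> \<subseteq> closure \<Gamma>" by (intro closure_mono) (auto intro!: sym)
    finally have "e i \<mu> \<in> closure \<Gamma>" using \<mu> pe by (force simp: fr)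
    moreover have "e i \<mu> \<notin> \<Gamma>" using sym[of "e i \<mu>" ?\<sigma>] \<mu> pe by (auto simp: fr)
    ultimately show ?thesis by (simp add: fr)
  qed
  then show ?thesis
    using \<open>0 \<le> \<mu>\<close> \<mu>(2) less unfolding e_def[symmetric]
    by (intro ex1I[of _ \<mu>]) (auto, metis linorder_less_linear)
qed

end

theory Submission
  imports Defs
begin

text \<open>On an end, \<open>- g\<^sup>-\<^sup>1 A\<close> for \<open>g = dr\<^sup>2 + \<Phi>\<^sup>2 h\<close> has the eigenvalue \<open>q = (\<Phi>'\<^sup>2 - k) / (2 \<Phi>\<^sup>2)\<close>
  on the slices and \<open>\<Phi>'' / \<Phi> - q\<close> in the radial direction. By hypothesis this vector dominates
  \<open>q (- \<mu> + \<delta>, 1, \<dots>, 1)\<close> and \<open>q \<ge> \<epsilon>\<close>, so monotonicity and homogeneity of \<open>f\<close> give the lower bound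
  \<open>\<epsilon> f (- \<mu> + \<delta>, 1, \<dots>, 1) > 0\<close>. To pass from an arbitrary chart to product coordinates, the
  Levi-Civita connection is characterised by the Koszul formula, which yields the gauge law
  \<open>F' (B' v w) = F'' v w + B (F' v) (F' w)\<close> under a diffeomorphism \<open>F\<close>; differentiating this law gives
  the tensoriality of the curvature. Completeness holds because a smoothed radius function on the
  ends is 1-Lipschitz and has compact sublevel sets.\<close>

section \<open>Smooth maps and second derivatives\<close>

text \<open>The statement ranges over arbitrary charts of \<open>A\<close>, while the warped
  structure is visible only in product coordinates. These live on
  \<open>real \<times> real^k\<close> rather than on \<open>real^n\<close>. Connections and
  curvature are therefore treated as multilinear maps on Euclidean spaces: a change of variables may
  then join two different spaces of equal dimension, and matching the coordinate indices is
  postponed to the eigenvalue count. Traces in place of index sums make the Ricci form invariant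
  under such a change.

  The boundary of an end is the other obstacle: at \<open>r = 0\<close> the end coordinates have
  one-sided derivatives only. Openness in \<open>X\<close> of the part \<open>r > 0\<close> is drawn
  from the condition on the frontier of the end. Differential arguments on an end take place there,
  and the slice \<open>r = 0\<close> is absorbed into compact sets.

  The entry -\<mu> + \<delta> arises because the second growth condition bounds the ratio of
  \<Phi>''/\<Phi> to q below by -\<mu> + 1 + \<delta>; subtracting q from \<Phi>''/\<Phi> removes
  the 1.\<close>

definition dd :: "('a::real_normed_vector \<Rightarrow> 'b::real_normed_vector) \<Rightarrow> 'a \<Rightarrow> 'a \<Rightarrow> 'b" where
  "dd f x v = frechet_derivative f (at x) v"

lemma dd_eq: "(f has_derivative f') (at x) \<Longrightarrow> dd f x = f'"
  unfolding dd_def using frechet_derivative_at by metis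

lemma has_derivative_dd: "f differentiable (at x) \<Longrightarrow> (f has_derivative dd f x) (at x)"
  unfolding dd_def[abs_def] by (simp add: frechet_derivative_works)

text \<open>Agreement near \<open>x\<close> gives both functions the same candidate derivatives, and
  \<open>frechet_derivative\<close> chooses among these; so the equality holds even where neither
  function is differentiable.\<close>

lemma dd_cong:
  assumes "open V" "x \<in> V" "\<And>y. y \<in> V \<Longrightarrow> f y = g y"
  shows "dd f x = dd g x"
proof -
  have "(f has_derivative D) (at x) \<longleftrightarrow> (g has_derivative D) (at x)" for D
    using assms by (metis has_derivative_transform_within_open)
  then show ?thesis unfolding dd_def frechet_derivative_def by presburger
qed

lemma differentiable_cong_open:
  assumes "open V" "x \<in> V" "\<And>y. y \<in> V \<Longrightarrow> f y = g y" "f differentiable (at x)"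
  shows "g differentiable (at x)"
  using assms unfolding differentiable_def by (metis has_derivative_transform_within_open)

text \<open>\<open>smooth_on\<close> speaks of local extensions; here the derivatives are those of
  \<open>f\<close> itself, so that \<open>dd\<close> can be iterated.\<close>

definition smooth_open :: "'a::euclidean_space set \<Rightarrow> ('a \<Rightarrow> 'b::real_normed_vector) \<Rightarrow> bool" where
  "smooth_open S f \<longleftrightarrow> (\<forall>k. Ck_on k S f)"

lemma smooth_open_differentiable: "smooth_open S f \<Longrightarrow> x \<in> S \<Longrightarrow> f differentiable (at x)"
  unfolding smooth_open_def by (metis Ck_on.simps(2))

lemma smooth_open_dd: "smooth_open S f \<Longrightarrow> smooth_open S (\<lambda>x. dd f x v)"
  unfolding smooth_open_def dd_def by (metis Ck_on.simps(2))

lemma smooth_open_continuous: "smooth_open S f \<Longrightarrow> continuous_on S f"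
  unfolding smooth_open_def by (metis Ck_on.simps(1))

lemma Ck_on_subset: "Ck_on k S f \<Longrightarrow> T \<subseteq> S \<Longrightarrow> Ck_on k T f"
  by (induction k arbitrary: f) (auto intro: continuous_on_subset)

lemma Ck_on_cong:
  assumes "open S" "\<And>x. x \<in> S \<Longrightarrow> f x = g x" "Ck_on k S f"
  shows "Ck_on k S g"
  using assms(2,3)
proof (induction k arbitrary: f g)
  case 0
  then show ?case by (metis Ck_on.simps(1) continuous_on_cong)
next
  case (Suc k)
  have "frechet_derivative f (at x) v = frechet_derivative g (at x) v" if "x \<in> S" for x v
    using dd_cong[OF assms(1) that, of f g] Suc.prems(1) by (auto simp: dd_def fun_eq_iff)
  then have "Ck_on k S (\<lambda>x. frechet_derivative g (at x) v)" for v
    using Suc.IH[of "\<lambda>x. frechet_derivative f (at x) v"] Suc.prems(2) by simp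
  moreover have "g differentiable (at x)" if "x \<in> S" for x
    using differentiable_cong_open[OF assms(1) that, of f g] Suc.prems that by auto
  ultimately show ?case by simp
qed

text \<open>On the open set \<open>T\<close> the local extension coincides with \<open>f\<close>,
  and there agreement passes to all derivatives by \<open>Ck_on_cong\<close>.\<close>

lemma smooth_on_imp_local:
  assumes "smooth_on S f" "open T" "x \<in> T" "T \<subseteq> S"
  obtains V where "open V" "x \<in> V" "V \<subseteq> T" "smooth_open V f"
proof -
  obtain U f' where U: "open U" "x \<in> U" "\<forall>k. Ck_on k U f'" "\<forall>y\<in>S \<inter> U. f' y = f y"
    using assms(1)[unfolded smooth_on_def, rule_format, OF subsetD[OF assms(4,3)]] by (elim exE conjE)
  have "smooth_open (U \<inter> T) f"
    unfolding smooth_open_def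
  proof
    fix k
    have "Ck_on k (U \<inter> T) f'" using U(3) Ck_on_subset[of k U f' "U \<inter> T"] by simp
    then show "Ck_on k (U \<inter> T) f"
      by (rule Ck_on_cong[rotated 2]) (use U assms(2,4) in auto)
  qed
  then show thesis using that[of "U \<inter> T"] U assms by auto
qed

lemma Ck_on_SucI:
  assumes "open S" "\<And>x. x \<in> S \<Longrightarrow> (f has_derivative D x) (at x)" "\<And>v. Ck_on k S (\<lambda>x. D x v)"
  shows "Ck_on (Suc k) S f"
proof -
  have "frechet_derivative f (at x) = D x" if "x \<in> S" for x
    using frechet_derivative_at[OF assms(2)[OF that]] by simp
  then have "Ck_on k S (\<lambda>x. frechet_derivative f (at x) v)" for v
    using Ck_on_cong[OF assms(1) _ assms(3)[of v]] by simp
  then show ?thesis using assms(2) by (auto simp: differentiable_def)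
qed

lemma Ck_on_linear_image:
  assumes "bounded_linear L" "open S" "Ck_on k S f"
  shows "Ck_on k S (\<lambda>x. L (f x))"
  using assms(3)
proof (induction k arbitrary: f)
  case 0
  then show ?case using assms(1) by (simp add: bounded_linear.continuous_on)
next
  case (Suc k)
  show ?case
  proof (rule Ck_on_SucI[OF assms(2)])
    show "((\<lambda>x. L (f x)) has_derivative (\<lambda>v. L (dd f x v))) (at x)" if "x \<in> S" for x
      using Suc.prems that by (intro bounded_linear.has_derivative[OF assms(1)] has_derivative_dd) auto
    show "Ck_on k S (\<lambda>x. L (dd f x v))" for v
      using Suc.prems by (intro Suc.IH) (auto simp: dd_def)
  qed
qed

lemma smooth_open_linear_image:
  "bounded_linear L \<Longrightarrow> open S \<Longrightarrow> smooth_open S f \<Longrightarrow> smooth_open S (\<lambda>x. L (f x))"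
  by (simp add: smooth_open_def Ck_on_linear_image)

text \<open>Chain rule along an affine line, by induction on the order. It serves for time shifts of
  curves and for straight segments in a chart.\<close>

lemma Ck_on_line:
  fixes f :: "'a::euclidean_space \<Rightarrow> 'b::real_normed_vector" and x v :: 'a
  assumes "open U" "Ck_on k U f"
  shows "Ck_on k {t::real. x + t *\<^sub>R v \<in> U} (\<lambda>t. f (x + t *\<^sub>R v))"
  using assms(2)
proof (induction k arbitrary: f)
  case 0
  then show ?case
    by (auto intro!: continuous_on_compose2[of U f] continuous_intros)
next
  case (Suc k)
  show ?case
  proof (rule Ck_on_SucI)
    show "open {t::real. x + t *\<^sub>R v \<in> U}"
      using open_vimage[OF assms(1), of "\<lambda>t. x + t *\<^sub>R v"]
      by (simp add: vimage_def continuous_intros)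
    show "((\<lambda>t. f (x + t *\<^sub>R v)) has_derivative (\<lambda>s. dd f (x + t *\<^sub>R v) (s *\<^sub>R v))) (at t)"
      if "t \<in> {t. x + t *\<^sub>R v \<in> U}" for t
    proof -
      have "(f has_derivative dd f (x + t *\<^sub>R v)) (at (x + t *\<^sub>R v))"
        using Suc.prems that by (intro has_derivative_dd) auto
      then show ?thesis
        by (rule has_derivative_compose[rotated]) (auto intro!: derivative_eq_intros)
    qed
    show "Ck_on k {t. x + t *\<^sub>R v \<in> U} (\<lambda>t. dd f (x + t *\<^sub>R v) (s *\<^sub>R v))" for s :: real
      using Suc.prems by (intro Suc.IH[of "\<lambda>y. dd f y (s *\<^sub>R v)"]) (auto simp: dd_def)
  qed
qed

lemma Ck_on_local:
  assumes "\<And>x. x \<in> S \<Longrightarrow> \<exists>V. open V \<and> x \<in> V \<and> Ck_on k V f"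
  shows "Ck_on k S f"
  using assms
proof (induction k arbitrary: f)
  case 0
  then show ?case
    by (metis Ck_on.simps(1) continuous_at_imp_continuous_on continuous_on_eq_continuous_at)
next
  case (Suc k)
  have "f differentiable (at x)" if "x \<in> S" for x
    using Suc.prems[OF that] by auto
  moreover have "Ck_on k S (\<lambda>x. frechet_derivative f (at x) v)" for v
  proof (rule Suc.IH)
    fix x assume "x \<in> S"
    then show "\<exists>V. open V \<and> x \<in> V \<and> Ck_on k V (\<lambda>x. frechet_derivative f (at x) v)"
      using Suc.prems by (metis Ck_on.simps(2))
  qed
  ultimately show ?case by simp
qed

lemma smooth_on_imp_smooth_open:
  assumes "open S" "smooth_on S f"
  shows "smooth_open S f"
  unfolding smooth_open_def
proof (intro allI Ck_on_local)
  fix k x assume x: "x \<in> S"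
  obtain V where "open V" "x \<in> V" "smooth_open V f"
    by (rule smooth_on_imp_local[OF assms(2,1) x order_refl])
  then show "\<exists>V. open V \<and> x \<in> V \<and> Ck_on k V f" unfolding smooth_open_def by blast
qed

text \<open>The second difference over a parallelogram is an increment along \<open>u\<close> of an
  increment along \<open>v\<close>. The mean value theorem is applied to the latter as a function of
  \<open>s\<close>, and then to the derivative in direction \<open>u\<close> as a function of
  \<open>t\<close>.\<close>

lemma second_derivative_mvt:
  fixes f :: "'a::euclidean_space \<Rightarrow> real"
  assumes "h > 0"
    and d1: "\<And>s t. s \<in> {0..h} \<Longrightarrow> t \<in> {0..h} \<Longrightarrow> f differentiable (at (x + s *\<^sub>R u + t *\<^sub>R v))"
    and d2: "\<And>s t. s \<in> {0..h} \<Longrightarrow> t \<in> {0..h} \<Longrightarrow> (\<lambda>y. dd f y u) differentiable (at (x + s *\<^sub>R u + t *\<^sub>R v))"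
  obtains s t where "s \<in> {0..h}" "t \<in> {0..h}"
    "f (x + h *\<^sub>R u + h *\<^sub>R v) - f (x + h *\<^sub>R u) - f (x + h *\<^sub>R v) + f x
      = h * h * dd (\<lambda>y. dd f y u) (x + s *\<^sub>R u + t *\<^sub>R v) v"
proof -
  define p where "p s = f (x + s *\<^sub>R u + h *\<^sub>R v) - f (x + s *\<^sub>R u)" for s
  have dp: "(p has_real_derivative
      dd f (x + s *\<^sub>R u + h *\<^sub>R v) u - dd f (x + s *\<^sub>R u) u) (at s)" if s: "s \<in> {0..h}" for s
  proof -
    have e: "((\<lambda>s. f (x + s *\<^sub>R u + t *\<^sub>R v)) has_derivative (\<lambda>r. r * dd f (x + s *\<^sub>R u + t *\<^sub>R v) u)) (at s)"
      if t: "t \<in> {0..h}" for t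
    proof -
      have D: "(f has_derivative dd f (x + s *\<^sub>R u + t *\<^sub>R v)) (at (x + s *\<^sub>R u + t *\<^sub>R v))"
        using d1[OF s t] by (rule has_derivative_dd)
      have "((\<lambda>s. x + s *\<^sub>R u + t *\<^sub>R v) has_derivative (\<lambda>r. r *\<^sub>R u)) (at s)"
        by (auto intro!: derivative_eq_intros)
      from has_derivative_compose[OF this D] show ?thesis
        using linear_simps(5)[OF has_derivative_bounded_linear[OF D]] by simp
    qed
    have "0 \<in> {0..h}" "h \<in> {0..h}" using assms(1) by auto
    then have "(p has_derivative (\<lambda>r. r * dd f (x + s *\<^sub>R u + h *\<^sub>R v) u - r * dd f (x + s *\<^sub>R u) u)) (at s)"
      using has_derivative_diff[OF e[of h] e[of 0]] by (simp add: p_def[abs_def])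
    moreover have "(\<lambda>r. r * dd f (x + s *\<^sub>R u + h *\<^sub>R v) u - r * dd f (x + s *\<^sub>R u) u)
        = (*) (dd f (x + s *\<^sub>R u + h *\<^sub>R v) u - dd f (x + s *\<^sub>R u) u)"
      by (simp add: fun_eq_iff algebra_simps)
    ultimately show ?thesis
      by (simp add: has_field_derivative_def)
  qed
  obtain s where s: "0 < s" "s < h"
    "p h - p 0 = (h - 0) * (dd f (x + s *\<^sub>R u + h *\<^sub>R v) u - dd f (x + s *\<^sub>R u) u)"
    using MVT2[OF \<open>h > 0\<close>, of p "\<lambda>s. dd f (x + s *\<^sub>R u + h *\<^sub>R v) u - dd f (x + s *\<^sub>R u) u"] dp by auto
  define q where "q t = dd f (x + s *\<^sub>R u + t *\<^sub>R v) u" for t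
  have dq: "(q has_real_derivative dd (\<lambda>y. dd f y u) (x + s *\<^sub>R u + t *\<^sub>R v) v) (at t)"
    if t: "t \<in> {0..h}" for t
  proof -
    have D: "((\<lambda>y. dd f y u) has_derivative dd (\<lambda>y. dd f y u) (x + s *\<^sub>R u + t *\<^sub>R v)) (at (x + s *\<^sub>R u + t *\<^sub>R v))"
      using d2[OF _ t] s by (intro has_derivative_dd) auto
    have "((\<lambda>t. x + s *\<^sub>R u + t *\<^sub>R v) has_derivative (\<lambda>r. r *\<^sub>R v)) (at t)"
      by (auto intro!: derivative_eq_intros)
    from has_derivative_compose[OF this D] show ?thesis
      using linear_simps(5)[OF has_derivative_bounded_linear[OF D]]
      by (simp add: q_def[abs_def] has_field_derivative_def mult_commute_abs)
  qed
  obtain t where t: "0 < t" "t < h" "q h - q 0 = (h - 0) * dd (\<lambda>y. dd f y u) (x + s *\<^sub>R u + t *\<^sub>R v) v"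
    using MVT2[OF \<open>h > 0\<close>, of q "\<lambda>t. dd (\<lambda>y. dd f y u) (x + s *\<^sub>R u + t *\<^sub>R v) v"] dq by auto
  have "p h - p 0 = h * (q h - q 0)" using s(3) by (simp add: q_def)
  also have "\<dots> = h * h * dd (\<lambda>y. dd f y u) (x + s *\<^sub>R u + t *\<^sub>R v) v" using t(3) by simp
  finally show thesis using that[of s t] s t by (simp add: p_def algebra_simps)
qed

lemma eq_if_abs_diff_less:
  fixes a b :: real
  assumes "\<And>e. e > 0 \<Longrightarrow> \<bar>a - b\<bar> < e"
  shows "a = b"
  using assms[of "\<bar>a - b\<bar>"] by auto

text \<open>Schwarz's theorem. The second difference is symmetric in \<open>u\<close> and
  \<open>v\<close>, so for small \<open>h\<close> it equals \<open>h * h\<close> times a value of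
  each mixed derivative near \<open>x\<close>; continuity of both identifies their values at
  \<open>x\<close>.\<close>

lemma symmetric_second_derivative_real:
  fixes f :: "'a::euclidean_space \<Rightarrow> real"
  assumes "open V" "x \<in> V" and sm: "smooth_open V f"
  shows "dd (\<lambda>y. dd f y u) x v = dd (\<lambda>y. dd f y v) x u"
proof -
  define P where "P = (\<lambda>y. dd (\<lambda>y. dd f y u) y v)"
  define Q where "Q = (\<lambda>y. dd (\<lambda>y. dd f y v) y u)"
  have cont: "isCont P x" "isCont Q x"
    unfolding P_def Q_def
    using assms smooth_open_continuous[OF smooth_open_dd[OF smooth_open_dd[OF sm]]]
      continuous_on_eq_continuous_at by blast+
  have diff: "f differentiable (at y)" "(\<lambda>y. dd f y w) differentiable (at y)" if "y \<in> V" for y w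
    using that sm by (auto intro: smooth_open_differentiable smooth_open_dd)
  have "\<bar>P x - Q x\<bar> < e" if "e > 0" for e
  proof -
    obtain d where d: "d > 0" "\<And>y. dist y x < d \<Longrightarrow> \<bar>P y - P x\<bar> < e / 2 \<and> \<bar>Q y - Q x\<bar> < e / 2 \<and> y \<in> V"
    proof -
      have "eventually (\<lambda>y. dist (P y) (P x) < e / 2 \<and> dist (Q y) (Q x) < e / 2 \<and> y \<in> V) (nhds x)"
        using cont assms \<open>e > 0\<close>
        by (intro eventually_conj) (auto simp: isCont_def tendsto_at_iff_tendsto_nhds eventually_nhds_in_open
            dest!: tendstoD[where e = "e/2"])
      then show thesis using that unfolding eventually_nhds_metric dist_real_def by blast
    qed
    \<comment> \<open>With this \<open>h\<close> the parallelogram at \<open>x\<close> spanned by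
      \<open>h *\<^sub>R u\<close> and \<open>h *\<^sub>R v\<close> stays within distance
      \<open>d\<close>; the summand 1 keeps the denominator positive when both directions
      vanish.\<close>
    define h where "h = d / (2 * (norm u + norm v + 1))"
    have h: "h > 0" unfolding h_def using d(1)
      by (intro divide_pos_pos mult_pos_pos add_nonneg_pos) auto
    have near: "dist (x + s *\<^sub>R u + t *\<^sub>R v) x < d" if "s \<in> {0..h}" "t \<in> {0..h}" for s t
    proof -
      have "dist (x + s *\<^sub>R u + t *\<^sub>R v) x = norm (s *\<^sub>R u + t *\<^sub>R v)" by (simp add: dist_norm algebra_simps)
      also have "\<dots> \<le> s * norm u + t * norm v" using that by (intro norm_triangle_le) auto
      also have "\<dots> \<le> h * norm u + h * norm v" using that by (intro add_mono mult_right_mono) auto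
      also have "\<dots> < 2 * h * (norm u + norm v + 1)" using h by (auto simp: algebra_simps add_nonneg_pos intro: add_less_le_mono)
      also have "\<dots> = d" unfolding h_def using add_nonneg_pos[of "norm u + norm v" 1] by (simp add: field_simps)
      finally show ?thesis .
    qed
    obtain s t where st: "s \<in> {0..h}" "t \<in> {0..h}"
      "f (x + h *\<^sub>R u + h *\<^sub>R v) - f (x + h *\<^sub>R u) - f (x + h *\<^sub>R v) + f x = h * h * P (x + s *\<^sub>R u + t *\<^sub>R v)"
      unfolding P_def
      by (rule second_derivative_mvt[OF h, of f x u v]) (use near d(2) diff in blast)+
    have near': "dist (x + s *\<^sub>R v + t *\<^sub>R u) x < d" if "s \<in> {0..h}" "t \<in> {0..h}" for s t
      using near[OF that(2,1)] by (simp add: algebra_simps)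
    obtain s' t' where st': "s' \<in> {0..h}" "t' \<in> {0..h}"
      "f (x + h *\<^sub>R v + h *\<^sub>R u) - f (x + h *\<^sub>R v) - f (x + h *\<^sub>R u) + f x = h * h * Q (x + s' *\<^sub>R v + t' *\<^sub>R u)"
      unfolding Q_def
      by (rule second_derivative_mvt[OF h, of f x v u]) (use near' d(2) diff in blast)+
    have "x + h *\<^sub>R v + h *\<^sub>R u = x + h *\<^sub>R u + h *\<^sub>R v" by (simp add: algebra_simps)
    then have "h * h * P (x + s *\<^sub>R u + t *\<^sub>R v) = h * h * Q (x + s' *\<^sub>R v + t' *\<^sub>R u)"
      using st(3) st'(3) by (simp only:)
    then have "P (x + s *\<^sub>R u + t *\<^sub>R v) = Q (x + s' *\<^sub>R v + t' *\<^sub>R u)" using h by simp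
    then show ?thesis using d(2)[OF near[OF st(1,2)]] d(2)[OF near'[OF st'(1,2)]] by linarith
  qed
  then have "P x = Q x" by (rule eq_if_abs_diff_less)
  then show ?thesis by (simp add: P_def Q_def)
qed

lemma symmetric_second_derivative:
  fixes f :: "'a::euclidean_space \<Rightarrow> 'b::euclidean_space"
  assumes "open V" "x \<in> V" and sm: "smooth_open V f"
  shows "dd (\<lambda>y. dd f y u) x v = dd (\<lambda>y. dd f y v) x u"
proof (rule euclidean_eqI)
  fix b :: 'b assume "b \<in> Basis"
  have L: "bounded_linear (\<lambda>z. z \<bullet> b)" by (rule bounded_linear_inner_left)
  have lin: "dd (\<lambda>y. g y \<bullet> b) y w = dd g y w \<bullet> b" if "g differentiable (at y)" for g :: "'a \<Rightarrow> 'b" and y w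
    using dd_eq[OF bounded_linear.has_derivative[OF L has_derivative_dd[OF that]]] by simp
  have e: "dd (\<lambda>y. dd f y u) x v \<bullet> b = dd (\<lambda>y. dd (\<lambda>y. f y \<bullet> b) y u) x v" for u v
  proof -
    have "dd (\<lambda>y. dd f y u) x v \<bullet> b = dd (\<lambda>y. dd f y u \<bullet> b) x v"
      using lin[of "\<lambda>y. dd f y u" x v] smooth_open_differentiable[OF smooth_open_dd[OF sm] assms(2)] by simp
    also have "\<dots> = dd (\<lambda>y. dd (\<lambda>y. f y \<bullet> b) y u) x v"
      using dd_cong[OF assms(1,2), of "\<lambda>y. dd f y u \<bullet> b" "\<lambda>y. dd (\<lambda>y. f y \<bullet> b) y u"]
        lin[of f] smooth_open_differentiable[OF sm] by (auto simp: fun_eq_iff)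
    finally show ?thesis .
  qed
  show "dd (\<lambda>y. dd f y u) x v \<bullet> b = dd (\<lambda>y. dd f y v) x u \<bullet> b"
    unfolding e
    by (rule symmetric_second_derivative_real[OF assms(1,2) smooth_open_linear_image[OF L assms(1) sm]])
qed


section \<open>Change of variables for connections and curvature\<close>

lemma linear_dd_family:
  fixes A :: "'b::real_normed_vector \<Rightarrow> 'c::real_vector \<Rightarrow> 'd::real_normed_vector"
  assumes "\<And>y. linear (A y)" "\<And>v. (\<lambda>y. A y v) differentiable (at x)"
  shows "linear (\<lambda>v. dd (\<lambda>y. A y v) x u)"
proof
  fix v w r
  have d: "((\<lambda>y. A y v) has_derivative dd (\<lambda>y. A y v) x) (at x)" for v
    using assms(2) by (rule has_derivative_dd)
  have "dd (\<lambda>y. A y (v + w)) x = (\<lambda>u. dd (\<lambda>y. A y v) x u + dd (\<lambda>y. A y w) x u)"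
    using has_derivative_add[OF d[of v] d[of w]] by (intro dd_eq) (simp add: linear_add[OF assms(1)])
  then show "dd (\<lambda>y. A y (v + w)) x u = dd (\<lambda>y. A y v) x u + dd (\<lambda>y. A y w) x u" by simp
  have "dd (\<lambda>y. A y (r *\<^sub>R v)) x = (\<lambda>u. r *\<^sub>R dd (\<lambda>y. A y v) x u)"
    using has_derivative_scaleR_right[OF d[of v], of r] by (intro dd_eq) (simp add: linear_cmul[OF assms(1)])
  then show "dd (\<lambda>y. A y (r *\<^sub>R v)) x u = r *\<^sub>R dd (\<lambda>y. A y v) x u" by simp
qed

lemma linear_expand_Basis:
  fixes v :: "'c::euclidean_space"
  assumes "linear f"
  shows "f v = (\<Sum>i\<in>Basis. (v \<bullet> i) *\<^sub>R f i)"
proof -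
  have "f v = f (\<Sum>i\<in>Basis. (v \<bullet> i) *\<^sub>R i)" by (simp add: euclidean_representation)
  then show ?thesis by (simp add: linear_sum[OF assms] linear_cmul[OF assms])
qed

text \<open>Product rule for a varying linear map applied to a varying vector. Expanding the vector
  in \<open>Basis\<close> reduces differentiability of the family to that of each
  \<open>A y v\<close>. The set \<open>W\<close> confines linearity to a neighbourhood, since
  \<open>dd F y\<close> is known to be linear only where \<open>F\<close> is differentiable.\<close>

lemma has_derivative_linear_family:
  fixes A :: "'b::real_normed_vector \<Rightarrow> 'c::euclidean_space \<Rightarrow> 'd::real_normed_vector"
  assumes W: "open W" "P x \<in> W" "\<And>y. y \<in> W \<Longrightarrow> linear (A y)"
    and diff: "\<And>v. (\<lambda>y. A y v) differentiable (at (P x))"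
    and P: "(P has_derivative P') (at x)" and v: "(v has_derivative v') (at x)"
  shows "((\<lambda>z. A (P z) (v z)) has_derivative
    (\<lambda>u. dd (\<lambda>y. A y (v x)) (P x) (P' u) + A (P x) (v' u))) (at x)"
proof -
  have d: "((\<lambda>y. A y w) has_derivative dd (\<lambda>y. A y w) (P x)) (at (P x))" for w
    using diff by (rule has_derivative_dd)
  have "((\<lambda>y. \<Sum>i\<in>Basis. (v x \<bullet> i) *\<^sub>R A y i) has_derivative
      (\<lambda>s. \<Sum>i\<in>Basis. (v x \<bullet> i) *\<^sub>R dd (\<lambda>y. A y i) (P x) s)) (at (P x))"
    by (intro has_derivative_sum has_derivative_scaleR_right d)
  moreover have "(\<Sum>i\<in>Basis. (v x \<bullet> i) *\<^sub>R A y i) = A y (v x)" if "y \<in> W" for y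
    using linear_expand_Basis[OF W(3)[OF that], of "v x"] by simp
  ultimately have "((\<lambda>y. A y (v x)) has_derivative
      (\<lambda>s. \<Sum>i\<in>Basis. (v x \<bullet> i) *\<^sub>R dd (\<lambda>y. A y i) (P x) s)) (at (P x))"
    by (rule has_derivative_transform_within_open[OF _ W(1,2)]) simp
  then have e: "dd (\<lambda>y. A y (v x)) (P x) = (\<lambda>s. \<Sum>i\<in>Basis. (v x \<bullet> i) *\<^sub>R dd (\<lambda>y. A y i) (P x) s)"
    by (rule dd_eq)
  have "((\<lambda>z. \<Sum>i\<in>Basis. (v z \<bullet> i) *\<^sub>R A (P z) i) has_derivative
      (\<lambda>u. \<Sum>i\<in>Basis. (v x \<bullet> i) *\<^sub>R dd (\<lambda>y. A y i) (P x) (P' u) + (v' u \<bullet> i) *\<^sub>R A (P x) i)) (at x)"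
    by (intro has_derivative_sum has_derivative_scaleR has_derivative_compose[OF P d] has_derivative_inner_left v)
  moreover have "(\<lambda>u. \<Sum>i\<in>Basis. (v x \<bullet> i) *\<^sub>R dd (\<lambda>y. A y i) (P x) (P' u) + (v' u \<bullet> i) *\<^sub>R A (P x) i)
      = (\<lambda>u. dd (\<lambda>y. A y (v x)) (P x) (P' u) + A (P x) (v' u))"
    unfolding e sum.distrib linear_expand_Basis[OF W(3)[OF W(2)], of "v' _"] by (rule refl)
  moreover have "isCont P x" using P has_derivative_continuous by blast
  then obtain S where S: "open S" "x \<in> S" "\<And>z. z \<in> S \<Longrightarrow> P z \<in> W"
    using W(1,2) unfolding continuous_at_open by metis
  moreover have "(\<Sum>i\<in>Basis. (v z \<bullet> i) *\<^sub>R A (P z) i) = A (P z) (v z)" if "z \<in> S" for z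
    using linear_expand_Basis[OF W(3)[OF S(3)[OF that]], of "v z"] by simp
  ultimately show ?thesis
    by (auto intro: has_derivative_transform_within_open[OF _ S(1,2)])
qed

text \<open>The linear rule twice: in the first vector argument with \<open>w\<close> fixed, then in
  the second for the family \<open>B (P z) (v z)\<close> over the base point
  \<open>z\<close>.\<close>

lemma has_derivative_bilinear_family:
  fixes B :: "'b::real_normed_vector \<Rightarrow> 'c::euclidean_space \<Rightarrow> 'e::euclidean_space \<Rightarrow> 'd::real_normed_vector"
  assumes B: "\<And>y. bilinear (B y)"
    and diff: "\<And>v w. (\<lambda>y. B y v w) differentiable (at (P x))"
    and P: "(P has_derivative P') (at x)" and v: "(v has_derivative v') (at x)"
    and w: "(w has_derivative w') (at x)"
  shows "((\<lambda>z. B (P z) (v z) (w z)) has_derivative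
    (\<lambda>u. dd (\<lambda>y. B y (v x) (w x)) (P x) (P' u) + B (P x) (v' u) (w x) + B (P x) (v x) (w' u))) (at x)"
proof -
  have l: "linear (\<lambda>v. B y v w)" "linear (B y v)" for y v w
    using B by (auto simp: bilinear_def)
  have 1: "((\<lambda>z. B (P z) (v z) w) has_derivative
    (\<lambda>u. dd (\<lambda>y. B y (v x) w) (P x) (P' u) + B (P x) (v' u) w)) (at x)" for w
    by (rule has_derivative_linear_family[OF open_UNIV _ _ _ P v, of "\<lambda>y v. B y v w"]) (auto intro: l diff)
  have "((\<lambda>z. B (P z) (v z) (w z)) has_derivative
    (\<lambda>u. dd (\<lambda>z. B (P z) (v z) (w x)) x u + B (P x) (v x) (w' u))) (at x)"
    by (rule has_derivative_linear_family[OF open_UNIV _ _ _ has_derivative_ident w, of "\<lambda>z. B (P z) (v z)"])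
      (use 1 in \<open>auto intro: l simp: differentiable_def\<close>)
  then show ?thesis by (simp add: dd_eq[OF 1])
qed

text \<open>Koszul formula on constant vector fields, whose Lie brackets vanish. For definite
  \<open>G\<close> it determines \<open>B x\<close>, so two connections can be compared without
  inverse matrices or indices.\<close>

definition levi_civita ::
  "('a::real_normed_vector \<Rightarrow> 'a \<Rightarrow> 'a \<Rightarrow> real) \<Rightarrow> ('a \<Rightarrow> 'a \<Rightarrow> 'a \<Rightarrow> 'a) \<Rightarrow> 'a \<Rightarrow> bool" where
  "levi_civita G B x \<longleftrightarrow> (\<forall>v w u. 2 * G x (B x v w) u =
     dd (\<lambda>y. G y w u) x v + dd (\<lambda>y. G y v u) x w - dd (\<lambda>y. G y v w) x u)"

text \<open>R(u,v)w of the connection d + \<open>B\<close>, evaluated on constant fields; sign and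
  order of arguments follow the convention of \<open>riemann\<close>.\<close>

definition curv ::
  "('a::real_normed_vector \<Rightarrow> 'a \<Rightarrow> 'a \<Rightarrow> 'a) \<Rightarrow> 'a \<Rightarrow> 'a \<Rightarrow> 'a \<Rightarrow> 'a \<Rightarrow> 'a" where
  "curv B x u v w = dd (\<lambda>y. B y v w) x u - dd (\<lambda>y. B y u w) x v + B x u (B x v w) - B x v (B x u w)"

definition endo_trace :: "('a::euclidean_space \<Rightarrow> 'a) \<Rightarrow> real" where
  "endo_trace L = (\<Sum>b\<in>Basis. L b \<bullet> b)"

definition ric ::
  "('a::euclidean_space \<Rightarrow> 'a \<Rightarrow> 'a \<Rightarrow> 'a) \<Rightarrow> 'a \<Rightarrow> 'a \<Rightarrow> 'a \<Rightarrow> real" where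
  "ric B x v w = endo_trace (\<lambda>u. curv B x u v w)"

lemma endo_trace_commute:
  fixes S :: "'b::euclidean_space \<Rightarrow> 'a::euclidean_space"
  assumes "linear S" "linear T"
  shows "endo_trace (\<lambda>x. S (T x)) = endo_trace (\<lambda>y. T (S y))"
proof -
  have "endo_trace (\<lambda>x. S (T x)) = (\<Sum>a\<in>Basis. \<Sum>b\<in>Basis. (T a \<bullet> b) * (S b \<bullet> a))"
    unfolding endo_trace_def by (subst linear_expand_Basis[OF assms(1)]) (simp add: inner_sum_left)
  also have "\<dots> = (\<Sum>b\<in>Basis. \<Sum>a\<in>Basis. (S b \<bullet> a) * (T a \<bullet> b))"
    by (subst sum.swap) (simp add: mult.commute)
  also have "\<dots> = endo_trace (\<lambda>y. T (S y))"
    unfolding endo_trace_def by (subst (2) linear_expand_Basis[OF assms(2)]) (simp add: inner_sum_left)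
  finally show ?thesis .
qed

text \<open>\<open>T\<close> may join different spaces, later \<open>real \<times> real^k\<close>
  and \<open>real^n\<close>. After writing \<open>L'\<close> as the conjugate of \<open>L\<close> by
  \<open>T\<close>, the claim is cyclicity of the trace.\<close>

lemma endo_trace_similar:
  fixes T :: "'a::euclidean_space \<Rightarrow> 'b::euclidean_space"
  assumes "linear T" "bij T" "linear L" "\<And>x. T (L' x) = L (T x)"
  shows "endo_trace L' = endo_trace L"
proof -
  define S where "S = inv T"
  have S: "linear S" unfolding S_def
    using assms(1,2) by (metis bij_def id_comp linear_injective_left_inverse o_inv_o_cancel surj_imp_inj_inv)
  have ST: "S (T x) = x" "T (S y) = y" for x y
    using assms(2) by (simp_all add: S_def bij_is_inj bij_is_surj surj_f_inv_f)
  have "L' = (\<lambda>x. S (L (T x)))" using assms(4) ST by (metis (no_types, lifting))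
  then have "endo_trace L' = endo_trace (\<lambda>x. S ((L \<circ> T) x))" by simp
  also have "\<dots> = endo_trace (\<lambda>y. (L \<circ> T) (S y))"
    by (rule endo_trace_commute[OF S linear_compose[OF assms(1,3)]])
  finally show ?thesis by (simp add: ST)
qed

text \<open>Differentiating the pulled-back metric yields Hessian terms of \<open>F\<close>, and
  their Koszul combination is twice a single Hessian. Hence the difference \<open>z\<close> of the
  two sides is orthogonal to the range of \<open>dd F x\<close>, which is everything; definiteness
  gives \<open>z = 0\<close>.\<close>

lemma levi_civita_pullback:
  fixes F :: "'a::euclidean_space \<Rightarrow> 'b::euclidean_space"
  assumes V: "open V" "x \<in> V" and F: "smooth_open V F" "surj (dd F x)"
    and G: "\<And>y. bilinear (G y)" "\<And>v w. (\<lambda>y. G y v w) differentiable (at (F x))"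
      "\<And>v w. G (F x) v w = G (F x) w v" "\<And>v. v \<noteq> 0 \<Longrightarrow> G (F x) v v > 0"
    and G': "\<And>y v w. y \<in> V \<Longrightarrow> G' y v w = G (F y) (dd F y v) (dd F y w)"
    and lc: "levi_civita G B (F x)" "levi_civita G' B' x"
  shows "dd F x (B' x v w) = dd (\<lambda>y. dd F y w) x v + B (F x) (dd F x v) (dd F x w)"
proof -
  let ?H = "\<lambda>u v. dd (\<lambda>y. dd F y v) x u"
  have sym: "?H u v = ?H v u" for u v
    by (rule symmetric_second_derivative[OF V F(1)])
  have dF: "(F has_derivative dd F x) (at x)"
    "((\<lambda>y. dd F y v) has_derivative (\<lambda>u. ?H u v)) (at x)" for v
    using smooth_open_differentiable[OF F(1) V(2)] smooth_open_differentiable[OF smooth_open_dd[OF F(1)] V(2)]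
    by (auto intro: has_derivative_dd simp: eta_contract_eq)
  have dG: "dd (\<lambda>y. G' y v w) x u = dd (\<lambda>y. G y (dd F x v) (dd F x w)) (F x) (dd F x u)
      + G (F x) (?H u v) (dd F x w) + G (F x) (dd F x v) (?H u w)" for u v w
  proof -
    have "dd (\<lambda>y. G' y v w) x = dd (\<lambda>y. G (F y) (dd F y v) (dd F y w)) x"
      by (rule dd_cong[OF V]) (simp add: G')
    then show ?thesis using dd_eq[OF has_derivative_bilinear_family[OF G(1,2) dF(1) dF(2) dF(2)]] by simp
  qed
  have l: "linear (\<lambda>v. G y v w)" "linear (G y v)" for y v w
    using G(1) by (auto simp: bilinear_def)
  define z where "z = dd F x (B' x v w) - ?H v w - B (F x) (dd F x v) (dd F x w)"
  have "G (F x) z (dd F x u) = 0" for u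
  proof -
    have "2 * G (F x) (dd F x (B' x v w)) (dd F x u) = 2 * G' x (B' x v w) u"
      by (simp add: G'[OF V(2)])
    also have "\<dots> = dd (\<lambda>y. G' y w u) x v + dd (\<lambda>y. G' y v u) x w - dd (\<lambda>y. G' y v w) x u"
      using lc(2) by (simp add: levi_civita_def)
    \<comment> \<open>Of the six Hessian terms four cancel in pairs, by symmetry of the Hessian and
      of \<open>G\<close>; the remaining two coincide.\<close>
    also have "\<dots> = 2 * G (F x) (B (F x) (dd F x v) (dd F x w)) (dd F x u) + 2 * G (F x) (?H v w) (dd F x u)"
      using lc(1)[unfolded levi_civita_def, rule_format, of "dd F x v" "dd F x w" "dd F x u"]
        G(3)[of "dd F x w" "?H v u"] unfolding dG sym[of u v] sym[of u w] sym[of w v]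
      by linarith
    finally show ?thesis unfolding z_def by (simp add: linear_diff[OF l(1)])
  qed
  then have "G (F x) z z = 0" using F(2) by (metis surjD)
  then have "z = 0" using G(4) by force
  then show ?thesis by (simp add: z_def algebra_simps)
qed

text \<open>Antisymmetrise the derivative of the gauge law \<open>rel\<close> in \<open>u\<close>
  and \<open>v\<close>. Third derivatives of \<open>F\<close> drop out by symmetry; each Hessian
  term is either part of an expression symmetric in \<open>u\<close> and \<open>v\<close> or is
  traded for connection terms by \<open>rel\<close> itself.\<close>

lemma curv_pullback:
  fixes F :: "'a::euclidean_space \<Rightarrow> 'b::euclidean_space"
  assumes V: "open V" "x \<in> V" and F: "smooth_open V F"
    and B: "\<And>y. bilinear (B y)" "\<And>v w. (\<lambda>y. B y v w) differentiable (at (F x))"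
    and B': "\<And>v w. (\<lambda>y. B' y v w) differentiable (at x)"
    and rel: "\<And>y v w. y \<in> V \<Longrightarrow> dd F y (B' y v w) = dd (\<lambda>y. dd F y w) y v + B (F y) (dd F y v) (dd F y w)"
  shows "dd F x (curv B' x u v w) = curv B (F x) (dd F x u) (dd F x v) (dd F x w)"
proof -
  let ?H = "\<lambda>u v. dd (\<lambda>y. dd F y v) x u"
  have sym: "?H u v = ?H v u" for u v
    by (rule symmetric_second_derivative[OF V F])
  have dF: "(F has_derivative dd F x) (at x)"
    "((\<lambda>y. dd F y v) has_derivative (\<lambda>u. ?H u v)) (at x)"
    "((\<lambda>y. dd (\<lambda>y. dd F y w) y v) has_derivative dd (\<lambda>y. dd (\<lambda>y. dd F y w) y v) x) (at x)" for v w
    using smooth_open_differentiable[OF F V(2)] smooth_open_differentiable[OF smooth_open_dd[OF F] V(2)]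
      smooth_open_differentiable[OF smooth_open_dd[OF smooth_open_dd[OF F]] V(2)]
    by (auto intro: has_derivative_dd simp: eta_contract_eq)
  have sym3: "dd (\<lambda>y. dd (\<lambda>y. dd F y w) y v) x u = dd (\<lambda>y. dd (\<lambda>y. dd F y w) y u) x v"
    by (rule symmetric_second_derivative[OF V smooth_open_dd[OF F]])
  have linF: "linear (dd F y)" if "y \<in> V" for y
    using has_derivative_linear[OF has_derivative_dd[OF smooth_open_differentiable[OF F that]]] .
  note lF = linear_add[OF linF[OF V(2)]] linear_diff[OF linF[OF V(2)]]
  have l: "linear (\<lambda>v. B y v w)" "linear (B y v)" for y v w
    using B(1) by (auto simp: bilinear_def)
  \<comment> \<open>Both sides of \<open>rel\<close> differentiated in direction \<open>u\<close>:
    the left by the product rule for \<open>dd F\<close>, the right by the one for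
    \<open>B\<close>.\<close>
  have key: "?H u (B' x v w) + dd F x (dd (\<lambda>y. B' y v w) x u)
     = dd (\<lambda>y. dd (\<lambda>y. dd F y w) y v) x u
       + (dd (\<lambda>y. B y (dd F x v) (dd F x w)) (F x) (dd F x u) + B (F x) (?H u v) (dd F x w) + B (F x) (dd F x v) (?H u w))"
    for u v
  proof -
    have "((\<lambda>y. dd F y (B' y v w)) has_derivative (\<lambda>u. ?H u (B' x v w) + dd F x (dd (\<lambda>y. B' y v w) x u))) (at x)"
      by (rule has_derivative_linear_family[OF V(1) _ linF _ has_derivative_ident has_derivative_dd[OF B']])
        (use V dF(2) in \<open>auto simp: differentiable_def\<close>)
    moreover have "((\<lambda>y. dd (\<lambda>y. dd F y w) y v + B (F y) (dd F y v) (dd F y w)) has_derivative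
       (\<lambda>u. dd (\<lambda>y. dd (\<lambda>y. dd F y w) y v) x u + (dd (\<lambda>y. B y (dd F x v) (dd F x w)) (F x) (dd F x u)
         + B (F x) (?H u v) (dd F x w) + B (F x) (dd F x v) (?H u w)))) (at x)"
      by (intro has_derivative_add dF(3) has_derivative_bilinear_family[OF B(1,2) dF(1) dF(2) dF(2)])
    ultimately show ?thesis
      using dd_cong[OF V, of "\<lambda>y. dd F y (B' y v w)" "\<lambda>y. dd (\<lambda>y. dd F y w) y v + B (F y) (dd F y v) (dd F y w)"]
      by (simp add: rel dd_eq fun_eq_iff)
  qed
  have r: "?H u z = dd F x (B' x u z) - B (F x) (dd F x u) (dd F x z)" for u z
    using rel[OF V(2), of u z] by simp
  \<comment> \<open>The previous identity solved for the derivative of \<open>B'\<close>. Rewriting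
    the Hessian at \<open>B' x v w\<close> by the gauge law produces the quadratic terms of both
    curvatures; the other Hessian and third-order terms are symmetric in \<open>u\<close> and
    \<open>v\<close>.\<close>
  have k1: "dd F x (dd (\<lambda>y. B' y v w) x u) = dd (\<lambda>y. dd (\<lambda>y. dd F y w) y v) x u
       + (dd (\<lambda>y. B y (dd F x v) (dd F x w)) (F x) (dd F x u) + B (F x) (?H u v) (dd F x w) + B (F x) (dd F x v) (?H u w))
       - (dd F x (B' x u (B' x v w)) - B (F x) (dd F x u) (?H v w + B (F x) (dd F x v) (dd F x w)))" for u v
    using key[where u = u and v = v] r[where u = u and z = "B' x v w"] rel[OF V(2), of v w] by (simp add: algebra_simps)
  show ?thesis
    unfolding curv_def lF k1 using sym[of u v] sym3
    by (simp add: linear_add[OF l(2)])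
qed

text \<open>By \<open>curv_pullback\<close> the bijection \<open>dd F x\<close> conjugates the two
  endomorphisms whose traces define \<open>ric\<close>.\<close>

lemma ric_pullback:
  fixes F :: "'a::euclidean_space \<Rightarrow> 'b::euclidean_space"
  assumes V: "open V" "x \<in> V" and F: "smooth_open V F" "bij (dd F x)"
    and B: "\<And>y. bilinear (B y)" "\<And>v w. (\<lambda>y. B y v w) differentiable (at (F x))"
    and B': "\<And>v w. (\<lambda>y. B' y v w) differentiable (at x)"
    and rel: "\<And>y v w. y \<in> V \<Longrightarrow> dd F y (B' y v w) = dd (\<lambda>y. dd F y w) y v + B (F y) (dd F y v) (dd F y w)"
  shows "ric B' x v w = ric B (F x) (dd F x v) (dd F x w)"
  unfolding ric_def
proof (rule endo_trace_similar[OF _ F(2)])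
  show "linear (dd F x)"
    using has_derivative_linear[OF has_derivative_dd[OF smooth_open_differentiable[OF F(1) V(2)]]] .
  have l: "linear (\<lambda>v. B y v w)" "linear (B y v)" for y v w
    using B(1) by (auto simp: bilinear_def)
  let ?y = "F x"
  have l3: "linear (dd (\<lambda>y. B y v w) ?y)" for v w
    using has_derivative_linear[OF has_derivative_dd[OF B(2)]] .
  have l4: "linear (\<lambda>u. dd (\<lambda>y. B y u w) ?y v)" for v w
    by (rule linear_dd_family[of "\<lambda>y u. B y u w"]) (auto intro: l B(2))
  have l5: "linear (\<lambda>u. B ?y v (B ?y u w))" for v w
    using linear_compose[OF l(1)[of ?y w] l(2)[of ?y v]] by (simp add: o_def)
  show "linear (\<lambda>u. curv B ?y u (dd F x v) (dd F x w))"
    unfolding curv_def by (intro linear_compose_add linear_compose_sub l l3 l4 l5)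
  show "dd F x (curv B' x u v w) = curv B (F x) (dd F x u) (dd F x v) (dd F x w)" for u
    by (rule curv_pullback[OF V F(1) B B' rel])
qed


section \<open>Curvature in coordinates\<close>

lemma differentiable_linear_image:
  "bounded_linear L \<Longrightarrow> f differentiable (at x) \<Longrightarrow> (\<lambda>y. L (f y)) differentiable (at x)"
  unfolding differentiable_def using bounded_linear.has_derivative by blast

lemma dd_linear_image:
  "bounded_linear L \<Longrightarrow> f differentiable (at x) \<Longrightarrow> dd (\<lambda>y. L (f y)) x v = L (dd f x v)"
  using dd_eq[OF bounded_linear.has_derivative[OF _ has_derivative_dd]] by metis

lemma bounded_linear_entry: "bounded_linear (\<lambda>M :: real ^ 'n ^ 'm. M $ i $ j)"
  by (intro bounded_linear_compose[OF bounded_linear_vec_nth bounded_linear_vec_nth])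

lemma bounded_linear_form:
  "bounded_linear (\<lambda>M :: real ^ 'n::finite ^ 'm::finite. v \<bullet> (M *v w))"
  by (rule linear_conv_bounded_linear[THEN iffD1])
    (auto intro!: linearI simp: matrix_vector_mult_add_rdistrib inner_add_right scaleR_matrix_vector_assoc[symmetric])

lemma has_derivative_vec_lambda:
  fixes f :: "'a::real_normed_vector \<Rightarrow> real ^ 'n::finite"
  assumes "\<And>i. (\<lambda>y. f y $ i) differentiable (at x)"
  shows "(f has_derivative (\<lambda>u. \<chi> i. dd (\<lambda>y. f y $ i) x u)) (at x)"
proof -
  have "((\<lambda>y. f y \<bullet> b) has_derivative (\<lambda>u. (\<chi> i. dd (\<lambda>y. f y $ i) x u) \<bullet> b)) (at x)"
    if "b \<in> Basis" for b
  proof -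
    obtain i where b: "b = axis i 1" using \<open>b \<in> Basis\<close> by (auto simp: Basis_vec_def)
    show ?thesis using has_derivative_dd[OF assms[of i]] by (simp add: b inner_axis)
  qed
  then show ?thesis using has_derivative_componentwise_within[of f _ x UNIV] by simp
qed

lemma dd_vec_nth:
  fixes f :: "'a::real_normed_vector \<Rightarrow> real ^ 'n::finite"
  assumes "\<And>i. (\<lambda>y. f y $ i) differentiable (at x)"
  shows "dd f x u $ i = dd (\<lambda>y. f y $ i) x u"
  by (simp add: dd_eq[OF has_derivative_vec_lambda[OF assms]])

lemma differentiable_sum_finite:
  fixes f :: "'i \<Rightarrow> 'a::real_normed_vector \<Rightarrow> 'b::real_normed_vector"
  assumes "\<And>i. i \<in> I \<Longrightarrow> f i differentiable (at x)"
  shows "(\<lambda>y. \<Sum>i\<in>I. f i y) differentiable (at x)"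
  using assms by (cases "finite I") auto

lemma invertible_mult_matrix_inv:
  fixes A :: "'a::semiring_1 ^ 'n ^ 'n"
  assumes "invertible A"
  shows "A ** matrix_inv A = mat 1" "matrix_inv A ** A = mat 1"
  using someI_ex[OF assms[unfolded invertible_def]] by (simp_all add: matrix_inv_def)

lemma differentiable_det:
  fixes M :: "'a::real_normed_vector \<Rightarrow> real ^ 'n ^ 'n::finite"
  assumes "\<And>i j. (\<lambda>y. M y $ i $ j) differentiable (at x)"
  shows "(\<lambda>y. det (M y)) differentiable (at x)"
proof -
  have "(\<lambda>y. \<Prod>i\<in>UNIV. M y $ i $ p i) differentiable (at x)" for p
    using has_derivative_prod[of UNIV "\<lambda>i y. M y $ i $ p i" _ x UNIV, OF has_derivative_dd[OF assms]]
    unfolding differentiable_def by blast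
  then show ?thesis
    unfolding det_def by (intro differentiable_sum_finite differentiable_mult) auto
qed

text \<open>Cramer's rule for the columns of the inverse. It exhibits the entries as quotients of
  determinants, from which their differentiability is read off.\<close>

lemma matrix_inv_nth_cramer:
  fixes A :: "real ^ 'n ^ 'n::finite"
  assumes "det A \<noteq> 0"
  shows "matrix_inv A $ k $ l = det (\<chi> i j. if j = k then axis l 1 $ i else A $ i $ j) / det A"
proof -
  have "A *v (matrix_inv A *v axis l 1) = axis l 1"
    using assms by (simp add: matrix_vector_mul_assoc invertible_mult_matrix_inv invertible_det_nz)
  then have "matrix_inv A *v axis l 1 = (\<chi> k. det (\<chi> i j. if j = k then axis l 1 $ i else A $ i $ j) / det A)"
    using cramer[OF assms] by blast
  moreover have "matrix_inv A $ k $ l = (matrix_inv A *v axis l 1) $ k"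
    by (simp add: matrix_vector_mult_basis column_def)
  ultimately show ?thesis by simp
qed

lemma differentiable_matrix_inv:
  fixes M :: "'a::real_normed_vector \<Rightarrow> real ^ 'n ^ 'n::finite"
  assumes "open W" "x \<in> W" "\<And>y. y \<in> W \<Longrightarrow> invertible (M y)"
    and "\<And>i j. (\<lambda>y. M y $ i $ j) differentiable (at x)"
  shows "(\<lambda>y. matrix_inv (M y) $ k $ l) differentiable (at x)"
proof (rule differentiable_cong_open[OF assms(1,2)])
  show "(\<lambda>y. det (\<chi> i j. if j = k then axis l 1 $ i else M y $ i $ j) / det (M y)) differentiable (at x)"
  proof (intro differentiable_divide differentiable_det)
    show "(\<lambda>y. (\<chi> i j. if j = k then axis l 1 $ i else M y $ i $ j) $ i $ j) differentiable (at x)" for i j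
      using assms(4)[of i j] by (cases "j = k") auto
  qed (use assms in \<open>auto simp: invertible_det_nz\<close>)
  show "det (\<chi> i j. if j = k then axis l 1 $ i else M y $ i $ j) / det (M y) = matrix_inv (M y) $ k $ l"
    if "y \<in> W" for y
    using matrix_inv_nth_cramer[of "M y"] assms(3)[OF that] by (simp add: invertible_det_nz)
qed

definition metric_form :: "(real ^ 'n \<Rightarrow> real ^ 'n ^ 'n) \<Rightarrow> real ^ 'n \<Rightarrow> real ^ 'n \<Rightarrow> real ^ 'n::finite \<Rightarrow> real" where
  "metric_form G y v w = v \<bullet> (G y *v w)"

definition christoffel_map ::
  "(real ^ 'n \<Rightarrow> real ^ 'n ^ 'n) \<Rightarrow> real ^ 'n \<Rightarrow> real ^ 'n \<Rightarrow> real ^ 'n \<Rightarrow> real ^ 'n::finite" where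
  "christoffel_map G y v w = (\<chi> k. \<Sum>i\<in>UNIV. \<Sum>j\<in>UNIV. christoffel G k i j y * v $ i * w $ j)"

lemma bilinear_metric_form: "bilinear (metric_form G y)"
  unfolding bilinear_def metric_form_def
  by (auto intro!: linearI simp: inner_add_left inner_add_right algebra_simps matrix_vector_right_distrib
      matrix_vector_mult_scaleR)

lemma bilinear_christoffel_map: "bilinear (christoffel_map G y)"
  unfolding bilinear_def christoffel_map_def
  by (auto intro!: linearI simp: vec_eq_iff algebra_simps sum.distrib sum_distrib_left)

lemma christoffel_map_axis:
  "christoffel_map G y (axis i 1) (axis j 1) $ k = christoffel G k i j y"
proof -
  have "christoffel G k a b y * axis i 1 $ a * axis j 1 $ b =
      (if b = j then if a = i then christoffel G k a b y else 0 else 0)" for a b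
    by (simp add: axis_def)
  then show ?thesis by (simp add: christoffel_map_def)
qed

lemma partial_eq_dd: "partial i F y = dd F y (axis i 1)"
  by (simp add: partial_def dd_def)

lemma bilinear_curv:
  fixes B :: "'a::euclidean_space \<Rightarrow> 'a \<Rightarrow> 'a \<Rightarrow> 'a"
  assumes B: "\<And>y. bilinear (B y)" "\<And>v w. (\<lambda>y. B y v w) differentiable (at x)"
  shows "bilinear (curv B x u)"
proof -
  have l: "linear (\<lambda>v. B y v w)" "linear (B y v)" for y v w
    using B(1) by (auto simp: bilinear_def)
  have l1: "linear (\<lambda>w. dd (\<lambda>y. B y v w) x u)" for v u
    by (rule linear_dd_family[of "\<lambda>y w. B y v w"]) (auto intro: l B(2))
  have l2: "linear (\<lambda>w. dd (\<lambda>y. B y w v) x u)" for v u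
    by (rule linear_dd_family[of "\<lambda>y w. B y w v"]) (auto intro: l B(2))
  have l3: "linear (dd (\<lambda>y. B y v w) x)" for v w
    using has_derivative_linear[OF has_derivative_dd[OF B(2)]] .
  have l4: "linear (\<lambda>w. B x u (B x v w))" "linear (\<lambda>w. B x u (B x w v))" for u v
    using linear_compose[OF l(2)[of x v] l(2)[of x u]] linear_compose[OF l(1)[of x v] l(2)[of x u]] by (simp_all add: o_def)
  show ?thesis
    unfolding bilinear_def curv_def
    by (intro conjI allI linear_compose_add linear_compose_sub l l1 l2 l3 l4)
qed

lemma bilinear_ric:
  fixes B :: "'a::euclidean_space \<Rightarrow> 'a \<Rightarrow> 'a \<Rightarrow> 'a"
  assumes B: "\<And>y. bilinear (B y)" "\<And>v w. (\<lambda>y. B y v w) differentiable (at x)"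
  shows "bilinear (ric B x)"
proof -
  have l: "linear (\<lambda>v. curv B x u v w)" "linear (curv B x u v)" for u v w
    using bilinear_curv[OF B] by (auto simp: bilinear_def)
  show ?thesis
    unfolding bilinear_def ric_def endo_trace_def
    by (auto intro!: linear_compose_sum linearI simp: linear_add[OF l(1)] linear_add[OF l(2)]
        linear_cmul[OF l(1)] linear_cmul[OF l(2)] inner_add_left sum.distrib sum_distrib_left)
qed

lemma linear_expand_axis:
  fixes v :: "real ^ 'n::finite"
  assumes "linear f"
  shows "f v = (\<Sum>i\<in>UNIV. v $ i *\<^sub>R f (axis i 1))"
proof -
  have "f v = f (\<Sum>i\<in>UNIV. v $ i *s axis i 1)" by (simp add: basis_expansion)
  then show ?thesis
    by (simp add: linear_sum[OF assms] linear_cmul[OF assms] scalar_mult_eq_scaleR)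
qed

text \<open>A metric on one coordinate domain, detached from charts so that the same facts serve
  \<open>X\<close> and the cross-sections of the ends.\<close>

locale riemannian_coords =
  fixes W :: "(real ^ 'n::finite) set" and G :: "real ^ 'n \<Rightarrow> real ^ 'n ^ 'n"
  assumes W: "open W" and G: "smooth_open W G"
    and sym: "\<And>y. y \<in> W \<Longrightarrow> transpose (G y) = G y"
    and pos: "\<And>y v. y \<in> W \<Longrightarrow> v \<noteq> 0 \<Longrightarrow> v \<bullet> (G y *v v) > 0"
begin

lemma metric_invertible: "y \<in> W \<Longrightarrow> invertible (G y)"
proof -
  assume y: "y \<in> W"
  have "inj ((*v) (G y))"
    using pos[OF y] unfolding matrix_left_invertible_injective[symmetric] matrix_left_invertible_ker by force
  then show ?thesis by (simp add: invertible_left_inverse matrix_left_invertible_injective)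
qed

lemma metric_entry_differentiable:
  assumes "y \<in> W"
  shows "(\<lambda>z. G z $ i $ j) differentiable (at y)" "(\<lambda>z. dd (\<lambda>z. G z $ i $ j) z v) differentiable (at y)"
  using smooth_open_linear_image[OF bounded_linear_entry W G] assms
  by (auto intro: smooth_open_differentiable smooth_open_dd)

lemma metric_form_differentiable:
  "y \<in> W \<Longrightarrow> (\<lambda>z. metric_form G z v w) differentiable (at y)"
  unfolding metric_form_def
  by (intro differentiable_linear_image[OF bounded_linear_form] smooth_open_differentiable[OF G])

lemma christoffel_differentiable:
  assumes y: "y \<in> W"
  shows "christoffel G k i j differentiable (at y)"
  unfolding christoffel_def[abs_def] partial_eq_dd
  by (intro differentiable_mult differentiable_sum_finite differentiable_add differentiable_diff differentiable_const
      differentiable_matrix_inv[OF W y metric_invertible] metric_entry_differentiable y) auto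

lemma christoffel_map_differentiable:
  assumes y: "y \<in> W"
  shows "(\<lambda>z. christoffel_map G z v w) differentiable (at y)"
proof -
  have "(\<lambda>z. christoffel_map G z v w $ k) differentiable (at y)" for k
    unfolding christoffel_map_def
    by (simp, intro differentiable_mult differentiable_sum_finite differentiable_const christoffel_differentiable y)
  then show ?thesis by (rule differentiableI[OF has_derivative_vec_lambda])
qed

text \<open>Lowering the upper index: multiplication by \<open>G y\<close> cancels the inverse
  matrix in \<open>christoffel\<close>, and the three sums that remain are, after renaming indices,
  the metric derivatives of the Koszul formula.\<close>

lemma levi_civita_christoffel_map:
  assumes y: "y \<in> W"
  shows "levi_civita (metric_form G) (christoffel_map G) y"
  unfolding levi_civita_def
proof (intro allI)
  fix v w u
  define p where "p i j l = partial i (\<lambda>z. G z $ j $ l) y" for i j l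
  have rot: "(\<Sum>l\<in>UNIV. \<Sum>i\<in>UNIV. \<Sum>j\<in>UNIV. F l i j) = (\<Sum>i\<in>UNIV. \<Sum>j\<in>UNIV. \<Sum>l\<in>UNIV. F l i j)"
    for F :: "'n \<Rightarrow> 'n \<Rightarrow> 'n \<Rightarrow> real"
    by (rule trans[OF sum.swap sum.cong[OF refl sum.swap]])
  define t where "t v w = (\<chi> l. \<Sum>i\<in>UNIV. \<Sum>j\<in>UNIV. (p i j l + p j i l - p l i j) * v $ i * w $ j)" for v w :: "real ^ 'n"
  have "2 *\<^sub>R christoffel_map G y v w = matrix_inv (G y) *v t v w"
  proof (subst vec_eq_iff, rule allI)
    fix k
    let ?M = "matrix_inv (G y)"
    have "(2 *\<^sub>R christoffel_map G y v w) $ k =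
      (\<Sum>i\<in>UNIV. \<Sum>j\<in>UNIV. \<Sum>l\<in>UNIV. ?M $ k $ l * ((p i j l + p j i l - p l i j) * v $ i * w $ j))"
      unfolding christoffel_map_def christoffel_def p_def
      by (simp add: sum_distrib_left sum_distrib_right mult.assoc)
    also have "\<dots> = (\<Sum>i\<in>UNIV. \<Sum>l\<in>UNIV. \<Sum>j\<in>UNIV. ?M $ k $ l * ((p i j l + p j i l - p l i j) * v $ i * w $ j))"
      by (intro sum.cong refl sum.swap)
    also have "\<dots> = (\<Sum>l\<in>UNIV. \<Sum>i\<in>UNIV. \<Sum>j\<in>UNIV. ?M $ k $ l * ((p i j l + p j i l - p l i j) * v $ i * w $ j))"
      by (rule sum.swap)
    also have "\<dots> = (?M *v t v w) $ k"
      by (simp add: t_def matrix_vector_mult_def sum_distrib_left)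
    finally show "(2 *\<^sub>R christoffel_map G y v w) $ k = (?M *v t v w) $ k" .
  qed
  then have "G y *v (2 *\<^sub>R christoffel_map G y v w) = t v w"
    by (simp add: matrix_vector_mul_assoc invertible_mult_matrix_inv metric_invertible[OF y])
  moreover have "a \<bullet> (G y *v b) = (G y *v a) \<bullet> b" for a b
    using sym[OF y] by (metis dot_lmul_matrix vector_transpose_matrix)
  ultimately have "2 * metric_form G y (christoffel_map G y v w) u = t v w \<bullet> u"
    unfolding metric_form_def by (simp add: matrix_vector_mult_scaleR flip: inner_scaleR_left)
  also have "\<dots> = (\<Sum>l\<in>UNIV. \<Sum>i\<in>UNIV. \<Sum>j\<in>UNIV. p i j l * v $ i * w $ j * u $ l)
      + (\<Sum>l\<in>UNIV. \<Sum>i\<in>UNIV. \<Sum>j\<in>UNIV. p j i l * v $ i * w $ j * u $ l)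
      - (\<Sum>l\<in>UNIV. \<Sum>i\<in>UNIV. \<Sum>j\<in>UNIV. p l i j * v $ i * w $ j * u $ l)"
    by (simp add: t_def inner_vec_def sum_distrib_left sum_distrib_right sum.distrib sum_subtractf algebra_simps)
  also have "(\<Sum>l\<in>UNIV. \<Sum>i\<in>UNIV. \<Sum>j\<in>UNIV. p i j l * v $ i * w $ j * u $ l)
      = (\<Sum>i\<in>UNIV. \<Sum>j\<in>UNIV. \<Sum>l\<in>UNIV. p i j l * v $ i * w $ j * u $ l)"
    by (rule rot)
  also have "(\<Sum>l\<in>UNIV. \<Sum>i\<in>UNIV. \<Sum>j\<in>UNIV. p j i l * v $ i * w $ j * u $ l)
      = (\<Sum>j\<in>UNIV. \<Sum>i\<in>UNIV. \<Sum>l\<in>UNIV. p j i l * w $ j * v $ i * u $ l)"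
    by (rule trans[OF rot], rule trans[OF sum.swap]) (simp add: mult_ac)
  also have "(\<Sum>l\<in>UNIV. \<Sum>i\<in>UNIV. \<Sum>j\<in>UNIV. p l i j * v $ i * w $ j * u $ l)
     = (\<Sum>l\<in>UNIV. \<Sum>i\<in>UNIV. \<Sum>j\<in>UNIV. p l i j * u $ l * v $ i * w $ j)"
    by (simp add: mult_ac)
  finally have 1: "2 * metric_form G y (christoffel_map G y v w) u =
     (\<Sum>i\<in>UNIV. \<Sum>j\<in>UNIV. \<Sum>l\<in>UNIV. p i j l * v $ i * w $ j * u $ l)
     + (\<Sum>j\<in>UNIV. \<Sum>i\<in>UNIV. \<Sum>l\<in>UNIV. p j i l * w $ j * v $ i * u $ l)
     - (\<Sum>l\<in>UNIV. \<Sum>i\<in>UNIV. \<Sum>j\<in>UNIV. p l i j * u $ l * v $ i * w $ j)" .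
  have 2: "dd (\<lambda>z. metric_form G z a b) y c = (\<Sum>i\<in>UNIV. \<Sum>j\<in>UNIV. \<Sum>l\<in>UNIV. p i j l * c $ i * a $ j * b $ l)" for a b c
  proof -
    have "dd (\<lambda>z. metric_form G z a b) y c = a \<bullet> (dd G y c *v b)"
      unfolding metric_form_def
      by (rule dd_linear_image[OF bounded_linear_form smooth_open_differentiable[OF G y]])
    also have "\<dots> = (\<Sum>i\<in>UNIV. c $ i *\<^sub>R (a \<bullet> (dd G y (axis i 1) *v b)))"
    proof -
      have "linear (dd G y)"
        using has_derivative_linear[OF has_derivative_dd[OF smooth_open_differentiable[OF G y]]] .
      then have "linear (\<lambda>c. a \<bullet> (dd G y c *v b))"
        using linear_compose[OF _ bounded_linear.linear[OF bounded_linear_form[of a b]], of "dd G y"] by (simp add: o_def)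
      then show ?thesis by (rule linear_expand_axis)
    qed
    also have "\<dots> = (\<Sum>i\<in>UNIV. \<Sum>j\<in>UNIV. \<Sum>l\<in>UNIV. p i j l * c $ i * a $ j * b $ l)"
      unfolding p_def partial_eq_dd
      by (simp add: dd_linear_image[OF bounded_linear_entry smooth_open_differentiable[OF G y]]
          inner_vec_def matrix_vector_mult_def sum_distrib_left mult_ac)
    finally show ?thesis .
  qed
  show "2 * metric_form G y (christoffel_map G y v w) u =
    dd (\<lambda>z. metric_form G z w u) y v + dd (\<lambda>z. metric_form G z v u) y w - dd (\<lambda>z. metric_form G z v w) y u"
    unfolding 1 2 by simp
qed

text \<open>Both sides are bilinear in \<open>v\<close> and \<open>w\<close>, so axis vectors
  suffice; there component \<open>l\<close> of \<open>curv\<close> with first argument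
  \<open>axis l 1\<close> is the summand of \<open>ricci\<close>.\<close>

lemma ricci_eq_ric:
  assumes y: "y \<in> W"
  shows "v \<bullet> (ricci G y *v w) = ric (christoffel_map G) y v w"
proof -
  let ?C = "christoffel_map G"
  have D: "(\<lambda>z. ?C z a b $ k) differentiable (at y)" for a b k
    by (rule differentiable_linear_image[OF bounded_linear_vec_nth christoffel_map_differentiable[OF y]])
  have dC: "dd (\<lambda>z. ?C z (axis i 1) (axis j 1)) y u $ k = dd (christoffel G k i j) y u" for i j k u
    by (simp add: dd_vec_nth[OF D] christoffel_map_axis)
  have CC: "?C y (axis i 1) b $ l = (\<Sum>m\<in>UNIV. christoffel G l i m y * b $ m)" for i b l
  proof -
    have "(\<Sum>m\<in>UNIV. christoffel G l a m y * axis i 1 $ a * b $ m)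
        = (if a = i then (\<Sum>m\<in>UNIV. christoffel G l i m y * b $ m) else 0)" for a
      by (simp add: axis_def)
    then show ?thesis by (simp add: christoffel_map_def)
  qed
  have entry: "ricci G y $ j $ k = ric ?C y (axis j 1) (axis k 1)" for j k
  proof -
    have "curv ?C y (axis l 1) (axis j 1) (axis k 1) $ l = riemann G l k l j y" for l
      unfolding curv_def riemann_def partial_eq_dd
      by (simp add: dC CC christoffel_map_axis sum_subtractf)
    moreover have "ric ?C y (axis j 1) (axis k 1) = (\<Sum>l\<in>UNIV. curv ?C y (axis l 1) (axis j 1) (axis k 1) $ l)"
    proof -
      have i: "inj (\<lambda>l::'n. axis l (1::real))" by (auto simp: inj_on_def axis_eq_axis)
      have B: "Basis = range (\<lambda>l::'n. axis l (1::real))" by (auto simp: Basis_vec_def)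
      show ?thesis
        unfolding ric_def endo_trace_def B sum.reindex[OF i] by (simp add: inner_axis)
    qed
    ultimately show ?thesis by (simp add: ricci_def)
  qed
  have bl: "linear (\<lambda>v. ric ?C y v w)" "linear (ric ?C y v)" for v w
    using bilinear_ric[OF bilinear_christoffel_map christoffel_map_differentiable[OF y]] by (auto simp: bilinear_def)
  have "ric ?C y v w = (\<Sum>j\<in>UNIV. v $ j * (\<Sum>k\<in>UNIV. w $ k * ricci G y $ j $ k))"
    unfolding entry
    by (subst linear_expand_axis[OF bl(1)]) (simp add: linear_expand_axis[OF bl(2), of _ w])
  then show ?thesis by (simp add: inner_vec_def matrix_vector_mult_def mult.commute)
qed

end


section \<open>Warped products\<close>

definition warped_form ::
  "(real \<Rightarrow> real) \<Rightarrow> ('b \<Rightarrow> 'b \<Rightarrow> 'b \<Rightarrow> real) \<Rightarrow> real \<times> 'b \<Rightarrow> real \<times> 'b \<Rightarrow> real \<times> 'b \<Rightarrow> real" where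
  "warped_form \<Phi> H p V W = fst V * fst W + (\<Phi> (fst p))\<^sup>2 * H (snd p) (snd V) (snd W)"

text \<open>The Christoffel symbols of dr^2 + \<Phi>^2 h: two slice vectors give the radial
  component -\<Phi> \<Phi>' h, a radial and a slice vector give the factor \<Phi>'/\<Phi>, and
  \<open>C\<close> is the connection of h.\<close>

definition warped_connection ::
  "(real \<Rightarrow> real) \<Rightarrow> ('b \<Rightarrow> 'b \<Rightarrow> 'b \<Rightarrow> real) \<Rightarrow> ('b \<Rightarrow> 'b \<Rightarrow> 'b \<Rightarrow> 'b::real_vector)
     \<Rightarrow> real \<times> 'b \<Rightarrow> real \<times> 'b \<Rightarrow> real \<times> 'b \<Rightarrow> real \<times> 'b" where
  "warped_connection \<Phi> H C p V W =
    (- (\<Phi> (fst p) * deriv \<Phi> (fst p) * H (snd p) (snd V) (snd W)),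
     (deriv \<Phi> (fst p) / \<Phi> (fst p)) *\<^sub>R (fst V *\<^sub>R snd W + fst W *\<^sub>R snd V) + C (snd p) (snd V) (snd W))"

lemma sum_Basis_Times:
  fixes f :: "'a::euclidean_space \<times> 'b::euclidean_space \<Rightarrow> 'c::comm_monoid_add"
  shows "sum f Basis = (\<Sum>i\<in>Basis. f (i, 0)) + (\<Sum>i\<in>Basis. f (0, i))"
proof -
  have "inj_on (\<lambda>u. (u::'a, 0::'b)) Basis" "inj_on (\<lambda>u. (0::'a, u::'b)) Basis"
    by (auto intro!: inj_onI)
  then show ?thesis
    unfolding Basis_prod_def
    by (subst sum.union_disjoint) (auto simp: sum.reindex)
qed

context
  fixes \<Phi> :: "real \<Rightarrow> real" and H :: "'b::euclidean_space \<Rightarrow> 'b \<Rightarrow> 'b \<Rightarrow> real"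
    and C :: "'b \<Rightarrow> 'b \<Rightarrow> 'b \<Rightarrow> 'b" and p :: "real \<times> 'b"
  assumes \<Phi>: "\<Phi> (fst p) > 0" "\<Phi> differentiable (at (fst p))" "deriv \<Phi> differentiable (at (fst p))"
    and H: "\<And>v w. (\<lambda>y. H y v w) differentiable (at (snd p))"
    and C: "\<And>v w. (\<lambda>y. C y v w) differentiable (at (snd p))"
begin

lemma
  shows has_derivative_profile: "((\<lambda>q. \<Phi> (fst q)) has_derivative (\<lambda>U. deriv \<Phi> (fst p) * fst U)) (at p)"
    and has_derivative_deriv_profile:
      "((\<lambda>q. deriv \<Phi> (fst q)) has_derivative (\<lambda>U. deriv (deriv \<Phi>) (fst p) * fst U)) (at p)"
proof -
  have f: "(fst has_derivative fst) (at p)" by (intro derivative_eq_intros) auto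
  have "(f has_derivative (\<lambda>t. deriv f (fst p) * t)) (at (fst p))" if "f differentiable (at (fst p))" for f :: "real \<Rightarrow> real"
    using that by (metis DERIV_deriv_iff_real_differentiable has_field_derivative_def)
  then show "((\<lambda>q. \<Phi> (fst q)) has_derivative (\<lambda>U. deriv \<Phi> (fst p) * fst U)) (at p)"
    "((\<lambda>q. deriv \<Phi> (fst q)) has_derivative (\<lambda>U. deriv (deriv \<Phi>) (fst p) * fst U)) (at p)"
    using has_derivative_compose[OF f] \<Phi> by fastforce+
qed

lemma has_derivative_base:
  assumes "\<And>v w. (\<lambda>y. A y v w) differentiable (at (snd p))"
  shows "((\<lambda>q. A (snd q) v w) has_derivative (\<lambda>U. dd (\<lambda>y. A y v w) (snd p) (snd U))) (at p)"
proof -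
  have s: "(snd has_derivative snd) (at p)" by (intro derivative_eq_intros) auto
  show ?thesis using has_derivative_compose[OF s has_derivative_dd[OF assms]] .
qed

lemma has_derivative_warped_form:
  "((\<lambda>q. warped_form \<Phi> H q V W) has_derivative (\<lambda>U.
     2 * \<Phi> (fst p) * deriv \<Phi> (fst p) * fst U * H (snd p) (snd V) (snd W)
     + (\<Phi> (fst p))\<^sup>2 * dd (\<lambda>y. H y (snd V) (snd W)) (snd p) (snd U))) (at p)"
  unfolding warped_form_def
  by (auto intro!: derivative_eq_intros has_derivative_profile has_derivative_base H simp: algebra_simps)

lemma levi_civita_warped:
  assumes "\<And>y. bilinear (H y)" "levi_civita H C (snd p)" "\<And>v w. H (snd p) v w = H (snd p) w v"
  shows "levi_civita (warped_form \<Phi> H) (warped_connection \<Phi> H C) p"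
proof -
  have lc: "2 * H (snd p) (C (snd p) v w) u = dd (\<lambda>y. H y w u) (snd p) v
      + dd (\<lambda>y. H y v u) (snd p) w - dd (\<lambda>y. H y v w) (snd p) u" for v w u
    using assms(2) by (simp add: levi_civita_def)
  have l: "linear (\<lambda>v. H y v w)" "linear (H y v)" for y v w
    using assms(1) by (auto simp: bilinear_def)
  \<comment> \<open>The Koszul formula of \<open>H\<close> solved for one derivative, so that it can
    act as a rewrite rule at a single instance.\<close>
  have lc': "dd (\<lambda>y. H y w u) (snd p) v
      = 2 * H (snd p) (C (snd p) v w) u - dd (\<lambda>y. H y v u) (snd p) w + dd (\<lambda>y. H y v w) (snd p) u" for v w u
    using lc[of v w u] by simp
  show ?thesis
    unfolding levi_civita_def
  proof (intro allI)
    fix V W U :: "real \<times> 'b"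
    \<comment> \<open>Writing \<Phi>' as \<open>q\<close> times \<Phi> removes the quotient, and the
      claim becomes a polynomial identity.\<close>
    define q where "q = deriv \<Phi> (fst p) / \<Phi> (fst p)"
    have dq: "deriv \<Phi> (fst p) = q * \<Phi> (fst p)" using \<Phi>(1) by (simp add: q_def)
    show "2 * warped_form \<Phi> H p (warped_connection \<Phi> H C p V W) U =
      dd (\<lambda>y. warped_form \<Phi> H y W U) p V + dd (\<lambda>y. warped_form \<Phi> H y V U) p W - dd (\<lambda>y. warped_form \<Phi> H y V W) p U"
      unfolding dd_eq[OF has_derivative_warped_form]
      unfolding warped_form_def warped_connection_def fst_conv snd_conv
        linear_add[OF l(1)] linear_cmul[OF l(1)] lc'[of "snd W" "snd U" "snd V"]
      unfolding q_def[symmetric] dq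
      using assms(3)
      by (simp add: algebra_simps power2_eq_square)
  qed
qed

lemma has_derivative_warped_connection:
  "((\<lambda>q. warped_connection \<Phi> H C q V W) has_derivative (\<lambda>U.
     (- (((deriv \<Phi> (fst p))\<^sup>2 + \<Phi> (fst p) * deriv (deriv \<Phi>) (fst p)) * fst U * H (snd p) (snd V) (snd W)
         + \<Phi> (fst p) * deriv \<Phi> (fst p) * dd (\<lambda>y. H y (snd V) (snd W)) (snd p) (snd U)),
      ((deriv (deriv \<Phi>) (fst p) / \<Phi> (fst p) - (deriv \<Phi> (fst p) / \<Phi> (fst p))\<^sup>2) * fst U) *\<^sub>R
         (fst V *\<^sub>R snd W + fst W *\<^sub>R snd V) + dd (\<lambda>y. C y (snd V) (snd W)) (snd p) (snd U)))) (at p)"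
proof -
  have "((\<lambda>q. deriv \<Phi> (fst q) / \<Phi> (fst q)) has_derivative
      (\<lambda>U. (deriv (deriv \<Phi>) (fst p) / \<Phi> (fst p) - (deriv \<Phi> (fst p) / \<Phi> (fst p))\<^sup>2) * fst U)) (at p)"
    by (rule has_derivative_eq_rhs[OF has_derivative_divide[OF has_derivative_deriv_profile has_derivative_profile]])
      (use \<Phi>(1) in \<open>auto simp: fun_eq_iff divide_simps power2_eq_square algebra_simps\<close>)
  from has_derivative_Pair[OF
      has_derivative_minus[OF has_derivative_mult[OF has_derivative_mult[OF has_derivative_profile has_derivative_deriv_profile]
        has_derivative_base[where v = "snd V" and w = "snd W", OF H]]]
      has_derivative_add[OF has_derivative_scaleR[OF this has_derivative_const[of "fst V *\<^sub>R snd W + fst W *\<^sub>R snd V"]]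
        has_derivative_base[where v = "snd V" and w = "snd W", OF C]]]
  show ?thesis
    unfolding warped_connection_def
    by (rule has_derivative_eq_rhs) (auto simp: fun_eq_iff algebra_simps power2_eq_square)
qed

text \<open>Trace of the curvature over the splitting. The radial vector contributes -\<Phi>
  \<Phi>'' h. A slice vector contributes the curvature of h, the mixed term with \<Phi>''/\<Phi>,
  and a term of constant-curvature type with factor \<Phi>'^2, as in the Gauss equation.\<close>

lemma ric_warped:
  assumes "\<And>y. bilinear (H y)" "\<And>y. bilinear (C y)" "\<And>v w. C (snd p) v w = C (snd p) w v"
  shows "ric (warped_connection \<Phi> H C) p V W =
    ric C (snd p) (snd V) (snd W)
    - real DIM('b) * (deriv (deriv \<Phi>) (fst p) / \<Phi> (fst p)) * fst V * fst W
    - ((real DIM('b) - 1) * (deriv \<Phi> (fst p))\<^sup>2 + \<Phi> (fst p) * deriv (deriv \<Phi>) (fst p)) * H (snd p) (snd V) (snd W)"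
proof -
  define y where "y = snd p"
  define P where "P = \<Phi> (fst p)"
  define Q where "Q = deriv \<Phi> (fst p)"
  define R where "R = deriv (deriv \<Phi>) (fst p)"
  obtain s v where V: "V = (s, v)" by (cases V)
  obtain t w where W: "W = (t, w)" by (cases W)
  have P: "P > 0" using \<Phi>(1) by (simp add: P_def)
  have lH: "linear (\<lambda>v. H y v w)" "linear (H y v)" and lC: "linear (\<lambda>v. C y v w)" "linear (C y v)" for v w
    using assms(1,2) by (auto simp: bilinear_def)
  note lin = linear_add[OF lH(1)] linear_add[OF lH(2)] linear_cmul[OF lH(1)] linear_cmul[OF lH(2)]
    linear_add[OF lC(1)] linear_add[OF lC(2)] linear_cmul[OF lC(1)] linear_cmul[OF lC(2)]
    linear_0[OF lH(1)] linear_0[OF lH(2)] linear_0[OF lC(1)] linear_0[OF lC(2)]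
  have lD: "dd (\<lambda>z. H z 0 w) y u = 0" "dd (\<lambda>z. C z 0 w) y u = 0" for w u
  proof -
    have "H z 0 w = 0" "C z 0 w = 0" for z
      using assms(1,2) linear_0[of "\<lambda>v. H z v w"] linear_0[of "\<lambda>v. C z v w"] by (simp_all add: bilinear_def)
    then show "dd (\<lambda>z. H z 0 w) y u = 0" "dd (\<lambda>z. C z 0 w) y u = 0"
      by (simp_all add: dd_eq[OF has_derivative_const])
  qed
  have lD0: "dd (\<lambda>z. H z a b) y 0 = 0" "dd (\<lambda>z. C z a b) y 0 = 0" for a b
    using linear_0[OF has_derivative_linear[OF has_derivative_dd[OF H[of a b]]]]
      linear_0[OF has_derivative_linear[OF has_derivative_dd[OF C[of a b]]]] by (simp_all add: y_def)
  have conn: "warped_connection \<Phi> H C p (s, v) (t, w) = (- (P * Q * H y v w), (Q / P) *\<^sub>R (s *\<^sub>R w + t *\<^sub>R v) + C y v w)" for s v t w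
    by (simp add: warped_connection_def P_def Q_def y_def)
  have dconn: "dd (\<lambda>q. warped_connection \<Phi> H C q (s, v) (t, w)) p (r, u) =
     (- ((Q\<^sup>2 + P * R) * r * H y v w + P * Q * dd (\<lambda>z. H z v w) y u),
      ((R / P - (Q / P)\<^sup>2) * r) *\<^sub>R (s *\<^sub>R w + t *\<^sub>R v) + dd (\<lambda>z. C z v w) y u)" for s v t w r u
    by (simp add: dd_eq[OF has_derivative_warped_connection] P_def Q_def R_def y_def)
  define q where "q = Q / P"
  have Qq: "Q = q * P" using P by (simp add: q_def)
  have 1: "fst (curv (warped_connection \<Phi> H C) p (1, 0) V W) = - (P * R * H y v w)"
    unfolding curv_def V W conn dconn q_def[symmetric] Qq
    by (simp add: lin lD lD0 algebra_simps power2_eq_square)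
  have 2: "snd (curv (warped_connection \<Phi> H C) p (0, b) V W) =
     curv C y b v w - ((R / P) * s * t) *\<^sub>R b - Q\<^sup>2 *\<^sub>R (H y v w *\<^sub>R b - H y b w *\<^sub>R v)" for b
    unfolding curv_def V W conn dconn q_def[symmetric] Qq
    by (simp add: lin lD lD0 assms(3)[folded y_def, of v b] algebra_simps power2_eq_square)
  \<comment> \<open>Trace of the rank-one map taking \<open>b\<close> to
    \<open>H y b w *\<^sub>R v\<close>; it lowers the factor of \<Phi>'^2 from
    \<open>DIM('b)\<close> to \<open>DIM('b) - 1\<close>.\<close>
  have Hsum: "(\<Sum>b\<in>Basis. H y b w * (v \<bullet> b)) = H y v w"
    using linear_expand_Basis[OF lH(1), of v w] by (simp add: mult.commute)
  have "(\<Sum>b\<in>(Basis :: 'b set). snd (curv (warped_connection \<Phi> H C) p (0, b) V W) \<bullet> b)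
    = (\<Sum>b\<in>(Basis :: 'b set). curv C y b v w \<bullet> b - ((R / P) * s * t + Q\<^sup>2 * H y v w) + Q\<^sup>2 * (H y b w * (v \<bullet> b)))"
    by (rule sum.cong) (auto simp: 2 inner_diff_left inner_add_left algebra_simps)
  also have "\<dots> = ric C y v w - real DIM('b) * ((R / P) * s * t + Q\<^sup>2 * H y v w) + Q\<^sup>2 * H y v w"
    by (simp add: sum.distrib sum_subtractf sum_distrib_left[symmetric] Hsum ric_def endo_trace_def)
  finally have S: "(\<Sum>b\<in>(Basis :: 'b set). snd (curv (warped_connection \<Phi> H C) p (0, b) V W) \<bullet> b) = \<dots>" .
  show ?thesis
    unfolding ric_def[of "warped_connection \<Phi> H C"] endo_trace_def sum_Basis_Times
    using 1 S by (simp add: inner_prod_def V W P_def Q_def R_def y_def algebra_simps)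
qed

end


section \<open>Eigenvalues of the Schouten endomorphism\<close>

lemma matrix_vector_mult_matrix:
  fixes f :: "real ^ 'n \<Rightarrow> real ^ 'm::finite"
  assumes "linear f"
  shows "matrix f *v x = f x"
proof -
  have "((*s) :: real \<Rightarrow> real ^ 'n \<Rightarrow> real ^ 'n) = (*\<^sub>R)" "((*s) :: real \<Rightarrow> real ^ 'm \<Rightarrow> real ^ 'm) = (*\<^sub>R)"
    by (simp_all add: fun_eq_iff scalar_mult_eq_scaleR)
  then show ?thesis using matrix_works[of f x] assms by simp
qed

lemma minus_matrix_vector_mult: "(- A) *v x = - (A *v (x :: real ^ 'n))" for A :: "real ^ 'n ^ 'm"
  by (simp add: matrix_vector_mult_def vec_eq_iff sum_negf)

lemma mat_vector_mult: "mat t *v x = t *\<^sub>R (x :: real ^ 'n::finite)"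
proof -
  have "(if i = j then t else 0) * x $ j = (if j = i then t * x $ i else 0)" for i j by simp
  then show ?thesis by (simp add: mat_def matrix_vector_mult_def vec_eq_iff)
qed

lemma matrix_diff_rdistrib: "(A - B) ** C = A ** C - B ** (C :: real ^ 'n ^ 'm)"
  by (simp add: matrix_matrix_mult_def vec_eq_iff left_diff_distrib sum_subtractf)

lemma matrix_diff_ldistrib: "A ** (B - C) = A ** B - A ** (C :: real ^ 'n ^ 'm)"
  by (simp add: matrix_matrix_mult_def vec_eq_iff right_diff_distrib sum_subtractf)

lemma trace_eq_endo_trace:
  fixes B :: "real ^ 'n ^ 'n::finite"
  shows "trace B = endo_trace ((*v) B)"
proof -
  have i: "inj (\<lambda>l::'n. axis l (1::real))" by (auto simp: inj_on_def axis_eq_axis)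
  have E: "Basis = range (\<lambda>l::'n. axis l (1::real))" by (auto simp: Basis_vec_def)
  show ?thesis
    unfolding endo_trace_def E sum.reindex[OF i]
    by (simp add: inner_axis trace_def matrix_vector_mult_basis column_def)
qed

context
  fixes D :: "real \<times> (real ^ 'k::finite) \<Rightarrow> real ^ 'n::finite" and B :: "real ^ 'n ^ 'n" and a b :: real
  assumes D: "linear D" "bij D" and split: "\<And>s v. B *v D (s, v) = D (a * s, b *\<^sub>R v)"
begin

lemma trace_of_splitting: "trace B = a + real CARD('k) * b"
proof -
  have "endo_trace (\<lambda>p :: real \<times> (real ^ 'k). (a * fst p, b *\<^sub>R snd p)) = endo_trace ((*v) B)"
    by (rule endo_trace_similar[OF D]) (use split in \<open>auto simp: matrix_vector_mul_linear\<close>)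
  moreover have "endo_trace (\<lambda>p :: real \<times> (real ^ 'k). (a * fst p, b *\<^sub>R snd p)) = a + real CARD('k) * b"
    unfolding endo_trace_def sum_Basis_Times by (simp add: inner_prod_def)
  ultimately show ?thesis by (simp add: trace_eq_endo_trace)
qed

text \<open>\<open>D\<close> starts from \<open>real \<times> real^k\<close>, so it is preceded by
  \<open>T\<close>, which reads \<open>i0\<close> as the radial slot and enumerates the other
  indices by \<open>e\<close>. The matrix \<open>P\<close> of the composite conjugates
  \<open>B\<close> to a diagonal matrix. The index \<open>i0\<close> is arbitrary, as the
  characteristic polynomial ignores the order of its roots.\<close>

lemma eigenvalue_vector_of_splitting:
  fixes i0 :: 'n
  assumes "CARD('n) = CARD('k) + 1"
  shows "eigenvalue_vector B (\<chi> i. if i = i0 then a else b)"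
proof -
  have "card (UNIV - {i0}) = CARD('k)" using assms by (simp add: card_Diff_singleton)
  then obtain e where e: "bij_betw e (UNIV :: 'k set) (UNIV - {i0})"
    using finite_same_card_bij[of "UNIV :: 'k set" "UNIV - {i0}"] by auto
  define T :: "real ^ 'n \<Rightarrow> real \<times> (real ^ 'k)" where "T z = (z $ i0, \<chi> j. z $ e j)" for z
  have ne: "e j \<noteq> i0" for j using bij_betwE[OF e] by auto
  have lT: "linear T" by (rule linearI) (auto simp: T_def vec_eq_iff)
  have iT: "inj T"
  proof (rule injI)
    fix z z' assume "T z = T z'"
    then have 1: "z $ i0 = z' $ i0" "z $ e j = z' $ e j" for j by (auto simp: T_def vec_eq_iff)
    have "z $ i = z' $ i" for i
    proof (cases "i = i0")
      case False
      then obtain j where "i = e j" using e by (auto simp: bij_betw_def)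
      then show ?thesis using 1 by simp
    qed (use 1 in simp)
    then show "z = z'" by (simp add: vec_eq_iff)
  qed
  define l :: "real ^ 'n" where "l = (\<chi> i. if i = i0 then a else b)"
  define \<Lambda> :: "real ^ 'n ^ 'n" where "\<Lambda> = (\<chi> i j. if i = j then l $ i else 0)"
  have \<Lambda>: "\<Lambda> *v z = (\<chi> i. l $ i * z $ i)" for z
  proof -
    have "(if i = j then l $ i else 0) * z $ j = (if j = i then l $ i * z $ i else 0)" for i j by simp
    then show ?thesis by (simp add: \<Lambda>_def matrix_vector_mult_def)
  qed
  have T\<Lambda>: "T (\<Lambda> *v z) = (a * fst (T z), b *\<^sub>R snd (T z))" for z
    by (simp add: T_def \<Lambda> l_def ne vec_eq_iff)
  define P where "P = matrix (D \<circ> T)"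
  have lDT: "linear (D \<circ> T)" by (rule linear_compose[OF lT D(1)])
  have P: "P *v z = D (T z)" for z by (simp add: P_def matrix_vector_mult_matrix[OF lDT])
  have "(*v) P = D \<circ> T" by (simp add: fun_eq_iff P)
  then have "inj ((*v) P)" using iT D(2) by (simp add: bij_def inj_compose)
  then have iP: "invertible P" by (simp add: invertible_left_inverse matrix_left_invertible_injective)
  have "(B ** P) *v z = (P ** \<Lambda>) *v z" for z
  proof -
    have "(B ** P) *v z = B *v D (fst (T z), snd (T z))" by (simp add: P flip: matrix_vector_mul_assoc)
    also have "\<dots> = D (T (\<Lambda> *v z))" unfolding T\<Lambda> by (rule split)
    finally show ?thesis by (simp add: P flip: matrix_vector_mul_assoc)
  qed
  then have BP: "B ** P = P ** \<Lambda>" by (simp add: matrix_eq)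
  show ?thesis
    unfolding eigenvalue_vector_def l_def[symmetric]
  proof
    fix t
    have "(mat t - B) ** P = P ** (mat t - \<Lambda>)"
    proof -
      have "(mat t - B) ** P = mat t ** P - B ** P" by (simp add: matrix_diff_rdistrib)
      also have "mat t ** P = P ** mat t"
        by (simp add: matrix_eq mat_vector_mult matrix_vector_mult_scaleR flip: matrix_vector_mul_assoc)
      also have "P ** mat t - B ** P = P ** (mat t - \<Lambda>)" by (simp add: BP matrix_diff_ldistrib)
      finally show ?thesis .
    qed
    then have "det (mat t - B) * det P = det P * det (mat t - \<Lambda>)" by (metis det_mul)
    then have "det (mat t - B) = det (mat t - \<Lambda>)" using iP by (simp add: invertible_det_nz)
    also have "\<dots> = (\<Prod>i\<in>UNIV. (mat t - \<Lambda>) $ i $ i)"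
      by (rule det_diagonal) (simp add: mat_def \<Lambda>_def)
    also have "\<dots> = (\<Prod>i\<in>UNIV. t - l $ i)" by (simp add: mat_def \<Lambda>_def)
    finally show "det (mat t - B) = (\<Prod>i\<in>UNIV. t - l $ i)" .
  qed
qed

end

text \<open>Torsion-freeness: the right-hand side of the Koszul formula is symmetric in
  \<open>v\<close> and \<open>w\<close> once \<open>G\<close> is symmetric near \<open>x\<close>,
  and definiteness hands this symmetry to \<open>B\<close>.\<close>

lemma levi_civita_commute:
  fixes G :: "'a::euclidean_space \<Rightarrow> 'a \<Rightarrow> 'a \<Rightarrow> real"
  assumes "levi_civita G B x" "open W" "x \<in> W" "\<And>y v w. y \<in> W \<Longrightarrow> G y v w = G y w v"
    and "bilinear (G x)" "\<And>v. v \<noteq> 0 \<Longrightarrow> G x v v > 0"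
  shows "B x v w = B x w v"
proof -
  have s: "dd (\<lambda>y. G y v w) x = dd (\<lambda>y. G y w v) x" for v w
    by (rule dd_cong[OF assms(2,3)]) (use assms(4) in blast)
  have l: "linear (\<lambda>v. G x v w)" for w using assms(5) by (auto simp: bilinear_def)
  have "2 * G x (B x v w) u = 2 * G x (B x w v) u" for u
    using assms(1) s[of v w] unfolding levi_civita_def by simp
  then have "G x (B x v w - B x w v) (B x v w - B x w v) = 0"
    by (simp add: linear_diff[OF l])
  then show ?thesis using assms(6)[of "B x v w - B x w v"] by force
qed

text \<open>The warped connection and the Christoffel map of \<open>G\<close> both satisfy the
  Koszul formula, so \<open>levi_civita_pullback\<close> relates them. The relation is established
  at every point of \<open>V\<close> because \<open>ric_pullback\<close> differentiates it;
  \<open>ric_warped\<close> then evaluates the Ricci form in product coordinates.\<close>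

lemma ricci_of_warped_metric:
  fixes F :: "real \<times> (real ^ 'k::finite) \<Rightarrow> real ^ 'n::finite" and G :: "real ^ 'n \<Rightarrow> real ^ 'n ^ 'n"
    and H :: "real ^ 'k \<Rightarrow> real ^ 'k ^ 'k"
  assumes V: "open V" "p \<in> V" and F: "smooth_open V F" "\<And>q. q \<in> V \<Longrightarrow> bij (dd F q)"
    and G: "riemannian_coords W G" "F ` V \<subseteq> W" and H: "riemannian_coords W' H" "snd ` V \<subseteq> W'"
    and \<Phi>: "\<And>q. q \<in> V \<Longrightarrow> \<Phi> (fst q) > 0" "\<And>q. q \<in> V \<Longrightarrow> \<Phi> differentiable (at (fst q))"
      "\<And>q. q \<in> V \<Longrightarrow> deriv \<Phi> differentiable (at (fst q))"
    and pull: "\<And>q U U'. q \<in> V \<Longrightarrow> warped_form \<Phi> (metric_form H) q U U' = metric_form G (F q) (dd F q U) (dd F q U')"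
  shows "dd F p U \<bullet> (ricci G (F p) *v dd F p U') =
    snd U \<bullet> (ricci H (snd p) *v snd U')
    - real CARD('k) * (deriv (deriv \<Phi>) (fst p) / \<Phi> (fst p)) * fst U * fst U'
    - ((real CARD('k) - 1) * (deriv \<Phi> (fst p))\<^sup>2 + \<Phi> (fst p) * deriv (deriv \<Phi>) (fst p)) * (snd U \<bullet> (H (snd p) *v snd U'))"
proof -
  let ?B = "christoffel_map G" and ?C = "christoffel_map H"
  let ?B' = "warped_connection \<Phi> (metric_form H) ?C"
  interpret G: riemannian_coords W G by (rule G(1))
  interpret H: riemannian_coords W' H by (rule H(1))
  have FW: "F q \<in> W" and sW: "snd q \<in> W'" if "q \<in> V" for q using that G(2) H(2) by auto
  have symG: "metric_form G y v w = metric_form G y w v" if "y \<in> W" for y v w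
    using G.sym[OF that] by (metis metric_form_def dot_lmul_matrix vector_transpose_matrix inner_commute)
  have symH: "metric_form H y v w = metric_form H y w v" if "y \<in> W'" for y v w
    using H.sym[OF that] by (metis metric_form_def dot_lmul_matrix vector_transpose_matrix inner_commute)
  note cG = G.levi_civita_christoffel_map G.christoffel_map_differentiable
    G.metric_form_differentiable G.ricci_eq_ric
  note cH = H.levi_civita_christoffel_map H.christoffel_map_differentiable
    H.metric_form_differentiable H.ricci_eq_ric
  have lc': "levi_civita (warped_form \<Phi> (metric_form H)) ?B' q" if q: "q \<in> V" for q
    by (rule levi_civita_warped[OF \<Phi>[OF q] cH(3)[OF sW[OF q]] cH(2)[OF sW[OF q]]
          bilinear_metric_form cH(1)[OF sW[OF q]] symH[OF sW[OF q]]])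
  have rel: "dd F q (?B' q v w) = dd (\<lambda>y. dd F y w) q v + ?B (F q) (dd F q v) (dd F q w)" if q: "q \<in> V" for q v w
    by (rule levi_civita_pullback[OF V(1) q F(1) bij_is_surj[OF F(2)[OF q]] bilinear_metric_form cG(3)[OF FW[OF q]]
       symG[OF FW[OF q]] _ pull cG(1)[OF FW[OF q]] lc'[OF q]])
     (use G.pos[OF FW[OF q]] in \<open>simp_all add: metric_form_def\<close>)
  have dB': "(\<lambda>q. ?B' q v w) differentiable (at p)" for v w
    by (rule differentiableI[OF has_derivative_warped_connection[OF \<Phi>[OF V(2)] cH(3)[OF sW[OF V(2)]] cH(2)[OF sW[OF V(2)]]]])
  have "dd F p U \<bullet> (ricci G (F p) *v dd F p U') = ric ?B (F p) (dd F p U) (dd F p U')"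
    by (rule cG(4)[OF FW[OF V(2)]])
  also have "\<dots> = ric ?B' p U U'"
    by (rule ric_pullback[OF V F(1) F(2)[OF V(2)] bilinear_christoffel_map cG(2)[OF FW[OF V(2)]] dB' rel, symmetric])
  also have "\<dots> = ric ?C (snd p) (snd U) (snd U')
    - real DIM(real ^ 'k) * (deriv (deriv \<Phi>) (fst p) / \<Phi> (fst p)) * fst U * fst U'
    - ((real DIM(real ^ 'k) - 1) * (deriv \<Phi> (fst p))\<^sup>2 + \<Phi> (fst p) * deriv (deriv \<Phi>) (fst p))
      * metric_form H (snd p) (snd U) (snd U')"
    by (rule ric_warped[OF \<Phi>[OF V(2)] cH(3)[OF sW[OF V(2)]] cH(2)[OF sW[OF V(2)]] bilinear_metric_form bilinear_christoffel_map])
      (rule levi_civita_commute[OF cH(1)[OF sW[OF V(2)]] H.W sW[OF V(2)] symH bilinear_metric_form],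
        use H.pos[OF sW[OF V(2)]] in \<open>simp_all add: metric_form_def\<close>)
  finally show ?thesis using cH(4)[OF sW[OF V(2)], of "snd U" "snd U'"] by (simp add: metric_form_def)
qed

text \<open>Linear algebra at one point: \<open>P\<close>, \<open>P'\<close>, \<open>P''\<close>
  stand for \<Phi> and its derivatives, and \<open>k\<close> for the Einstein constant divided by n
  - 2. Both forms split along \<open>D\<close> into a radial part and a multiple of
  \<open>h\<close>, so the Ricci endomorphism acts by scalars on the two factors, and its trace is
  the scalar curvature.\<close>

lemma neg_schouten_splitting:
  fixes D :: "real \<times> (real ^ 'k::finite) \<Rightarrow> real ^ 'n::finite" and g Rc :: "real ^ 'n ^ 'n"
    and h :: "real ^ 'k ^ 'k"
  assumes dim: "CARD('n) = CARD('k) + 1" "CARD('n) \<ge> 3"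
    and D: "linear D" "bij D" and g: "transpose g = g" "invertible g"
    and \<Phi>: "P > 0"
    and gD: "\<And>s v s' v'. D (s, v) \<bullet> (g *v D (s', v')) = s * s' + P\<^sup>2 * (v \<bullet> (h *v v'))"
    and RD: "\<And>s v s' v'. D (s, v) \<bullet> (Rc *v D (s', v')) =
       (real CARD('n) - 2) * k * (v \<bullet> (h *v v')) - real CARD('k) * (P'' / P) * s * s'
       - ((real CARD('k) - 1) * P'\<^sup>2 + P * P'') * (v \<bullet> (h *v v'))"
  defines "R \<equiv> \<Sum>i\<in>UNIV. \<Sum>j\<in>UNIV. matrix_inv g $ i $ j * Rc $ i $ j"
  shows "- (matrix_inv g ** ((1 / (real CARD('n) - 2)) *\<^sub>R (Rc - (R / (2 * (real CARD('n) - 1))) *\<^sub>R g))) *v D (s, v)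
    = D ((P'' / P - (P'\<^sup>2 - k) / (2 * P\<^sup>2)) * s, ((P'\<^sup>2 - k) / (2 * P\<^sup>2)) *\<^sub>R v)"
proof -
  define n where "n = real CARD('n)"
  have k: "real CARD('k) = n - 1" using dim by (simp add: n_def)
  have n: "n \<ge> 3" using dim by (simp add: n_def)
  \<comment> \<open>Eigenvalues of the Ricci endomorphism on the radial line and on the
    slices.\<close>
  define \<alpha> where "\<alpha> = - ((n - 1) * (P'' / P))"
  define \<beta> where "\<beta> = ((n - 2) * k - (n - 2) * P'\<^sup>2 - P * P'') / P\<^sup>2"
  define L where "L = matrix_inv g ** Rc"
  have P\<beta>: "P\<^sup>2 * \<beta> = (n - 2) * k - (n - 2) * P'\<^sup>2 - P * P''" using \<Phi> by (simp add: \<beta>_def)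
  have L: "L *v D (s, v) = D (\<alpha> * s, \<beta> *\<^sub>R v)" for s v
  proof -
    have "D (s', v') \<bullet> (Rc *v D (s, v) - g *v D (\<alpha> * s, \<beta> *\<^sub>R v)) = 0" for s' v'
    proof -
      have "D (s', v') \<bullet> (g *v D (\<alpha> * s, \<beta> *\<^sub>R v)) = s' * \<alpha> * s + (P\<^sup>2 * \<beta>) * (v' \<bullet> (h *v v))"
        by (simp add: gD matrix_vector_mult_scaleR)
      then show ?thesis
        unfolding P\<beta> by (simp add: inner_diff_right RD k \<alpha>_def n_def[symmetric] algebra_simps)
    qed
    then have "z \<bullet> (Rc *v D (s, v) - g *v D (\<alpha> * s, \<beta> *\<^sub>R v)) = 0" for z
      using bij_is_surj[OF D(2)] by (metis surj_pair surjD)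
    then have "Rc *v D (s, v) = g *v D (\<alpha> * s, \<beta> *\<^sub>R v)"
      by (metis inner_eq_zero_iff right_minus_eq)
    then have "L *v D (s, v) = matrix_inv g *v (g *v D (\<alpha> * s, \<beta> *\<^sub>R v))"
      by (simp add: L_def flip: matrix_vector_mul_assoc)
    then show ?thesis by (simp add: matrix_vector_mul_assoc invertible_mult_matrix_inv[OF g(2)])
  qed
  \<comment> \<open>Symmetry of the inverse turns the double sum \<open>R\<close> into the trace of
    \<open>L\<close>.\<close>
  have inv_sym: "transpose (matrix_inv g) = matrix_inv g"
  proof -
    have "transpose (matrix_inv g) ** g = mat 1"
      using arg_cong[OF invertible_mult_matrix_inv(1)[OF g(2)], of transpose] g(1)
      by (simp add: matrix_transpose_mul)
    then have "(transpose (matrix_inv g) ** g) ** matrix_inv g = matrix_inv g" by simp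
    then show ?thesis by (simp add: invertible_mult_matrix_inv[OF g(2)] flip: matrix_mul_assoc)
  qed
  have "R = (\<Sum>j\<in>UNIV. \<Sum>i\<in>UNIV. matrix_inv g $ i $ j * Rc $ i $ j)"
    unfolding R_def by (rule sum.swap)
  also have "\<dots> = (\<Sum>j\<in>UNIV. \<Sum>i\<in>UNIV. transpose (matrix_inv g) $ j $ i * Rc $ i $ j)"
    by (simp add: transpose_def)
  also have "\<dots> = trace L" by (simp add: inv_sym L_def trace_def matrix_matrix_mult_def)
  also have "\<dots> = \<alpha> + (n - 1) * \<beta>" using trace_of_splitting[OF D L] by (simp add: k)
  finally have R: "R = \<alpha> + (n - 1) * \<beta>" .
  \<comment> \<open>In \<open>x\<close> and \<open>q\<close> everything is linear: \<open>R\<close>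
    becomes -2 (n - 1) (x + (n - 2) q), and both eigenvalue differences acquire a factor n - 2 that
    cancels the one in the Schouten tensor.\<close>
  define x where "x = P'' / P"
  define q where "q = (P'\<^sup>2 - k) / (2 * P\<^sup>2)"
  have \<alpha>: "\<alpha> = - ((n - 1) * x)" by (simp add: \<alpha>_def x_def)
  have \<beta>: "\<beta> = - (2 * (n - 2) * q) - x"
    using \<Phi> by (simp add: \<beta>_def x_def q_def divide_simps power2_eq_square) (simp add: algebra_simps)
  have R': "R / (2 * (n - 1)) = - (x + (n - 2) * q)"
    using n by (simp add: R \<alpha> \<beta> divide_simps) (simp add: algebra_simps)
  have "matrix_inv g ** ((1 / (n - 2)) *\<^sub>R (Rc - (R / (2 * (n - 1))) *\<^sub>R g))
     = (1 / (n - 2)) *\<^sub>R (L - (R / (2 * (n - 1))) *\<^sub>R mat 1)"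
    by (simp add: L_def matrix_scalar_ac scalar_matrix_assoc[symmetric] matrix_diff_ldistrib
        invertible_mult_matrix_inv[OF g(2)] scaleR_diff_right)
  then have "- (matrix_inv g ** ((1 / (n - 2)) *\<^sub>R (Rc - (R / (2 * (n - 1))) *\<^sub>R g))) *v D (s, v)
     = - ((1 / (n - 2)) *\<^sub>R (L *v D (s, v) - (R / (2 * (n - 1))) *\<^sub>R D (s, v)))"
    by (simp add: matrix_vector_mult_diff_rdistrib scaleR_matrix_vector_assoc[symmetric] minus_matrix_vector_mult)
  also have "\<dots> = D (- (1 / (n - 2)) * (\<alpha> - R / (2 * (n - 1))) * s, (- (1 / (n - 2)) * (\<beta> - R / (2 * (n - 1)))) *\<^sub>R v)"
    unfolding L by (simp add: algebra_simps flip: linear_cmul[OF D(1)] linear_diff[OF D(1)] linear_neg[OF D(1)])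
  also have "- (1 / (n - 2)) * (\<alpha> - R / (2 * (n - 1))) = x - q"
  proof -
    have "\<alpha> - R / (2 * (n - 1)) = (n - 2) * (q - x)" unfolding R' \<alpha> by (simp add: algebra_simps)
    then show ?thesis using n by simp
  qed
  also have "- (1 / (n - 2)) * (\<beta> - R / (2 * (n - 1))) = q"
  proof -
    have "\<beta> - R / (2 * (n - 1)) = (n - 2) * (- q)" unfolding R' \<beta> by (simp add: algebra_simps)
    then show ?thesis using n by simp
  qed
  finally show ?thesis by (simp add: n_def x_def q_def)
qed


section \<open>Cones\<close>

lemma mu_plus_in_frontier:
  fixes \<Gamma> :: "(real ^ 'n::finite) set"
  assumes "open \<Gamma>" "convex \<Gamma>"
    and "\<And>x \<sigma>. x \<in> \<Gamma> \<Longrightarrow> bij \<sigma> \<Longrightarrow> permute_coords \<sigma> x \<in> \<Gamma>"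
    and "positive_cone \<subseteq> \<Gamma>" "\<Gamma> \<subseteq> positive_trace_cone"
  shows "(\<chi> j. if j = i then - mu_plus \<Gamma> else 1) \<in> frontier \<Gamma>" "0 \<le> mu_plus \<Gamma>"
  using theI'[OF mu_plus_unique_exists[OF assms], folded mu_plus_def] by auto

context
  fixes \<Gamma> :: "(real ^ 'n::finite) set" and f :: "real ^ 'n \<Rightarrow> real"
  assumes \<Gamma>: "open \<Gamma>" "convex \<Gamma>" "\<And>x t. x \<in> \<Gamma> \<Longrightarrow> t > 0 \<Longrightarrow> t *\<^sub>R x \<in> \<Gamma>"
      "\<And>x \<sigma>. x \<in> \<Gamma> \<Longrightarrow> bij \<sigma> \<Longrightarrow> permute_coords \<sigma> x \<in> \<Gamma>"
      "positive_cone \<subseteq> \<Gamma>" "\<Gamma> \<subseteq> positive_trace_cone"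
    and f: "smooth_on \<Gamma> f" "\<And>x t. x \<in> \<Gamma> \<Longrightarrow> t > 0 \<Longrightarrow> f (t *\<^sub>R x) = t * f x"
      "\<And>x. x \<in> \<Gamma> \<Longrightarrow> f x > 0" "\<And>x i. x \<in> \<Gamma> \<Longrightarrow> partial i f x > 0"
begin

text \<open>The vector lies on the segment from the closure point with entry -\<mu> to a point of
  the positive cone, strictly past the former; by convexity such points are interior.\<close>

lemma axial_vector_in_cone:
  assumes "a > - mu_plus \<Gamma>"
  shows "(\<chi> j. if j = i then a else 1) \<in> \<Gamma>"
proof -
  define e where "e a = (\<chi> j::'n. if j = i then a else (1::real))" for a
  define \<mu> where "\<mu> = mu_plus \<Gamma>"
  have \<mu>: "e (- \<mu>) \<in> closure \<Gamma>" "0 \<le> \<mu>"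
    using mu_plus_in_frontier(1)[OF \<Gamma>(1,2,4,5,6), of i] mu_plus_in_frontier(2)[OF \<Gamma>(1,2,4,5,6)] by (auto simp: e_def \<mu>_def frontier_def)
  \<comment> \<open>Any number exceeding both 0 and \<open>a\<close> would do.\<close>
  define T where "T = \<bar>a\<bar> + 1"
  have T: "T > 0" "a < T" by (auto simp: T_def)
  then have eT: "e T \<in> interior \<Gamma>"
    using \<Gamma>(1,5) by (auto simp: interior_open positive_cone_def e_def)
  define t where "t = (a + \<mu>) / (T + \<mu>)"
  have t: "0 < t" "t \<le> 1" using assms T \<mu>(2) by (auto simp: t_def \<mu>_def field_simps)
  have "e (- \<mu>) - t *\<^sub>R (e (- \<mu>) - e T) \<in> interior \<Gamma>"
    by (rule mem_interior_closure_convex_shrink[OF \<Gamma>(2) eT \<mu>(1) t])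
  moreover have "t * (T + \<mu>) = a + \<mu>" using T \<mu>(2) by (simp add: t_def)
  then have "e (- \<mu>) - t *\<^sub>R (e (- \<mu>) - e T) = e a"
    by (auto simp: e_def vec_eq_iff algebra_simps)
  ultimately show ?thesis using interior_subset by (auto simp: e_def)
qed

text \<open>The segment stays in the cone by \<open>axial_vector_in_cone\<close>, and along it the
  derivative of \<open>f\<close> is the positive \<open>i\<close>-th partial derivative.\<close>

lemma axial_vector_mono:
  assumes "- mu_plus \<Gamma> < a" "a \<le> b"
  shows "f (\<chi> j. if j = i then a else 1) \<le> f (\<chi> j. if j = i then b else 1)"
proof -
  define e where "e a = (\<chi> j::'n. if j = i then a else (1::real))" for a
  have "\<exists>y. ((\<lambda>t. f (e t)) has_real_derivative y) (at t) \<and> 0 \<le> y" if t: "a \<le> t" "t \<le> b" for t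
  proof -
    have eG: "e t \<in> \<Gamma>" unfolding e_def using axial_vector_in_cone[of t i] assms t by simp
    obtain V where "open V" "e t \<in> V" "V \<subseteq> \<Gamma>" "smooth_open V f"
      by (rule smooth_on_imp_local[OF f(1) \<Gamma>(1) eG]) auto
    then have D: "(f has_derivative dd f (e t)) (at (e t))"
      by (intro has_derivative_dd smooth_open_differentiable)
    define e0 where "e0 = (\<chi> j::'n. if j = i then 0 else (1::real))"
    have eeq: "e = (\<lambda>s. e0 + s *\<^sub>R axis i 1)" by (auto simp: e_def e0_def vec_eq_iff axis_def fun_eq_iff)
    have "(e has_derivative (\<lambda>s. s *\<^sub>R axis i 1)) (at t)"
      unfolding eeq by (auto intro!: derivative_eq_intros)
    from has_derivative_compose[OF this D]
    have "((\<lambda>t. f (e t)) has_real_derivative dd f (e t) (axis i 1)) (at t)"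
      using linear_cmul[OF has_derivative_linear[OF D]] by (simp add: has_field_derivative_def mult_commute_abs)
    moreover have "dd f (e t) (axis i 1) > 0" using f(4)[OF eG, of i] by (simp add: partial_def dd_def)
    ultimately show ?thesis by fastforce
  qed
  then have "f (e a) \<le> f (e b)"
    by (intro DERIV_nonneg_imp_nondecreasing[OF assms(2)]) auto
  then show ?thesis by (simp add: e_def)
qed

text \<open>Dividing by \<open>q\<close> moves the vector to the axial line with entry
  \<open>p / q\<close>, which is at least \<open>a\<close>. Homogeneity restores the factor, and
  positivity of \<open>f\<close> allows \<open>q\<close> to be replaced by the smaller
  \<epsilon>.\<close>

lemma cone_function_lower_bound:
  assumes q: "0 < \<epsilon>" "\<epsilon> \<le> q" and a: "- mu_plus \<Gamma> < a" "a * q \<le> p"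
  shows "(\<chi> j. if j = i then p else q) \<in> \<Gamma>"
    and "\<epsilon> * f (\<chi> j. if j = i then a else 1) \<le> f (\<chi> j. if j = i then p else q)"
    and "0 < \<epsilon> * f (\<chi> j. if j = i then a else 1)"
proof -
  define e where "e a = (\<chi> j::'n. if j = i then a else (1::real))" for a
  have eq: "(\<chi> j. if j = i then p else q) = q *\<^sub>R e (p / q)"
    using q by (simp add: e_def vec_eq_iff)
  have ap: "a \<le> p / q" using q a by (simp add: field_simps)
  have in\<Gamma>: "e a \<in> \<Gamma>" "e (p / q) \<in> \<Gamma>"
    unfolding e_def using a ap by (auto intro!: axial_vector_in_cone)
  show "(\<chi> j. if j = i then p else q) \<in> \<Gamma>" unfolding eq using q in\<Gamma> by (intro \<Gamma>(3)) auto
  show "0 < \<epsilon> * f (\<chi> j. if j = i then a else 1)"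
    using q f(3)[OF in\<Gamma>(1)] by (simp add: e_def)
  have "\<epsilon> * f (e a) \<le> q * f (e a)" using q f(3)[OF in\<Gamma>(1)] by simp
  also have "\<dots> \<le> q * f (e (p / q))" unfolding e_def using q axial_vector_mono[OF a(1) ap] by simp
  also have "\<dots> = f (q *\<^sub>R e (p / q))" using f(2)[OF in\<Gamma>(2)] q by simp
  finally show "\<epsilon> * f (\<chi> j. if j = i then a else 1) \<le> f (\<chi> j. if j = i then p else q)"
    unfolding eq by (simp add: e_def)
qed

end


section \<open>Curves in Riemannian manifolds\<close>

locale smooth_atlas =
  fixes X :: "'a topology" and A :: "('a, 'n::finite) chart set"
  assumes manifold: "smooth_manifold X A"
begin

lemma chart_on: "c \<in> A \<Longrightarrow> chart_on X c"
  using manifold by (simp add: smooth_manifold_def)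

lemma topspace_charts: "topspace X = (\<Union>c\<in>A. fst c)"
  using manifold by (simp add: smooth_manifold_def)

lemma chart_domain:
  assumes "c \<in> A"
  shows "openin X (fst c)" "fst c \<subseteq> topspace X"
  using chart_on[OF assms] openin_subset by (auto simp: chart_on_def)

lemma chart_homeomorphic:
  "c \<in> A \<Longrightarrow> homeomorphic_map (subtopology X (fst c)) (top_of_set (snd c ` fst c)) (snd c)"
  using chart_on by (auto simp: chart_on_def)

lemma topspace_chart_domain: "c \<in> A \<Longrightarrow> topspace (subtopology X (fst c)) = fst c"
  using chart_domain(2)[of c] by (simp add: Int_absorb1)

lemma chart_inj: "c \<in> A \<Longrightarrow> inj_on (snd c) (fst c)"
  using homeomorphic_imp_injective_map[OF chart_homeomorphic] topspace_chart_domain by metis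

lemma open_chart_image:
  assumes "c \<in> A" "openin X W" "W \<subseteq> fst c"
  shows "open (snd c ` W)"
proof -
  have "openin (subtopology X (fst c)) W" using assms by (auto simp: openin_subtopology)
  then have "openin (top_of_set (snd c ` fst c)) (snd c ` W)"
    using homeomorphic_imp_open_map[OF chart_homeomorphic[OF assms(1)]] by (simp add: open_map_def)
  then show ?thesis
    using chart_on[OF assms(1)] by (simp add: chart_on_def openin_open_eq)
qed

lemma chart_inv_simps:
  assumes "c \<in> A"
  shows "p \<in> fst c \<Longrightarrow> chart_inv c (snd c p) = p"
    and "y \<in> snd c ` fst c \<Longrightarrow> snd c (chart_inv c y) = y"
    and "y \<in> snd c ` fst c \<Longrightarrow> chart_inv c y \<in> fst c"
  using chart_inj[OF assms] by (auto simp: chart_inv_def f_inv_into_f inv_into_into)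

lemma chart_inv_image: "c \<in> A \<Longrightarrow> W \<subseteq> fst c \<Longrightarrow> y \<in> snd c ` W \<Longrightarrow> chart_inv c y \<in> W"
  using chart_inv_simps(1)[of c] by auto

lemma chart_inv_continuous:
  assumes "c \<in> A"
  shows "continuous_map (top_of_set (snd c ` fst c)) X (chart_inv c)"
proof -
  have "openin (top_of_set (snd c ` fst c)) {y \<in> snd c ` fst c. chart_inv c y \<in> W}" if "openin X W" for W
  proof -
    have "{y \<in> snd c ` fst c. chart_inv c y \<in> W} = snd c ` (fst c \<inter> W)"
      using chart_inv_simps[OF assms] by auto
    then show ?thesis
      using open_chart_image[OF assms, of "fst c \<inter> W"] chart_domain(1)[OF assms] that
      by (metis (no_types, lifting) Int_lower1 image_mono openin_Int open_subset)
  qed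
  then show ?thesis
    using chart_inv_simps(3)[OF assms] chart_domain(2)[OF assms] by (auto simp: continuous_map_def)
qed

lemma chart_continuous_on_curve:
  assumes "c \<in> A" "continuous_map (top_of_set T) X \<gamma>"
  shows "continuous_on {t \<in> T. \<gamma> t \<in> fst c} (snd c \<circ> \<gamma>)"
proof -
  let ?S = "{t \<in> T. \<gamma> t \<in> fst c}"
  have "continuous_map (top_of_set ?S) X \<gamma>"
    using continuous_map_from_subtopology_mono[OF assms(2), of ?S] by auto
  then have "continuous_map (top_of_set ?S) (subtopology X (fst c)) \<gamma>"
    by (auto simp: continuous_map_in_subtopology)
  from continuous_map_compose[OF this homeomorphic_imp_continuous_map[OF chart_homeomorphic[OF assms(1)]]]
  have "continuous_map (top_of_set ?S) euclidean (snd c \<circ> \<gamma>)"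
    by (rule continuous_map_into_fulltopology)
  then show ?thesis by (simp only: continuous_map_iff_continuous)
qed

lemma open_preimage_curve:
  assumes "open T" "continuous_map (top_of_set T) X \<gamma>" "openin X W"
  shows "open {t \<in> T. \<gamma> t \<in> W}"
  using openin_continuous_map_preimage[OF assms(2,3)] assms(1) by (simp add: openin_open_eq)

lemma transition_smooth:
  assumes "c \<in> A" "c' \<in> A" "p \<in> fst c" "p \<in> fst c'"
  obtains V where "open V" "snd c p \<in> V" "V \<subseteq> snd c ` (fst c \<inter> fst c')" "smooth_open V (snd c' \<circ> chart_inv c)"
proof (rule smooth_on_imp_local)
  show "smooth_on (snd c ` (fst c \<inter> fst c')) (snd c' \<circ> chart_inv c)"
    using manifold assms by (auto simp: smooth_manifold_def)
  show "open (snd c ` (fst c \<inter> fst c'))"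
    using chart_domain(1)[OF assms(1)] chart_domain(1)[OF assms(2)] assms(1) by (intro open_chart_image) auto
qed (use assms in auto)

lemma transition_has_derivative:
  assumes "c \<in> A" "c' \<in> A" "p \<in> fst c" "p \<in> fst c'"
  shows "((snd c' \<circ> chart_inv c) has_derivative dd (snd c' \<circ> chart_inv c) (snd c p)) (at (snd c p))"
  using transition_smooth[OF assms] by (metis has_derivative_dd smooth_open_differentiable)

lemma curve_has_derivative_transition:
  assumes "c \<in> A" "c' \<in> A" "open T" "t \<in> T" "continuous_map (top_of_set T) X \<gamma>"
    and "\<gamma> t \<in> fst c" "\<gamma> t \<in> fst c'"
    and v: "((snd c \<circ> \<gamma>) has_vector_derivative v) (at t)"
  shows "((snd c' \<circ> \<gamma>) has_vector_derivative dd (snd c' \<circ> chart_inv c) (snd c (\<gamma> t)) v) (at t)"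
proof -
  let ?S = "{s \<in> T. \<gamma> s \<in> fst c}"
  have S: "open ?S" "t \<in> ?S" using assms open_preimage_curve[OF assms(3,5) chart_domain(1)[OF assms(1)]] by auto
  have "((snd c' \<circ> chart_inv c) \<circ> (snd c \<circ> \<gamma>) has_vector_derivative dd (snd c' \<circ> chart_inv c) (snd c (\<gamma> t)) v) (at t)"
    using vector_derivative_diff_chain_within[OF v, of "snd c' \<circ> chart_inv c" "dd (snd c' \<circ> chart_inv c) (snd c (\<gamma> t))"]
      has_derivative_at_withinI[OF transition_has_derivative[OF assms(1,2,6,7)]] by simp
  then show ?thesis
    by (rule has_vector_derivative_transform_within_open[OF _ S]) (simp add: chart_inv_simps[OF assms(1)])
qed

text \<open>At an endpoint of the interval the curve is controlled from one side only; the extension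
  \<beta> is smooth on a full ball, so ordinary derivatives are available.\<close>

lemma smooth_curve_local_extension:
  assumes "smooth_curve X A a b \<gamma>" "c \<in> A" "t \<in> {a..b}" "\<gamma> t \<in> fst c"
  obtains d \<beta> where "d > 0" "smooth_open (ball t d) \<beta>"
    "\<And>s. s \<in> {a..b} \<Longrightarrow> s \<in> ball t d \<Longrightarrow> \<gamma> s \<in> fst c \<and> \<beta> s = snd c (\<gamma> s)"
proof -
  let ?S = "{t \<in> {a..b}. \<gamma> t \<in> fst c}"
  have "smooth_on ?S (snd c \<circ> \<gamma>)" using assms by (simp add: smooth_curve_def)
  then obtain U \<beta> where U: "open U" "t \<in> U" "\<forall>k. Ck_on k U \<beta>" "\<forall>s\<in>?S \<inter> U. \<beta> s = (snd c \<circ> \<gamma>) s"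
    using assms unfolding smooth_on_def by (metis (mono_tags, lifting) mem_Collect_eq)
  have "openin (top_of_set {a..b}) ?S"
    using openin_continuous_map_preimage[of "top_of_set {a..b}" X \<gamma> "fst c"] assms chart_domain
    by (simp add: smooth_curve_def)
  then obtain O' where O': "open O'" "?S = {a..b} \<inter> O'" by (auto simp: openin_open)
  have "open (U \<inter> O')" "t \<in> U \<inter> O'" using U O' assms by auto
  then obtain d where d: "d > 0" "ball t d \<subseteq> U \<inter> O'" using open_contains_ball by blast
  show thesis
  proof (rule that[OF d(1)])
    show "smooth_open (ball t d) \<beta>"
      using U(3) d(2) Ck_on_subset unfolding smooth_open_def by blast
    show "\<gamma> s \<in> fst c \<and> \<beta> s = snd c (\<gamma> s)" if "s \<in> {a..b}" "s \<in> ball t d" for s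
    proof -
      have "s \<in> ?S \<inter> U" using that d(2) O' by auto
      then show ?thesis using U(4) by auto
    qed
  qed
qed

end

locale riemannian_manifold = smooth_atlas X A for X :: "'a topology" and A :: "('a, 'n::finite) chart set" +
  fixes g :: "('a, 'n) metric"
  assumes metric: "riemannian_metric A g"
begin

lemma metric_symmetric: "c \<in> A \<Longrightarrow> p \<in> fst c \<Longrightarrow> transpose (g c p) = g c p"
  using metric by (simp add: riemannian_metric_def)

lemma metric_positive: "c \<in> A \<Longrightarrow> p \<in> fst c \<Longrightarrow> v \<noteq> 0 \<Longrightarrow> v \<bullet> (g c p *v v) > 0"
  using metric by (simp add: riemannian_metric_def)

lemma metric_nonneg: "c \<in> A \<Longrightarrow> p \<in> fst c \<Longrightarrow> v \<bullet> (g c p *v v) \<ge> 0"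
  using metric_positive[of c p v] by (cases "v = 0") auto

lemma metric_continuous:
  assumes "c \<in> A"
  shows "continuous_on (snd c ` fst c) (coord_metric g c)"
proof -
  have "\<exists>V. open V \<and> x \<in> V \<and> continuous_on V (coord_metric g c)" if x: "x \<in> snd c ` fst c" for x
  proof -
    have "smooth_on (snd c ` fst c) (coord_metric g c)" using metric assms by (simp add: riemannian_metric_def)
    then obtain V where "open V" "x \<in> V" "smooth_open V (coord_metric g c)"
      by (rule smooth_on_imp_local[OF _ open_chart_image[OF assms chart_domain(1)[OF assms] order_refl] x order_refl])
    then show ?thesis using smooth_open_continuous by blast
  qed
  then show ?thesis
    by (meson continuous_at_imp_continuous_on continuous_on_eq_continuous_at)
qed

lemma metric_transform:
  assumes "c \<in> A" "c' \<in> A" "p \<in> fst c" "p \<in> fst c'"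
  shows "v \<bullet> (g c p *v v) = dd (snd c' \<circ> chart_inv c) (snd c p) v \<bullet> (g c' p *v dd (snd c' \<circ> chart_inv c) (snd c p) v)"
proof -
  let ?D = "dd (snd c' \<circ> chart_inv c) (snd c p)"
  let ?J = "matrix ?D"
  have "linear ?D" using has_derivative_linear[OF transition_has_derivative[OF assms]] .
  then have J: "?J *v w = ?D w" for w by (rule matrix_vector_mult_matrix)
  have e: "?D = frechet_derivative (snd c' \<circ> chart_inv c) (at (snd c p))" by (simp add: dd_def fun_eq_iff)
  have "g c p = transpose ?J ** g c' p ** ?J"
    using metric assms unfolding riemannian_metric_def e Let_def by (metis (no_types, lifting) IntI)
  then have "v \<bullet> (g c p *v v) = v \<bullet> (transpose ?J *v (g c' p *v (?J *v v)))"
    by (simp add: matrix_vector_mul_assoc matrix_mul_assoc)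
  also have "\<dots> = (?J *v v) \<bullet> (g c' p *v (?J *v v))"
    using dot_lmul_matrix[of "g c' p *v (?J *v v)" ?J v] by (simp add: inner_commute)
  finally show ?thesis by (simp add: J)
qed

text \<open>\<open>speed\<close> evaluates in a chart picked by choice; the transformation law
  permits evaluation in whichever chart is at hand. The derivative is two-sided, whence the open
  \<open>T\<close>.\<close>

lemma speed_eq:
  assumes "c \<in> A" "open T" "t \<in> T" "continuous_map (top_of_set T) X \<gamma>" "\<gamma> t \<in> fst c"
    and v: "((snd c \<circ> \<gamma>) has_vector_derivative v) (at t)"
  shows "speed A g \<gamma> t = sqrt (v \<bullet> (g c (\<gamma> t) *v v))"
proof -
  define c' where "c' = (SOME c. c \<in> A \<and> \<gamma> t \<in> fst c)"
  have c': "c' \<in> A" "\<gamma> t \<in> fst c'"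
    using someI[of "\<lambda>c. c \<in> A \<and> \<gamma> t \<in> fst c" c] assms by (auto simp: c'_def)
  have "vector_derivative (snd c' \<circ> \<gamma>) (at t) = dd (snd c' \<circ> chart_inv c) (snd c (\<gamma> t)) v"
    by (rule vector_derivative_at[OF curve_has_derivative_transition[OF assms(1) c'(1) assms(2-5) c'(2) v]])
  then show ?thesis
    using metric_transform[OF assms(1) c'(1) assms(5) c'(2), of v] by (simp add: speed_def c'_def[symmetric] Let_def)
qed

lemma speed_nonneg: "\<gamma> t \<in> topspace X \<Longrightarrow> speed A g \<gamma> t \<ge> 0"
proof -
  assume "\<gamma> t \<in> topspace X"
  then have "\<exists>c. c \<in> A \<and> \<gamma> t \<in> fst c" by (auto simp: topspace_charts)
  then have "(SOME c. c \<in> A \<and> \<gamma> t \<in> fst c) \<in> A \<and> \<gamma> t \<in> fst (SOME c. c \<in> A \<and> \<gamma> t \<in> fst c)"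
    by (rule someI_ex)
  then show ?thesis using metric_nonneg by (simp add: speed_def Let_def)
qed

lemma smooth_curve_interior:
  assumes "smooth_curve X A a b \<gamma>"
  shows "continuous_map (top_of_set {a<..<b}) X \<gamma>"
  using assms continuous_map_from_subtopology_mono[of euclidean "{a..b}" X \<gamma> "{a<..<b}"]
  by (simp add: smooth_curve_def greaterThanLessThan_subseteq_atLeastAtMost_iff)

text \<open>Here \<beta> is the velocity of the extended curve. Its length in the metric is
  continuous up to the endpoints and agrees with \<open>speed\<close> in the interior.\<close>

lemma smooth_curve_speed_extension:
  assumes "smooth_curve X A a b \<gamma>" "c \<in> A" "t \<in> {a..b}" "\<gamma> t \<in> fst c"
  obtains d \<beta> where "d > 0" "\<And>s. s \<in> {a..b} \<inter> ball t d \<Longrightarrow> \<gamma> s \<in> fst c"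
    "continuous_on ({a..b} \<inter> ball t d) (\<lambda>s. sqrt (\<beta> s \<bullet> (g c (\<gamma> s) *v \<beta> s)))"
    "\<And>s. s \<in> {a<..<b} \<inter> ball t d \<Longrightarrow> ((snd c \<circ> \<gamma>) has_vector_derivative \<beta> s) (at s)"
    "\<And>s. s \<in> {a<..<b} \<inter> ball t d \<Longrightarrow> speed A g \<gamma> s = sqrt (\<beta> s \<bullet> (g c (\<gamma> s) *v \<beta> s))"
proof -
  obtain d \<beta> where d: "d > 0" "smooth_open (ball t d) \<beta>"
    and \<beta>: "\<And>s. s \<in> {a..b} \<Longrightarrow> s \<in> ball t d \<Longrightarrow> \<gamma> s \<in> fst c \<and> \<beta> s = snd c (\<gamma> s)"
    by (rule smooth_curve_local_extension[OF assms]) blast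
  have D: "((snd c \<circ> \<gamma>) has_vector_derivative dd \<beta> s 1) (at s)" if s: "s \<in> {a<..<b} \<inter> ball t d" for s
  proof -
    have h: "(\<beta> has_derivative dd \<beta> s) (at s)"
      using s by (intro has_derivative_dd smooth_open_differentiable[OF d(2)]) auto
    have "dd \<beta> s = (\<lambda>x. x *\<^sub>R dd \<beta> s 1)"
    proof
      show "dd \<beta> s x = x *\<^sub>R dd \<beta> s 1" for x
        using linear_cmul[OF has_derivative_linear[OF h], of x 1] by simp
    qed
    then have "(\<beta> has_vector_derivative dd \<beta> s 1) (at s)"
      using h by (simp add: has_vector_derivative_def)
    then show ?thesis
      by (rule has_vector_derivative_transform_within_open[of _ _ _ "{a<..<b} \<inter> ball t d"])
        (use s \<beta> in auto)
  qed
  have cm: "continuous_on ({a..b} \<inter> ball t d) (\<lambda>s. g c (\<gamma> s))"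
  proof -
    have "continuous_on ({a..b} \<inter> ball t d) (\<lambda>s. coord_metric g c (\<beta> s))"
      by (rule continuous_on_compose2[OF metric_continuous[OF assms(2)]
            continuous_on_subset[OF smooth_open_continuous[OF d(2)]]]) (use \<beta> in auto)
    then show ?thesis
      by (rule continuous_on_eq) (use \<beta> in \<open>auto simp: coord_metric_def chart_inv_simps[OF assms(2)]\<close>)
  qed
  have cb: "continuous_on ({a..b} \<inter> ball t d) (\<lambda>s. dd \<beta> s 1)"
    by (rule continuous_on_subset[OF smooth_open_continuous[OF smooth_open_dd[OF d(2)]]]) auto
  have "continuous_on ({a..b} \<inter> ball t d) (\<lambda>s. sqrt (dd \<beta> s 1 \<bullet> (g c (\<gamma> s) *v dd \<beta> s 1)))"
    using cm cb unfolding matrix_vector_mult_def inner_vec_def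
    by (auto intro!: continuous_intros)
  then show thesis
    using that[OF d(1), of "\<lambda>s. dd \<beta> s 1"] \<beta> D
      speed_eq[OF assms(2) _ _ smooth_curve_interior[OF assms(1)]] by force
qed

lemma smooth_curve_in_space:
  "smooth_curve X A a b \<gamma> \<Longrightarrow> t \<in> {a..b} \<Longrightarrow> \<gamma> t \<in> topspace X"
  by (auto simp: smooth_curve_def continuous_map_def)

text \<open>At \<open>a\<close> and \<open>b\<close> the two-sided derivative in
  \<open>speed\<close> depends on \<gamma> outside the interval. On small subintervals
  \<open>speed\<close> differs from a continuous function at most at the two ends, which does not
  affect integrability.\<close>

lemma smooth_curve_speed_integrable:
  assumes "smooth_curve X A a b \<gamma>"
  shows "speed A g \<gamma> integrable_on {a..b}"
proof -
  have "\<exists>d>0. \<forall>u v. t \<in> cbox u v \<and> cbox u v \<subseteq> ball t d \<and> cbox u v \<subseteq> cbox a b \<longrightarrow> speed A g \<gamma> integrable_on cbox u v"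
    if t: "t \<in> cbox a b" for t
  proof -
    obtain c where c: "c \<in> A" "\<gamma> t \<in> fst c"
      using smooth_curve_in_space[OF assms, of t] t unfolding topspace_charts by (metis UN_E cbox_interval)
    have t': "t \<in> {a..b}" using t by simp
    obtain d \<beta> where d: "d > 0"
      "continuous_on ({a..b} \<inter> ball t d) (\<lambda>s. sqrt (\<beta> s \<bullet> (g c (\<gamma> s) *v \<beta> s)))"
      "\<And>s. s \<in> {a<..<b} \<inter> ball t d \<Longrightarrow> speed A g \<gamma> s = sqrt (\<beta> s \<bullet> (g c (\<gamma> s) *v \<beta> s))"
      by (rule smooth_curve_speed_extension[OF assms c(1) t' c(2)]) blast
    show ?thesis
    proof (intro exI[of _ d] conjI d(1) allI impI)
      fix u v assume uv: "t \<in> cbox u v \<and> cbox u v \<subseteq> ball t d \<and> cbox u v \<subseteq> cbox a b"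
      have int: "(\<lambda>s. sqrt (\<beta> s \<bullet> (g c (\<gamma> s) *v \<beta> s))) integrable_on cbox u v"
        using uv by (intro integrable_continuous continuous_on_subset[OF d(2)]) auto
      have eq: "speed A g \<gamma> s = sqrt (\<beta> s \<bullet> (g c (\<gamma> s) *v \<beta> s))" if "s \<in> cbox u v - {u, v}" for s
      proof (rule d(3))
        have "a \<le> u" "v \<le> b" using uv by auto
        then show "s \<in> {a<..<b} \<inter> ball t d" using that uv by auto
      qed
      show "speed A g \<gamma> integrable_on cbox u v"
        by (rule integrable_spike_finite[where S = "{u, v}", OF _ _ int]) (simp, rule eq)
    qed
  qed
  then show ?thesis using integrable_on_little_subintervals[of a b "speed A g \<gamma>"] by simp
qed

end

section \<open>Shifting and concatenating piecewise smooth curves\<close>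

lemma smooth_on_cong:
  assumes "smooth_on S f" "\<And>x. x \<in> S \<Longrightarrow> f x = f' x"
  shows "smooth_on S f'"
  unfolding smooth_on_def
proof
  fix x assume "x \<in> S"
  then obtain U h where "open U" "x \<in> U" "\<forall>k. Ck_on k U h" "\<forall>y\<in>S \<inter> U. h y = f y"
    using assms(1) unfolding smooth_on_def by meson
  then show "\<exists>U h. open U \<and> x \<in> U \<and> (\<forall>k. Ck_on k U h) \<and> (\<forall>y\<in>S \<inter> U. h y = f' y)"
    using assms(2) by (intro exI[of _ U] exI[of _ h]) auto
qed

lemma smooth_on_shift:
  fixes f :: "real \<Rightarrow> 'b::real_normed_vector"
  assumes "smooth_on S f"
  shows "smooth_on {t. t + h \<in> S} (\<lambda>t. f (t + h))"
  unfolding smooth_on_def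
proof
  fix t assume "t \<in> {t. t + h \<in> S}"
  then obtain U f' where U: "open U" "t + h \<in> U" "\<forall>k. Ck_on k U f'" "\<forall>y\<in>S \<inter> U. f' y = f y"
    using assms unfolding smooth_on_def by blast
  have "Ck_on k {t. t + h \<in> U} (\<lambda>t. f' (t + h))" for k
    using Ck_on_line[OF U(1), of k f' h 1] U(3) by (simp add: add.commute)
  moreover have "open {t. t + h \<in> U}"
    using open_vimage[OF U(1), of "\<lambda>t. t + h"] by (simp add: vimage_def continuous_intros)
  ultimately show "\<exists>V h'. open V \<and> t \<in> V \<and> (\<forall>k. Ck_on k V h') \<and> (\<forall>y\<in>{t. t + h \<in> S} \<inter> V. h' y = f (y + h))"
    using U by (intro exI[of _ "{t. t + h \<in> U}"] exI[of _ "\<lambda>t. f' (t + h)"]) auto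
qed

lemma smooth_curve_cong:
  assumes "smooth_curve X A a b \<gamma>" "\<And>t. t \<in> {a..b} \<Longrightarrow> \<gamma> t = \<gamma>' t"
  shows "smooth_curve X A a b \<gamma>'"
proof -
  have "continuous_map (top_of_set {a..b}) X \<gamma>'"
    using assms by (auto simp: smooth_curve_def intro: continuous_map_eq)
  moreover have "smooth_on {t \<in> {a..b}. \<gamma>' t \<in> fst c} (snd c \<circ> \<gamma>')" if "c \<in> A" for c
  proof -
    have "{t \<in> {a..b}. \<gamma>' t \<in> fst c} = {t \<in> {a..b}. \<gamma> t \<in> fst c}" using assms(2) by auto
    moreover have "smooth_on {t \<in> {a..b}. \<gamma> t \<in> fst c} (snd c \<circ> \<gamma>)"
      using assms(1) that by (simp add: smooth_curve_def)
    then have "smooth_on {t \<in> {a..b}. \<gamma> t \<in> fst c} (snd c \<circ> \<gamma>')"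
      by (rule smooth_on_cong) (use assms(2) in auto)
    ultimately show ?thesis by simp
  qed
  ultimately show ?thesis by (simp add: smooth_curve_def)
qed

lemma smooth_curve_shift:
  assumes "smooth_curve X A a b \<gamma>"
  shows "smooth_curve X A (a - h) (b - h) (\<lambda>t. \<gamma> (t + h))"
proof -
  have "continuous_map (top_of_set {a - h..b - h}) (top_of_set {a..b}) (\<lambda>t. t + h)"
    by (auto simp: continuous_map_in_subtopology continuous_on_add)
  then have "continuous_map (top_of_set {a - h..b - h}) X (\<lambda>t. \<gamma> (t + h))"
    using continuous_map_compose[of _ "top_of_set {a..b}" "\<lambda>t. t + h" X \<gamma>] assms
    unfolding smooth_curve_def o_def by blast
  moreover have "smooth_on {t \<in> {a - h..b - h}. \<gamma> (t + h) \<in> fst c} (snd c \<circ> (\<lambda>t. \<gamma> (t + h)))" if "c \<in> A" for c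
  proof -
    have "smooth_on {t \<in> {a..b}. \<gamma> t \<in> fst c} (snd c \<circ> \<gamma>)"
      using assms that by (simp add: smooth_curve_def)
    from smooth_on_shift[OF this, of h]
    show ?thesis by (simp add: o_def le_diff_eq diff_le_eq)
  qed
  ultimately show ?thesis by (simp add: smooth_curve_def)
qed

lemma knots_mono:
  fixes s :: "nat \<Rightarrow> real"
  assumes "\<forall>j<m. s j < s (Suc j)" "i \<le> j" "j \<le> m"
  shows "s i \<le> s j"
  using assms(2,3)
proof (induction j rule: dec_induct)
  case (step j)
  then show ?case using assms(1) by (metis Suc_le_eq less_le_not_le less_imp_le order_trans)
qed simp

lemma piecewise_smooth_curve_cong:
  assumes "piecewise_smooth_curve X A a b \<gamma>" "\<And>t. t \<in> {a..b} \<Longrightarrow> \<gamma> t = \<gamma>' t"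
  shows "piecewise_smooth_curve X A a b \<gamma>'"
proof -
  obtain m :: nat and s where s: "m > 0" "s 0 = a" "s m = b"
    "\<forall>j<m. s j < s (Suc j) \<and> smooth_curve X A (s j) (s (Suc j)) \<gamma>"
    using assms(1) unfolding piecewise_smooth_curve_def by blast
  have "smooth_curve X A (s j) (s (Suc j)) \<gamma>'" if "j < m" for j
  proof -
    have "s 0 \<le> s j" "s (Suc j) \<le> s m" using knots_mono[of m s] s(4) that by auto
    with s that assms(2) show ?thesis
      by (intro smooth_curve_cong[where \<gamma>' = \<gamma>' and \<gamma> = \<gamma>]) auto
  qed
  then show ?thesis using s unfolding piecewise_smooth_curve_def by blast
qed

lemma piecewise_smooth_curve_shift:
  assumes "piecewise_smooth_curve X A a b \<gamma>"
  shows "piecewise_smooth_curve X A (a - h) (b - h) (\<lambda>t. \<gamma> (t + h))"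
proof -
  obtain m :: nat and s where s: "m > 0" "s 0 = a" "s m = b"
    "\<forall>j<m. s j < s (Suc j) \<and> smooth_curve X A (s j) (s (Suc j)) \<gamma>"
    using assms(1) unfolding piecewise_smooth_curve_def by blast
  then show ?thesis
    unfolding piecewise_smooth_curve_def
    by (intro exI[of _ m] exI[of _ "\<lambda>j. s j - h"]) (auto intro: smooth_curve_shift)
qed

lemma piecewise_smooth_curve_append:
  assumes "piecewise_smooth_curve X A a b \<gamma>" "piecewise_smooth_curve X A b c \<gamma>"
  shows "piecewise_smooth_curve X A a c \<gamma>"
proof -
  obtain m :: nat and s where s: "m > 0" "s 0 = a" "s m = b"
    "\<forall>j<m. s j < s (Suc j) \<and> smooth_curve X A (s j) (s (Suc j)) \<gamma>"
    using assms(1) unfolding piecewise_smooth_curve_def by blast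
  obtain m' :: nat and s' where s': "m' > 0" "s' 0 = b" "s' m' = c"
    "\<forall>j<m'. s' j < s' (Suc j) \<and> smooth_curve X A (s' j) (s' (Suc j)) \<gamma>"
    using assms(2) unfolding piecewise_smooth_curve_def by blast
  \<comment> \<open>Index \<open>m\<close> belongs to both lists of knots with the common value
    \<open>b\<close>, so the second list can be read from \<open>j = m\<close> on.\<close>
  define u where "u j = (if j \<le> m then s j else s' (j - m))" for j
  have u': "u j = s' (j - m)" if "m \<le> j" for j using that s(3) s'(2) by (auto simp: u_def)
  have "u j < u (Suc j) \<and> smooth_curve X A (u j) (u (Suc j)) \<gamma>" if "j < m + m'" for j
  proof (cases "j < m")
    case True
    then show ?thesis using s(4) by (simp add: u_def)
  next
    case False
    then have "j - m < m'" "Suc j - m = Suc (j - m)" using that by auto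
    then show ?thesis using s'(4) u'[of j] u'[of "Suc j"] False by simp
  qed
  moreover have "u 0 = a" "u (m + m') = c" using s u'[of "m + m'"] s' by (simp_all add: u_def)
  ultimately show ?thesis
    unfolding piecewise_smooth_curve_def using s(1) by (intro exI[of _ "m + m'"] exI[of _ u]) auto
qed

lemma vector_derivative_cong_open:
  assumes "open T" "t \<in> T" "\<And>s. s \<in> T \<Longrightarrow> f s = f' s"
  shows "vector_derivative f (at t) = vector_derivative f' (at t)"
proof -
  have "(f has_vector_derivative v) (at t) \<longleftrightarrow> (f' has_vector_derivative v) (at t)" for v
    using assms has_vector_derivative_transform_within_open[OF _ assms(1,2)] by metis
  then show ?thesis by (simp add: vector_derivative_def)
qed

lemma speed_cong:
  fixes A :: "('a, 'n::finite) chart set"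
  assumes "open T" "t \<in> T" "\<And>s. s \<in> T \<Longrightarrow> \<gamma> s = \<gamma>' s"
  shows "speed A g \<gamma> t = speed A g \<gamma>' t"
proof -
  have "vector_derivative (snd c \<circ> \<gamma>) (at t) = vector_derivative (snd c \<circ> \<gamma>') (at t)" for c :: "('a, 'n) chart"
    by (rule vector_derivative_cong_open[OF assms(1,2)]) (simp add: assms(3))
  then show ?thesis using assms(2,3) by (simp add: speed_def Let_def)
qed

lemma vector_derivative_shift:
  fixes f :: "real \<Rightarrow> 'b::real_normed_vector"
  shows "vector_derivative (\<lambda>s. f (s + h)) (at t) = vector_derivative f (at (t + h))"
proof -
  have a: "((\<lambda>s. f (s + h)) has_vector_derivative v) (at t)"
    if "(f has_vector_derivative v) (at (t + h))" for f :: "real \<Rightarrow> 'b" and t h v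
  proof -
    have "((\<lambda>s. s + h) has_vector_derivative 1) (at t)" by (auto intro!: derivative_eq_intros)
    from vector_diff_chain_at[OF this that] show ?thesis by (simp add: o_def)
  qed
  have "((\<lambda>s. f (s + h)) has_vector_derivative v) (at t) \<longleftrightarrow> (f has_vector_derivative v) (at (t + h))" for v
    using a[of f v t h] a[of "\<lambda>s. f (s + h)" v "t + h" "- h"] by auto
  then show ?thesis by (simp add: vector_derivative_def)
qed

lemma speed_shift:
  fixes A :: "('a, 'n::finite) chart set"
  shows "speed A g (\<lambda>s. \<gamma> (s + h)) t = speed A g \<gamma> (t + h)"
proof -
  have "vector_derivative (snd c \<circ> (\<lambda>s. \<gamma> (s + h))) (at t) = vector_derivative (snd c \<circ> \<gamma>) (at (t + h))"
    for c :: "('a, 'n) chart"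
    using vector_derivative_shift[of "snd c \<circ> \<gamma>" h t] by (simp add: o_def)
  then show ?thesis by (simp add: speed_def Let_def)
qed

text \<open>Trades the infimum for a witness curve. If no curve joins the points, the infimum is
  infinite and both sides are false.\<close>

lemma riemannian_dist_less_iff:
  "riemannian_dist X A g p q < ereal e \<longleftrightarrow> (\<exists>a b \<gamma>. piecewise_smooth_curve X A a b \<gamma> \<and>
     \<gamma> a = p \<and> \<gamma> b = q \<and> riemannian_length A g a b \<gamma> < e)"
proof
  assume "riemannian_dist X A g p q < ereal e"
  then obtain x where "x \<in> {ereal (riemannian_length A g a b \<gamma>) |a b \<gamma>.
     piecewise_smooth_curve X A a b \<gamma> \<and> \<gamma> a = p \<and> \<gamma> b = q}" "x < ereal e"
    unfolding riemannian_dist_def Inf_less_iff by (elim bexE)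
  then show "\<exists>a b \<gamma>. piecewise_smooth_curve X A a b \<gamma> \<and> \<gamma> a = p \<and> \<gamma> b = q \<and> riemannian_length A g a b \<gamma> < e"
    by (elim CollectE exE conjE) (intro exI conjI, auto)
next
  assume "\<exists>a b \<gamma>. piecewise_smooth_curve X A a b \<gamma> \<and> \<gamma> a = p \<and> \<gamma> b = q \<and> riemannian_length A g a b \<gamma> < e"
  then obtain a b \<gamma> where 1: "piecewise_smooth_curve X A a b \<gamma>" "\<gamma> a = p" "\<gamma> b = q" "riemannian_length A g a b \<gamma> < e"
    by (elim exE conjE)
  have "riemannian_dist X A g p q \<le> ereal (riemannian_length A g a b \<gamma>)"
    unfolding riemannian_dist_def by (rule Inf_lower) (use 1 in blast)
  also have "\<dots> < ereal e" using 1 by simp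
  finally show "riemannian_dist X A g p q < ereal e" .
qed

section \<open>Length, triangle inequality and functions with bounded gradient\<close>

context riemannian_manifold
begin

lemma piecewise_smooth_curve_length:
  assumes "piecewise_smooth_curve X A a b \<gamma>"
  shows "a < b" "speed A g \<gamma> integrable_on {a..b}" "0 \<le> riemannian_length A g a b \<gamma>"
    "\<And>t. t \<in> {a..b} \<Longrightarrow> \<gamma> t \<in> topspace X"
proof -
  obtain m :: nat and s where s: "m > 0" "s 0 = a" "s m = b"
    "\<forall>j<m. s j < s (Suc j) \<and> smooth_curve X A (s j) (s (Suc j)) \<gamma>"
    using assms(1) unfolding piecewise_smooth_curve_def by blast
  have mono: "s i \<le> s j" if "i \<le> j" "j \<le> m" for i j using knots_mono[of m s] s(4) that by auto
  show "a < b" using mono[of "Suc 0" m] s by force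
  have "speed A g \<gamma> integrable_on {s 0..s j} \<and> (\<forall>t\<in>{s 0..s j}. \<gamma> t \<in> topspace X)" if "j \<le> m" for j
    using that
  proof (induction j)
    case 0
    have "\<gamma> (s 0) \<in> topspace X" using s smooth_curve_in_space[of "s 0" "s (Suc 0)" \<gamma> "s 0"] by auto
    then show ?case using integrable_on_refl[of "speed A g \<gamma>" "s 0"] by simp
  next
    case (Suc j)
    have sc: "smooth_curve X A (s j) (s (Suc j)) \<gamma>" using Suc.prems s(4) by auto
    have le: "s 0 \<le> s j" "s j \<le> s (Suc j)" using mono Suc.prems by auto
    have "speed A g \<gamma> integrable_on {s 0..s (Suc j)}"
      using Suc smooth_curve_speed_integrable[OF sc] le by (simp add: Henstock_Kurzweil_Integration.integrable_combine[of "s 0" "s j" "s (Suc j)"])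
    moreover have "\<gamma> t \<in> topspace X" if "t \<in> {s 0..s (Suc j)}" for t
      using Suc smooth_curve_in_space[OF sc, of t] that le by (cases "t \<le> s j") auto
    ultimately show ?case by blast
  qed
  from this[of m] s have i: "speed A g \<gamma> integrable_on {a..b}" "\<forall>t\<in>{a..b}. \<gamma> t \<in> topspace X" by auto
  then show "speed A g \<gamma> integrable_on {a..b}" "\<And>t. t \<in> {a..b} \<Longrightarrow> \<gamma> t \<in> topspace X" by auto
  show "0 \<le> riemannian_length A g a b \<gamma>"
    unfolding riemannian_length_def using i by (intro integral_nonneg) (auto intro: speed_nonneg)
qed

lemma riemannian_dist_nonneg: "0 \<le> riemannian_dist X A g p q"
  unfolding riemannian_dist_def
  by (rule Inf_greatest) (auto dest: piecewise_smooth_curve_length(3))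

text \<open>The second curve is shifted in time to start at \<open>b\<close> and glued to the first.
  Lengths add because the speed of the glued curve agrees with the original speeds off the ends of
  the two pieces.\<close>

lemma riemannian_dist_triangle:
  assumes "riemannian_dist X A g p q < ereal e" "riemannian_dist X A g q r < ereal e'"
  shows "riemannian_dist X A g p r < ereal (e + e')"
proof -
  obtain a b \<gamma> where 1: "piecewise_smooth_curve X A a b \<gamma>" "\<gamma> a = p" "\<gamma> b = q" "riemannian_length A g a b \<gamma> < e"
    using assms(1) unfolding riemannian_dist_less_iff by blast
  obtain c d \<beta> where 2: "piecewise_smooth_curve X A c d \<beta>" "\<beta> c = q" "\<beta> d = r" "riemannian_length A g c d \<beta> < e'"
    using assms(2) unfolding riemannian_dist_less_iff by blast
  define h where "h = c - b"
  define \<alpha> where "\<alpha> t = (if t \<le> b then \<gamma> t else \<beta> (t + h))" for t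
  have ab: "a < b" and cd: "c < d"
    using piecewise_smooth_curve_length(1) 1 2 by auto
  have \<alpha>1: "\<alpha> t = \<gamma> t" if "t \<le> b" for t using that by (simp add: \<alpha>_def)
  have \<alpha>2: "\<alpha> t = \<beta> (t + h)" if "b \<le> t" for t using that 1(3) 2(2) by (cases "t = b") (auto simp: \<alpha>_def h_def)
  have p1: "piecewise_smooth_curve X A a b \<alpha>"
    by (rule piecewise_smooth_curve_cong[OF 1(1)]) (simp add: \<alpha>1)
  have p2: "piecewise_smooth_curve X A b (d - h) \<alpha>"
    by (rule piecewise_smooth_curve_cong[of _ _ _ _ "\<lambda>t. \<beta> (t + h)"])
      (use piecewise_smooth_curve_shift[OF 2(1), of h] in \<open>simp_all add: h_def \<alpha>2\<close>)
  have p: "piecewise_smooth_curve X A a (d - h) \<alpha>" by (rule piecewise_smooth_curve_append[OF p1 p2])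
  have l1: "integral {a..b} (speed A g \<alpha>) = integral {a..b} (speed A g \<gamma>)"
  proof (rule integral_spike[of "{a, b}"])
    show "speed A g \<gamma> t = speed A g \<alpha> t" if "t \<in> {a..b} - {a, b}" for t
      by (rule speed_cong[of "{..<b}"]) (use that \<alpha>1 in auto)
  qed auto
  have bd: "b < d - h" using cd by (simp add: h_def)
  have l2: "integral {b..d - h} (speed A g \<alpha>) = integral {b..d - h} (\<lambda>t. speed A g \<beta> (t + h))"
  proof (rule integral_spike[of "{b, d - h}"])
    show "speed A g \<beta> (t + h) = speed A g \<alpha> t" if "t \<in> {b..d - h} - {b, d - h}" for t
      unfolding speed_shift[symmetric]
      by (rule speed_cong[of "{b<..}"]) (use that \<alpha>2 in auto)
  qed auto
  have cb: "c - h = b" by (simp add: h_def)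
  have "((\<lambda>t. speed A g \<beta> (t + h)) has_integral integral {c..d} (speed A g \<beta>)) {b..d - h}"
    using has_integral_affinity[of "speed A g \<beta>" "integral {c..d} (speed A g \<beta>)" c d 1 h]
      piecewise_smooth_curve_length(2)[OF 2(1)] cd
    by (simp add: integrable_integral cb)
  then have l3: "integral {b..d - h} (speed A g \<alpha>) = integral {c..d} (speed A g \<beta>)"
    unfolding l2 by (rule integral_unique)
  have "riemannian_length A g a (d - h) \<alpha> = integral {a..b} (speed A g \<alpha>) + integral {b..d - h} (speed A g \<alpha>)"
    unfolding riemannian_length_def
    using Henstock_Kurzweil_Integration.integral_combine[OF _ _ piecewise_smooth_curve_length(2)[OF p], of b] ab bd by simp
  also have "\<dots> < e + e'" using 1(4) 2(4) unfolding riemannian_length_def l1 l3 by simp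
  finally show ?thesis
    unfolding riemannian_dist_less_iff using p \<alpha>1[of a] \<alpha>2[of "d - h"] 1(2) 2(3) ab bd by force
qed

text \<open>Fundamental theorem of calculus for \<Theta> along each smooth piece, with the gradient
  bound applied to the velocity. The gauge integral integrates every derivative, so pointwise
  differentiability of \<Theta> is enough.\<close>

lemma curve_length_lower_bound:
  fixes \<Theta> :: "'a \<Rightarrow> real"
  assumes diff: "\<And>c p. c \<in> A \<Longrightarrow> p \<in> fst c \<Longrightarrow> (\<Theta> \<circ> chart_inv c) differentiable (at (snd c p))"
    and grad: "\<And>c p v. c \<in> A \<Longrightarrow> p \<in> fst c \<Longrightarrow> dd (\<Theta> \<circ> chart_inv c) (snd c p) v \<le> sqrt (v \<bullet> (g c p *v v))"
    and "piecewise_smooth_curve X A a b \<gamma>"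
  shows "\<Theta> (\<gamma> b) - \<Theta> (\<gamma> a) \<le> riemannian_length A g a b \<gamma>"
proof -
  have piece: "\<Theta> (\<gamma> v) - \<Theta> (\<gamma> u) \<le> integral {u..v} (speed A g \<gamma>)" if sc: "smooth_curve X A u v \<gamma>" and "u < v" for u v
  proof -
    have ex: "\<exists>w. ((\<Theta> \<circ> \<gamma>) has_vector_derivative w) (at t) \<and> w \<le> speed A g \<gamma> t" if t: "t \<in> {u<..<v}" for t
    proof -
      have t': "t \<in> {u..v}" using t by auto
      obtain c where c: "c \<in> A" "\<gamma> t \<in> fst c"
        using smooth_curve_in_space[OF sc t'] unfolding topspace_charts by (rule UN_E)
      obtain d \<beta> where d: "d > 0" "\<And>s. s \<in> {u..v} \<inter> ball t d \<Longrightarrow> \<gamma> s \<in> fst c"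
        "\<And>s. s \<in> {u<..<v} \<inter> ball t d \<Longrightarrow> ((snd c \<circ> \<gamma>) has_vector_derivative \<beta> s) (at s)"
        "\<And>s. s \<in> {u<..<v} \<inter> ball t d \<Longrightarrow> speed A g \<gamma> s = sqrt (\<beta> s \<bullet> (g c (\<gamma> s) *v \<beta> s))"
        by (rule smooth_curve_speed_extension[OF sc c(1) t' c(2)]) blast
      have tb: "t \<in> {u<..<v} \<inter> ball t d" using t d(1) by auto
      have "((\<Theta> \<circ> chart_inv c) \<circ> (snd c \<circ> \<gamma>) has_vector_derivative dd (\<Theta> \<circ> chart_inv c) (snd c (\<gamma> t)) (\<beta> t)) (at t)"
        using vector_derivative_diff_chain_within[OF d(3)[OF tb], of "\<Theta> \<circ> chart_inv c" "dd (\<Theta> \<circ> chart_inv c) (snd c (\<gamma> t))"]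
          has_derivative_at_withinI[OF has_derivative_dd[OF diff[OF c]]] by simp
      then have "((\<Theta> \<circ> \<gamma>) has_vector_derivative dd (\<Theta> \<circ> chart_inv c) (snd c (\<gamma> t)) (\<beta> t)) (at t)"
        by (rule has_vector_derivative_transform_within_open[of _ _ _ "{u<..<v} \<inter> ball t d"])
          (use tb d(2) in \<open>auto simp: chart_inv_simps(1)[OF c(1)]\<close>)
      then show ?thesis using grad[OF c, of "\<beta> t"] d(4)[OF tb] by auto
    qed
    then obtain w where w: "\<And>t. t \<in> {u<..<v} \<Longrightarrow> ((\<Theta> \<circ> \<gamma>) has_vector_derivative w t) (at t) \<and> w t \<le> speed A g \<gamma> t"
      by metis
    \<comment> \<open>At the endpoints the value 0 lies below the nonnegative speed, so the
      comparison of integrands holds on the whole closed interval.\<close>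
    define w' where "w' t = (if t \<in> {u<..<v} then w t else 0)" for t
    have "continuous_on {u..v} (\<Theta> \<circ> \<gamma>)"
      unfolding continuous_on_eq_continuous_within
    proof
      fix t assume t: "t \<in> {u..v}"
      obtain c where c: "c \<in> A" "\<gamma> t \<in> fst c"
        using smooth_curve_in_space[OF sc t] unfolding topspace_charts by (rule UN_E)
      obtain d \<beta> where d: "d > 0" "smooth_open (ball t d) \<beta>"
        "\<And>s. s \<in> {u..v} \<Longrightarrow> s \<in> ball t d \<Longrightarrow> \<gamma> s \<in> fst c \<and> \<beta> s = snd c (\<gamma> s)"
        by (rule smooth_curve_local_extension[OF sc c(1) t c(2)]) blast
      have "isCont \<beta> t"
        using smooth_open_continuous[OF d(2)] d(1) by (simp add: continuous_on_eq_continuous_at)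
      moreover have "isCont (\<Theta> \<circ> chart_inv c) (\<beta> t)"
        using differentiable_imp_continuous_within[OF diff[OF c]] d(1) d(3)[of t] t by simp
      ultimately have "isCont ((\<Theta> \<circ> chart_inv c) \<circ> \<beta>) t" by (rule continuous_at_compose)
      then have "continuous (at t within {u..v}) ((\<Theta> \<circ> chart_inv c) \<circ> \<beta>)"
        by (rule continuous_at_imp_continuous_at_within)
      then show "continuous (at t within {u..v}) (\<Theta> \<circ> \<gamma>)"
        by (rule continuous_transform_within[OF _ d(1) t])
          (use d(3) in \<open>auto simp: chart_inv_simps(1)[OF c(1)] dist_commute\<close>)
    qed
    then have "(w' has_integral ((\<Theta> \<circ> \<gamma>) v - (\<Theta> \<circ> \<gamma>) u)) {u..v}"
      using w \<open>u < v\<close> by (intro fundamental_theorem_of_calculus_interior_strong[of "{}"]) (auto simp: w'_def o_def)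
    moreover have "(speed A g \<gamma> has_integral integral {u..v} (speed A g \<gamma>)) {u..v}"
      using smooth_curve_speed_integrable[OF sc] by (rule integrable_integral)
    moreover have "w' t \<le> speed A g \<gamma> t" if "t \<in> {u..v}" for t
      using w[of t] speed_nonneg[of \<gamma> t, OF smooth_curve_in_space[OF sc that]] by (auto simp: w'_def)
    ultimately have "(\<Theta> \<circ> \<gamma>) v - (\<Theta> \<circ> \<gamma>) u \<le> integral {u..v} (speed A g \<gamma>)"
      by (rule has_integral_le)
    then show ?thesis by simp
  qed
  obtain m :: nat and s where s: "m > 0" "s 0 = a" "s m = b"
    "\<forall>j<m. s j < s (Suc j) \<and> smooth_curve X A (s j) (s (Suc j)) \<gamma>"
    using assms(3) unfolding piecewise_smooth_curve_def by blast
  have mono: "s i \<le> s j" if "i \<le> j" "j \<le> m" for i j using knots_mono[of m s] s(4) that by auto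
  have "\<Theta> (\<gamma> (s j)) - \<Theta> (\<gamma> (s 0)) \<le> integral {s 0..s j} (speed A g \<gamma>)" if "j \<le> m" for j
    using that
  proof (induction j)
    case (Suc j)
    have sj: "s j < s (Suc j)" "smooth_curve X A (s j) (s (Suc j)) \<gamma>" using Suc.prems s(4) by auto
    have le: "s 0 \<le> s j" "s (Suc j) \<le> s m" using mono Suc.prems by auto
    have "speed A g \<gamma> integrable_on {s 0..s (Suc j)}"
      by (rule integrable_subinterval_real[OF piecewise_smooth_curve_length(2)[OF assms(3)]]) (use le s in auto)
    then have "integral {s 0..s j} (speed A g \<gamma>) + integral {s j..s (Suc j)} (speed A g \<gamma>) = integral {s 0..s (Suc j)} (speed A g \<gamma>)"
      using le sj by (intro Henstock_Kurzweil_Integration.integral_combine) auto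
    then show ?case using Suc piece[OF sj(2,1)] by simp
  qed simp
  from this[of m] s show ?thesis by (simp add: riemannian_length_def)
qed

end


section \<open>Riemannian distance and completeness\<close>

lemma norm_matrix_vector_mult_le:
  fixes M :: "real ^ 'n ^ 'm::finite"
  shows "norm (M *v v) \<le> real CARD('m) * (norm M * norm v)"
proof -
  have "norm (M *v v) \<le> (\<Sum>i\<in>UNIV. \<bar>(M *v v) $ i\<bar>)" by (rule norm_le_l1_cart)
  also have "\<dots> \<le> (\<Sum>i\<in>(UNIV :: 'm set). norm M * norm v)"
  proof (rule sum_mono)
    fix i
    have "\<bar>(M *v v) $ i\<bar> = \<bar>M $ i \<bullet> v\<bar>" by (simp add: matrix_vector_mult_def inner_vec_def)
    also have "\<dots> \<le> norm (M $ i) * norm v" by (rule Cauchy_Schwarz_ineq2)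
    also have "\<dots> \<le> norm M * norm v" by (intro mult_right_mono Finite_Cartesian_Product.norm_nth_le) simp
    finally show "\<bar>(M *v v) $ i\<bar> \<le> norm M * norm v" .
  qed
  finally show ?thesis by simp
qed

context smooth_atlas
begin

text \<open>Read in another chart \<open>c'\<close>, the curve is the transition map along a
  straight line, to which \<open>Ck_on_line\<close> applies.\<close>

lemma smooth_curve_chart_segment:
  assumes c: "c \<in> A" and seg: "\<And>t. t \<in> {a..b} \<Longrightarrow> y + t *\<^sub>R v \<in> snd c ` fst c"
  shows "smooth_curve X A a b (\<lambda>t. chart_inv c (y + t *\<^sub>R v))"
proof -
  have "continuous_map (top_of_set {a..b}) (top_of_set (snd c ` fst c)) (\<lambda>t. y + t *\<^sub>R v)"
    using seg by (auto simp: continuous_map_in_subtopology intro!: continuous_intros)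
  from continuous_map_compose[OF this chart_inv_continuous[OF c]]
  have "continuous_map (top_of_set {a..b}) X (\<lambda>t. chart_inv c (y + t *\<^sub>R v))"
    by (simp add: o_def)
  moreover have "smooth_on {t \<in> {a..b}. chart_inv c (y + t *\<^sub>R v) \<in> fst c'} (snd c' \<circ> (\<lambda>t. chart_inv c (y + t *\<^sub>R v)))"
    if c': "c' \<in> A" for c'
    unfolding smooth_on_def
  proof
    fix t assume "t \<in> {t \<in> {a..b}. chart_inv c (y + t *\<^sub>R v) \<in> fst c'}"
    then have t: "t \<in> {a..b}" "chart_inv c (y + t *\<^sub>R v) \<in> fst c'" by auto
    note y = seg[OF t(1)]
    obtain V where V: "open V" "snd c (chart_inv c (y + t *\<^sub>R v)) \<in> V" "smooth_open V (snd c' \<circ> chart_inv c)"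
      by (rule transition_smooth[OF c c' chart_inv_simps(3)[OF c y] t(2)])
    have "\<forall>k. Ck_on k {t. y + t *\<^sub>R v \<in> V} (\<lambda>t. (snd c' \<circ> chart_inv c) (y + t *\<^sub>R v))"
      using Ck_on_line[OF V(1), of _ "snd c' \<circ> chart_inv c" y v] V(3) unfolding smooth_open_def by blast
    moreover have "open {t. y + t *\<^sub>R v \<in> V}"
      using open_vimage[OF V(1), of "\<lambda>t. y + t *\<^sub>R v"] by (simp add: vimage_def continuous_intros)
    moreover have "y + t *\<^sub>R v \<in> V" using V(2) by (simp add: chart_inv_simps(2)[OF c y])
    ultimately show "\<exists>U f'. open U \<and> t \<in> U \<and> (\<forall>k. Ck_on k U f') \<and>
      (\<forall>s\<in>{t \<in> {a..b}. chart_inv c (y + t *\<^sub>R v) \<in> fst c'} \<inter> U. f' s = (snd c' \<circ> (\<lambda>t. chart_inv c (y + t *\<^sub>R v))) s)"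
      by (intro exI[of _ "{t. y + t *\<^sub>R v \<in> V}"] exI[of _ "\<lambda>t. (snd c' \<circ> chart_inv c) (y + t *\<^sub>R v)"]) auto
  qed
  ultimately show ?thesis by (simp add: smooth_curve_def)
qed

end

context riemannian_manifold
begin

text \<open>The Gram matrix is bounded on a closed coordinate ball around \<open>p\<close>, so
  straight segments in the chart have length at most a constant times their coordinate length. The
  segment runs from \<open>q\<close> to \<open>p\<close>, the order in which
  \<open>complete_metric_if_compact_tails\<close> uses it.\<close>

lemma riemannian_dist_small_near:
  assumes p: "p \<in> topspace X" and "e > 0"
  obtains W where "openin X W" "p \<in> W" "\<And>q. q \<in> W \<Longrightarrow> riemannian_dist X A g q p < ereal e"
proof -
  obtain c where c: "c \<in> A" "p \<in> fst c" using p unfolding topspace_charts by (rule UN_E)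
  define y where "y = snd c p"
  have "open (snd c ` fst c)" by (rule open_chart_image[OF c(1) chart_domain(1)[OF c(1)] order_refl])
  moreover have "y \<in> snd c ` fst c" using c by (simp add: y_def)
  ultimately obtain R where R: "R > 0" "cball y R \<subseteq> snd c ` fst c" by (meson open_contains_cball)
  have "compact (coord_metric g c ` cball y R)"
    by (intro compact_continuous_image continuous_on_subset[OF metric_continuous[OF c(1)]] R) simp
  then obtain K where K: "\<And>z. z \<in> cball y R \<Longrightarrow> norm (coord_metric g c z) \<le> K" "K > 0"
    using compact_imp_bounded bounded_pos by (metis imageI)
  \<comment> \<open>Comparison constant of norms: by \<open>norm_matrix_vector_mult_le\<close> the
    squared metric length of \<open>v\<close> is at most n K |v|^2. A segment of coordinate length
    below \<open>e / C\<close> therefore has length below \<open>e\<close>.\<close>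
  define C where "C = sqrt (real CARD('n) * K)"
  have "C > 0" using K(2) by (simp add: C_def)
  define r where "r = min R (e / C)"
  have r: "r > 0" "r \<le> R" "r \<le> e / C" using R(1) \<open>e > 0\<close> \<open>C > 0\<close> by (auto simp: r_def)
  define W where "W = {q \<in> topspace (subtopology X (fst c)). snd c q \<in> ball y r}"
  have "openin (subtopology X (fst c)) W"
    unfolding W_def
  proof (rule openin_continuous_map_preimage)
    show "continuous_map (subtopology X (fst c)) euclidean (snd c)"
      using continuous_map_into_fulltopology[OF homeomorphic_imp_continuous_map[OF chart_homeomorphic[OF c(1)]]] .
  qed simp
  then have "openin X W" using openin_trans_full chart_domain(1)[OF c(1)] by blast
  moreover have "p \<in> W" using c r(1) p by (simp add: W_def y_def)
  moreover have "riemannian_dist X A g q p < ereal e" if q: "q \<in> W" for q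
  proof -
    have qc: "q \<in> fst c" "snd c q \<in> ball y r" using q by (auto simp: W_def)
    define v where "v = y - snd c q"
    have v: "norm v < r" using qc(2) by (simp add: v_def dist_norm)
    define \<gamma> where "\<gamma> t = chart_inv c (snd c q + t *\<^sub>R v)" for t
    have seg: "snd c q + t *\<^sub>R v \<in> cball y R" if t: "t \<in> {0..1}" for t
    proof -
      have "y - (snd c q + t *\<^sub>R v) = (1 - t) *\<^sub>R v" by (simp add: v_def algebra_simps)
      then have "norm (y - (snd c q + t *\<^sub>R v)) \<le> norm v" using t by (simp add: mult_left_le_one_le)
      then show ?thesis using v r(2) by (simp add: dist_norm)
    qed
    have img: "snd c q + t *\<^sub>R v \<in> snd c ` fst c" if "t \<in> {0..1}" for t using seg[OF that] R(2) by blast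
    have sc: "smooth_curve X A 0 1 \<gamma>"
      unfolding \<gamma>_def[abs_def] by (rule smooth_curve_chart_segment[OF c(1) img])
    have "piecewise_smooth_curve X A 0 1 \<gamma>"
      unfolding piecewise_smooth_curve_def
      by (rule exI[of _ "1::nat"], rule exI[of _ "\<lambda>j. real j"]) (simp add: sc)
    moreover have "\<gamma> 0 = q" "\<gamma> 1 = p"
      using chart_inv_simps(1)[OF c(1)] qc c by (simp_all add: \<gamma>_def v_def y_def)
    moreover have "riemannian_length A g 0 1 \<gamma> < e"
    proof -
      have sp: "speed A g \<gamma> t \<le> C * norm v" if t: "t \<in> {0<..<1}" for t
      proof -
        have ti: "s \<in> {0..1}" if "s \<in> {0<..<1}" for s :: real using that by simp
        have "((\<lambda>s. snd c q + s *\<^sub>R v) has_vector_derivative v) (at t)"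
          by (auto intro!: derivative_eq_intros)
        then have D: "((snd c \<circ> \<gamma>) has_vector_derivative v) (at t)"
          by (rule has_vector_derivative_transform_within_open[of _ _ _ "{0<..<1}"])
            (use t img[OF ti] in \<open>auto simp: \<gamma>_def chart_inv_simps(2)[OF c(1)]\<close>)
        let ?z = "snd c q + t *\<^sub>R v"
        have "\<gamma> t \<in> fst c" unfolding \<gamma>_def by (rule chart_inv_simps(3)[OF c(1) img[OF ti[OF t]]])
        then have "speed A g \<gamma> t = sqrt (v \<bullet> (g c (\<gamma> t) *v v))"
          by (intro speed_eq[OF c(1) _ t smooth_curve_interior[OF sc] _ D]) auto
        also have "g c (\<gamma> t) = coord_metric g c ?z" by (simp add: coord_metric_def \<gamma>_def)
        also have "v \<bullet> (coord_metric g c ?z *v v) \<le> norm v * norm (coord_metric g c ?z *v v)"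
          by (rule norm_cauchy_schwarz)
        also have "\<dots> \<le> norm v * (real CARD('n) * (norm (coord_metric g c ?z) * norm v))"
          by (intro mult_left_mono norm_matrix_vector_mult_le) simp
        also have "\<dots> \<le> norm v * (real CARD('n) * (K * norm v))"
          by (intro mult_left_mono mult_right_mono K(1) seg[OF ti[OF t]]) auto
        also have "\<dots> = (real CARD('n) * K) * (norm v)\<^sup>2" by (simp add: power2_eq_square)
        finally show ?thesis by (simp add: C_def real_sqrt_mult)
      qed
      define w where "w t = (if t \<in> {0<..<1} then speed A g \<gamma> t else 0)" for t
      have i: "integral {0..1} (speed A g \<gamma>) = integral {0..1} w"
        by (rule integral_spike[of "{0, 1}"]) (auto simp: w_def)
      have wi: "w integrable_on {0..1}"
        by (rule integrable_spike_finite[where S = "{0, 1}", OF _ _ smooth_curve_speed_integrable[OF sc]])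
          (auto simp: w_def)
      have "integral {0..1} w \<le> integral {0..1} (\<lambda>t::real. C * norm v)"
        using sp \<open>C > 0\<close> by (intro integral_le wi) (auto simp: w_def)
      also have "\<dots> = C * norm v" by simp
      also have "\<dots> < C * r" using v \<open>C > 0\<close> by simp
      also have "\<dots> \<le> e" using r(3) \<open>C > 0\<close> by (simp add: field_simps)
      finally show ?thesis by (simp add: riemannian_length_def i)
    qed
    ultimately show ?thesis unfolding riemannian_dist_less_iff by blast
  qed
  ultimately show thesis using that by blast
qed

text \<open>A tail in a compact set forces a cluster point in the manifold topology; by
  \<open>riemannian_dist_small_near\<close> and the triangle inequality a Cauchy sequence converges
  in distance to it.\<close>

lemma complete_metric_if_compact_tails:
  assumes K: "\<And>\<sigma> :: nat \<Rightarrow> 'a. range \<sigma> \<subseteq> topspace X \<Longrightarrow>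
      \<forall>e>0. \<exists>K. \<forall>i\<ge>K. \<forall>j\<ge>K. riemannian_dist X A g (\<sigma> i) (\<sigma> j) < ereal e \<Longrightarrow>
      \<exists>C n0. compactin X C \<and> (\<forall>n\<ge>n0. \<sigma> n \<in> C)"
  shows "complete_metric X A g"
  unfolding complete_metric_def
proof (intro allI impI)
  fix \<sigma> :: "nat \<Rightarrow> 'a"
  assume \<sigma>: "range \<sigma> \<subseteq> topspace X \<and>
    (\<forall>e>0. \<exists>K. \<forall>i\<ge>K. \<forall>j\<ge>K. riemannian_dist X A g (\<sigma> i) (\<sigma> j) < ereal e)"
  obtain C n0 where C: "compactin X C" "\<And>n. n \<ge> n0 \<Longrightarrow> \<sigma> n \<in> C"
    using K[of \<sigma>] \<sigma> by blast
  \<comment> \<open>Pigeonhole on a finite subcover. Indices rather than points are counted, so that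
    sequences with repeated values are covered.\<close>
  have "\<exists>p\<in>C. \<forall>W. openin X W \<and> p \<in> W \<longrightarrow> infinite {n. \<sigma> n \<in> W}"
  proof (rule ccontr)
    assume "\<not> ?thesis"
    then have "\<forall>p\<in>C. \<exists>W. openin X W \<and> p \<in> W \<and> finite {n. \<sigma> n \<in> W}" by blast
    from bchoice[OF this] obtain W where W: "\<forall>p\<in>C. openin X (W p) \<and> p \<in> W p \<and> finite {n. \<sigma> n \<in> W p}"
      by (elim exE)
    obtain \<F> where F: "finite \<F>" "\<F> \<subseteq> W ` C" "C \<subseteq> \<Union>\<F>"
      using C(1)[unfolded compactin_def, THEN conjunct2, rule_format, of "W ` C"] W by blast
    have "finite (\<Union>V\<in>\<F>. {n. \<sigma> n \<in> V})" using F W by blast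
    moreover have "{n0..} \<subseteq> (\<Union>V\<in>\<F>. {n. \<sigma> n \<in> V})" using C(2) F(3) by blast
    ultimately show False using finite_subset infinite_Ici by blast
  qed
  then obtain p where p: "p \<in> C" "\<And>W. openin X W \<Longrightarrow> p \<in> W \<Longrightarrow> infinite {n. \<sigma> n \<in> W}" by blast
  have pX: "p \<in> topspace X" using p(1) compactin_subset_topspace[OF C(1)] by blast
  have small: "\<forall>\<^sub>F n in sequentially. riemannian_dist X A g (\<sigma> n) p < ereal e" if "e > 0" for e
  proof -
    obtain W where W: "openin X W" "p \<in> W" "\<And>q. q \<in> W \<Longrightarrow> riemannian_dist X A g q p < ereal (e / 2)"
      using riemannian_dist_small_near[OF pX, of "e / 2"] \<open>e > 0\<close> by auto
    obtain N where N: "\<And>i j. i \<ge> N \<Longrightarrow> j \<ge> N \<Longrightarrow> riemannian_dist X A g (\<sigma> i) (\<sigma> j) < ereal (e / 2)"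
      using \<sigma> \<open>e > 0\<close> by (meson half_gt_zero)
    obtain j where "j \<ge> N" "\<sigma> j \<in> W"
      using p(2)[OF W(1,2)] unfolding infinite_nat_iff_unbounded_le by blast
    then have "riemannian_dist X A g (\<sigma> n) p < ereal e" if "n \<ge> N" for n
      using riemannian_dist_triangle[OF N[OF that \<open>j \<ge> N\<close>] W(3)] by simp
    then show ?thesis using eventually_sequentially by blast
  qed
  have "(\<lambda>i. riemannian_dist X A g (\<sigma> i) p) \<longlonglongrightarrow> 0"
  proof (rule order_tendstoI)
    fix a :: ereal assume "a < 0"
    then show "\<forall>\<^sub>F n in sequentially. a < riemannian_dist X A g (\<sigma> n) p"
      using less_le_trans[OF _ riemannian_dist_nonneg] by (intro always_eventually allI)
  next
    fix a :: ereal assume "0 < a"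
    then obtain e where "0 < e" "ereal e \<le> a" by (metis ereal_dense2 ereal_less(2) less_imp_le)
    then show "\<forall>\<^sub>F n in sequentially. riemannian_dist X A g (\<sigma> n) p < a"
      using small[of e] by (auto elim!: eventually_mono intro: less_le_trans)
  qed
  then show "\<exists>p\<in>topspace X. (\<lambda>i. riemannian_dist X A g (\<sigma> i) p) \<longlonglongrightarrow> 0" using pX by blast
qed

end


section \<open>Ends\<close>

locale product_end = smooth_atlas X A + N: smooth_atlas N B
  for X :: "'a topology" and A :: "('a, 'n::finite) chart set"
    and N :: "'b topology" and B :: "('b, 'k::finite) chart set" +
  fixes \<phi> :: "real \<times> 'b \<Rightarrow> 'a"
  assumes embedding: "smooth_end_embedding X A N B \<phi>"
    and compact_base: "compact_space N"
    and frontier_end: "X frontier_of (\<phi> ` ({0..} \<times> topspace N)) = \<phi> ` ({0} \<times> topspace N)"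
    and dim: "CARD('n) = CARD('k) + 1"
begin

abbreviation half_cylinder :: "(real \<times> 'b) topology" where
  "half_cylinder \<equiv> prod_topology (top_of_set {0..}) N"

abbreviation end_set :: "real set \<Rightarrow> 'a set" where
  "end_set S \<equiv> \<phi> ` (S \<times> topspace N)"

lemma homeomorphic_end:
  "homeomorphic_map half_cylinder (subtopology X (end_set {0..})) \<phi>"
  using embedding by (simp add: smooth_end_embedding_def embedding_map_def)

lemma inj_end: "inj_on \<phi> ({0..} \<times> topspace N)"
  using homeomorphic_imp_injective_map[OF homeomorphic_end] by simp

lemma continuous_end: "continuous_map half_cylinder X \<phi>"
  using continuous_map_into_fulltopology[OF homeomorphic_imp_continuous_map[OF homeomorphic_end]] .

lemma end_subset: "S \<subseteq> {0..} \<Longrightarrow> end_set S \<subseteq> topspace X"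
  using continuous_map_image_subset_topspace[OF continuous_end] by auto

text \<open>The embedding makes the image open relative to the end. Its points avoid the frontier,
  which is the slice \<open>r = 0\<close>, hence lie in the interior of the end, where relative
  openness is openness.\<close>

lemma open_end:
  assumes "0 \<le> R" "openin N W"
  shows "openin X (\<phi> ` ({R<..} \<times> W))"
proof -
  let ?M = "end_set {0..}"
  let ?T = "\<phi> ` ({R<..} \<times> W)"
  have WN: "W \<subseteq> topspace N" using assms(2) by (rule openin_subset)
  have "openin (top_of_set {0..}) {R<..}" using assms(1) by (intro open_subset) auto
  then have "openin half_cylinder ({R<..} \<times> W)" using assms(2) by (simp add: openin_prod_Times_iff)
  then have "openin (subtopology X ?M) ?T"
    using homeomorphic_imp_open_map[OF homeomorphic_end] by (simp add: open_map_def)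
  then obtain V where V: "openin X V" "?T = V \<inter> ?M" by (auto simp: openin_subtopology)
  have TM: "?T \<subseteq> ?M" using assms(1) WN by (intro image_mono) auto
  have "?T \<inter> X frontier_of ?M = {}"
  proof -
    have "({R<..} \<times> W) \<inter> ({0} \<times> topspace N) = {}" using assms(1) by auto
    moreover have "{R<..} \<times> W \<subseteq> {0..} \<times> topspace N" "{0::real} \<times> topspace N \<subseteq> {0..} \<times> topspace N"
      using assms(1) WN by auto
    ultimately show ?thesis
      unfolding frontier_end using inj_on_image_Int[OF inj_end] by (metis image_empty)
  qed
  moreover have "?M \<subseteq> X closure_of ?M" by (rule closure_of_subset[OF end_subset]) simp
  ultimately have "?T \<subseteq> X interior_of ?M"
    using TM unfolding frontier_of_def by blast
  moreover have "T = V \<inter> I" if "T = V \<inter> M" "I \<subseteq> M" "T \<subseteq> I" for T V M I :: "'a set" using that by blast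
  ultimately have "?T = V \<inter> X interior_of ?M" using V(2) interior_of_subset[of X ?M] by metis
  then show ?thesis using V(1) openin_Int openin_interior_of by metis
qed

text \<open>The end contains its frontier and is therefore closed; relative closedness under the
  embedding does the rest.\<close>

lemma closed_end:
  assumes "0 \<le> R"
  shows "closedin X (end_set {R..})"
proof -
  let ?M = "end_set {0..}"
  have "X frontier_of ?M \<subseteq> ?M" unfolding frontier_end by auto
  then have M: "closedin X ?M" using frontier_of_subset_eq[OF end_subset] by simp
  have "closedin (top_of_set {0..}) {R..}" using assms by (intro closed_subset) auto
  then have "closedin half_cylinder ({R..} \<times> topspace N)"
    by (simp add: closedin_prod_Times_iff)
  then have "closedin (subtopology X ?M) (end_set {R..})"
    using homeomorphic_imp_closed_map[OF homeomorphic_end] by (simp add: closed_map_def)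
  then show ?thesis using closedin_trans_full M by blast
qed

lemma compact_end:
  assumes "S \<subseteq> {0..}" "compact S"
  shows "compactin X (end_set S)"
proof -
  have "compactin half_cylinder (S \<times> topspace N)"
    using assms compact_base by (simp add: compactin_Times compact_space_def compactin_subtopology)
  then show ?thesis by (rule image_compactin[OF _ continuous_end])
qed

definition end_inv :: "'a \<Rightarrow> real \<times> 'b" where
  "end_inv = inv_into ({0..} \<times> topspace N) \<phi>"

lemma end_inv_simps:
  "0 \<le> r \<Longrightarrow> q \<in> topspace N \<Longrightarrow> end_inv (\<phi> (r, q)) = (r, q)"
  unfolding end_inv_def by (rule inv_into_f_f[OF inj_end]) simp

lemma end_inv_continuous: "continuous_map (subtopology X (end_set {0..})) half_cylinder end_inv"
proof -
  obtain \<psi> where \<psi>: "homeomorphic_maps half_cylinder (subtopology X (end_set {0..})) \<phi> \<psi>"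
    using homeomorphic_end homeomorphic_map_maps by blast
  have "end_inv x = \<psi> x" if "x \<in> topspace (subtopology X (end_set {0..}))" for x
  proof -
    have "x \<in> end_set {0..}" using that by (simp only: topspace_subtopology Int_iff)
    then obtain r q where x: "x = \<phi> (r, q)" "0 \<le> r" "q \<in> topspace N" by auto
    then show ?thesis using \<psi> end_inv_simps by (simp add: homeomorphic_maps_def)
  qed
  then show ?thesis
    using \<psi> continuous_map_eq[of "subtopology X (end_set {0..})" half_cylinder \<psi> end_inv]
    by (simp add: homeomorphic_maps_def)
qed

lemma end_coords_dom_open:
  assumes "c \<in> A" "d \<in> B"
  shows "open {(r, y). 0 < r \<and> y \<in> snd d ` fst d \<and> \<phi> (r, chart_inv d y) \<in> fst c}"
    (is "open ?E")
proof -
  let ?P = "{0<..} \<times> (snd d ` fst d) :: (real \<times> (real ^ 'k)) set"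
  have oP: "open ?P"
    by (intro open_Times N.open_chart_image assms N.chart_domain) auto
  have "continuous_map (top_of_set ?P) half_cylinder (\<lambda>z. (fst z, chart_inv d (snd z)))"
  proof (rule continuous_map_pairedI)
    show "continuous_map (top_of_set ?P) (top_of_set {0..}) fst"
      by (auto simp: continuous_map_in_subtopology intro!: continuous_intros)
    have "continuous_map (top_of_set ?P) (top_of_set (snd d ` fst d)) snd"
      by (auto simp: continuous_map_in_subtopology intro!: continuous_intros)
    from continuous_map_compose[OF this N.chart_inv_continuous[OF assms(2)]]
    show "continuous_map (top_of_set ?P) N (\<lambda>z. chart_inv d (snd z))" by (simp add: o_def)
  qed
  from continuous_map_compose[OF this continuous_end]
  have "continuous_map (top_of_set ?P) X (\<lambda>z. \<phi> (fst z, chart_inv d (snd z)))" by (simp add: o_def)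
  from openin_continuous_map_preimage[OF this chart_domain(1)[OF assms(1)]]
  have "openin (top_of_set ?P) {z \<in> ?P. \<phi> (fst z, chart_inv d (snd z)) \<in> fst c}" by simp
  then have "open {z \<in> ?P. \<phi> (fst z, chart_inv d (snd z)) \<in> fst c}"
    using oP by (simp add: openin_open_eq)
  also have "{z \<in> ?P. \<phi> (fst z, chart_inv d (snd z)) \<in> fst c} = ?E" by auto
  finally show ?thesis .
qed

text \<open>For \<open>r > 0\<close> the derivative within \<open>end_dom\<close> is an ordinary
  one, hence unique and equal to \<open>dd\<close>. Its injectivity becomes bijectivity because both
  spaces have dimension k + 1.\<close>

lemma end_coords_local:
  assumes c: "c \<in> A" and d: "d \<in> B" and r: "0 < r" and q: "q \<in> fst d" and p: "\<phi> (r, q) \<in> fst c"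
  obtains V where "open V" "(r, snd d q) \<in> V" "smooth_open V (end_coords c d \<phi>)"
    "V \<subseteq> {(r, y). 0 < r \<and> y \<in> snd d ` fst d \<and> \<phi> (r, chart_inv d y) \<in> fst c}"
    "\<And>z. z \<in> V \<Longrightarrow> bij (dd (end_coords c d \<phi>) z)"
    "\<And>z D. z \<in> V \<Longrightarrow> (end_coords c d \<phi> has_derivative D) (at z within end_dom c d \<phi>) \<Longrightarrow>
       D = dd (end_coords c d \<phi>) z"
proof -
  let ?E = "{(r, y). 0 < r \<and> y \<in> snd d ` fst d \<and> \<phi> (r, chart_inv d y) \<in> fst c}"
  let ?F = "end_coords c d \<phi>"
  have E: "open ?E" by (rule end_coords_dom_open[OF c d])
  have ED: "?E \<subseteq> end_dom c d \<phi>" by (auto simp: end_dom_def)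
  have zE: "(r, snd d q) \<in> ?E" using r q p N.chart_inv_simps(1)[OF d] by auto
  have sm: "smooth_on (end_dom c d \<phi>) ?F"
    and inj: "\<And>z. z \<in> end_dom c d \<phi> \<Longrightarrow> \<exists>D. (?F has_derivative D) (at z within end_dom c d \<phi>) \<and> inj D"
    using embedding c d unfolding smooth_end_embedding_def by blast+
  obtain V where V: "open V" "(r, snd d q) \<in> V" "V \<subseteq> ?E" "smooth_open V ?F"
    by (rule smooth_on_imp_local[OF sm E zE ED])
  have at: "at z within end_dom c d \<phi> = at z" if "z \<in> V" for z
    using at_within_open_subset[OF that V(1)] V(3) ED by blast
  show thesis
  proof (rule that[OF V(1,2,4,3)])
    show D: "D = dd ?F z" if "z \<in> V" "(?F has_derivative D) (at z within end_dom c d \<phi>)" for z D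
      using dd_eq[of ?F D z] that at[OF that(1)] by simp
    show "bij (dd ?F z)" if z: "z \<in> V" for z
    proof -
      obtain D where D': "(?F has_derivative D) (at z within end_dom c d \<phi>)" "inj D"
        using inj[of z] z V(3) ED by blast
      have "linear D" using has_derivative_linear[OF D'(1)] .
      then have "dim (range D) = DIM(real ^ 'n)"
        using dim_image_eq[of D UNIV] D'(2) dim by (simp add: dim_UNIV)
      then have "span (range D) = UNIV" by (rule dim_eq_full[THEN iffD1])
      then have "surj D" using linear_span_image[OF \<open>linear D\<close>, of UNIV] by simp
      then show ?thesis using D[OF z D'(1)] D'(2) by (simp add: bij_def)
    qed
  qed
qed

text \<open>The inverse function theorem is not needed: the inverse of the coordinate expression is
  already known to be continuous.\<close>

lemma end_inv_has_derivative:
  assumes c: "c \<in> A" and d: "d \<in> B" and r: "0 < r" and q: "q \<in> fst d" and p: "\<phi> (r, q) \<in> fst c"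
  shows "((\<lambda>x. fst (end_inv (chart_inv c x))) has_derivative
    (\<lambda>v. fst (inv (dd (end_coords c d \<phi>) (r, snd d q)) v))) (at (snd c (\<phi> (r, q))))"
proof -
  let ?F = "end_coords c d \<phi>"
  let ?z = "(r, snd d q)"
  let ?D = "dd ?F ?z"
  obtain V where V: "open V" "?z \<in> V" "smooth_open V ?F" "\<And>z. z \<in> V \<Longrightarrow> bij (dd ?F z)"
    by (rule end_coords_local[OF c d r q p]) blast
  define \<Psi> where "\<Psi> x = (fst (end_inv (chart_inv c x)), snd d (snd (end_inv (chart_inv c x))))" for x
  define T where "T = snd c ` (fst c \<inter> \<phi> ` ({0<..} \<times> fst d))"
  have dN: "fst d \<subseteq> topspace N" by (rule N.chart_domain(2)[OF d])
  have T: "open T"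
    unfolding T_def
    by (intro open_chart_image[OF c] openin_Int chart_domain[OF c] open_end N.chart_domain[OF d]) auto
  have yT: "snd c (\<phi> (r, q)) \<in> T" unfolding T_def using r q p by auto
  have inT: "\<exists>s q'. 0 < s \<and> q' \<in> fst d \<and> \<phi> (s, q') \<in> fst c \<and> chart_inv c x = \<phi> (s, q') \<and> x = snd c (\<phi> (s, q'))"
    if "x \<in> T" for x
    using that chart_inv_simps(1)[OF c] unfolding T_def by force
  have D: "(?F has_derivative ?D) (at ?z)"
    by (rule has_derivative_dd[OF smooth_open_differentiable[OF V(3,2)]])
  have lD: "linear ?D" by (rule has_derivative_linear[OF D])
  have "linear (inv ?D)"
    using lD V(4)[OF V(2)] by (metis bij_def id_comp linear_injective_left_inverse o_inv_o_cancel surj_imp_inj_inv)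
  then have bl: "bounded_linear (inv ?D)" by (simp add: linear_conv_bounded_linear)
  have y: "\<Psi> (snd c (\<phi> (r, q))) = ?z"
    using r q dN by (simp add: \<Psi>_def chart_inv_simps(1)[OF c p] end_inv_simps subset_iff)
  have cont: "continuous_on T \<Psi>"
  proof -
    have "continuous_map (top_of_set T) X (chart_inv c)"
      by (rule continuous_map_from_subtopology_mono[OF chart_inv_continuous[OF c]]) (auto simp: T_def)
    moreover have "chart_inv c \<in> T \<rightarrow> \<phi> ` ({0..} \<times> fst d)"
      using inT by fastforce
    ultimately have 1: "continuous_map (top_of_set T) (subtopology X (\<phi> ` ({0..} \<times> fst d))) (chart_inv c)"
      by (auto simp: continuous_map_in_subtopology)
    have "continuous_map (subtopology X (\<phi> ` ({0..} \<times> fst d))) half_cylinder end_inv"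
      by (rule continuous_map_from_subtopology_mono[OF end_inv_continuous]) (use dN in auto)
    from continuous_map_compose[OF 1 this]
    have 2: "continuous_map (top_of_set T) half_cylinder (\<lambda>x. end_inv (chart_inv c x))" by (simp add: o_def)
    have "continuous_map (top_of_set T) (top_of_set {0..}) (\<lambda>x. fst (end_inv (chart_inv c x)))"
      using continuous_map_compose[OF 2 continuous_map_fst] by (simp add: o_def)
    then have 3: "continuous_on T (\<lambda>x. fst (end_inv (chart_inv c x)))"
      using continuous_map_into_fulltopology continuous_map_iff_continuous by blast
    have 4: "continuous_map (top_of_set T) N (\<lambda>x. snd (end_inv (chart_inv c x)))"
      using continuous_map_compose[OF 2 continuous_map_snd] by (simp add: o_def)
    have "{x \<in> T. snd (end_inv (chart_inv c x)) \<in> fst d} = T"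
    proof -
      have "snd (end_inv (chart_inv c x)) \<in> fst d" if "x \<in> T" for x
        using inT[OF that] end_inv_simps dN by (metis less_imp_le snd_conv subsetD)
      then show ?thesis by blast
    qed
    then have "continuous_on T (\<lambda>x. snd d (snd (end_inv (chart_inv c x))))"
      using N.chart_continuous_on_curve[OF d 4] by (simp add: o_def)
    with 3 show ?thesis unfolding \<Psi>_def by (intro continuous_intros)
  qed
  have "(\<Psi> has_derivative inv ?D) (at (snd c (\<phi> (r, q))))"
  proof (rule has_derivative_inverse_basic[where f = ?F and f' = ?D, OF _ bl _ _ T yT])
    show "(?F has_derivative ?D) (at (\<Psi> (snd c (\<phi> (r, q)))))" unfolding y by (rule D)
    show "inv ?D \<circ> ?D = id" using V(4)[OF V(2)] by (simp add: bij_is_inj)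
    show "continuous (at (snd c (\<phi> (r, q)))) \<Psi>"
      using cont T yT by (simp add: continuous_on_eq_continuous_at)
    show "?F (\<Psi> x) = x" if xT: "x \<in> T" for x
    proof -
      obtain s q' where s: "0 < s" "q' \<in> fst d" "\<phi> (s, q') \<in> fst c" "chart_inv c x = \<phi> (s, q')" "x = snd c (\<phi> (s, q'))"
        using inT[OF xT] by blast
      then have "\<Psi> x = (s, snd d q')" using dN by (simp add: \<Psi>_def end_inv_simps subset_iff)
      then show ?thesis using s N.chart_inv_simps(1)[OF d s(2)] by (simp add: end_coords_def)
    qed
  qed
  from bounded_linear.has_derivative[OF bounded_linear_fst this]
  show ?thesis by (simp add: \<Psi>_def)
qed

end

section \<open>The warped metric on an end: gradient of the radius and Schouten eigenvalues\<close>

lemma (in riemannian_manifold) riemannian_coords_chart: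
  assumes c: "c \<in> A"
  shows "riemannian_coords (snd c ` fst c) (coord_metric g c)"
proof
  show o: "open (snd c ` fst c)" by (rule open_chart_image[OF c chart_domain(1)[OF c] order_refl])
  show "smooth_open (snd c ` fst c) (coord_metric g c)"
    using metric c by (intro smooth_on_imp_smooth_open[OF o]) (simp add: riemannian_metric_def)
  show "transpose (coord_metric g c y) = coord_metric g c y" if "y \<in> snd c ` fst c" for y
    using metric_symmetric[OF c chart_inv_simps(3)[OF c that]] by (simp add: coord_metric_def)
  show "v \<bullet> (coord_metric g c y *v v) > 0" if "y \<in> snd c ` fst c" "v \<noteq> 0" for y v
    using metric_positive[OF c chart_inv_simps(3)[OF c that(1)] that(2)] by (simp add: coord_metric_def)
qed

locale warped_end = product_end X A N B \<phi> + riemannian_manifold X A g + N: riemannian_manifold N B h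
  for X :: "'a topology" and A :: "('a, 'n::finite) chart set"
    and N :: "'b topology" and B :: "('b, 'k::finite) chart set"
    and \<phi> :: "real \<times> 'b \<Rightarrow> 'a" and g :: "('a, 'n) metric" and h :: "('b, 'k) metric" +
  fixes \<Phi> :: "real \<Rightarrow> real"
  assumes profile_smooth: "smooth_on {0..} \<Phi>"
    and profile_positive: "\<And>r. 0 \<le> r \<Longrightarrow> \<Phi> r > 0"
    and warped: "warped_product_on_end A g B h \<phi> \<Phi>"
begin

lemma profile_differentiable:
  assumes "0 < r"
  shows "\<Phi> differentiable (at r)" "deriv \<Phi> differentiable (at r)"
proof -
  obtain V where V: "open V" "r \<in> V" "smooth_open V \<Phi>"
    by (rule smooth_on_imp_local[OF profile_smooth, of "{0<..}" r]) (use assms in auto)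
  show "\<Phi> differentiable (at r)" by (rule smooth_open_differentiable[OF V(3,2)])
  have "dd \<Phi> s 1 = deriv \<Phi> s" if "s \<in> V" for s
  proof -
    have "(\<Phi> has_real_derivative deriv \<Phi> s) (at s)"
      using smooth_open_differentiable[OF V(3) that] DERIV_deriv_iff_real_differentiable by blast
    then show ?thesis using dd_eq by (metis has_field_derivative_def mult.right_neutral)
  qed
  then show "deriv \<Phi> differentiable (at r)"
    by (rule differentiable_cong_open[OF V(1,2) _ smooth_open_differentiable[OF smooth_open_dd[OF V(3)] V(2)]])
qed

text \<open>\<open>warped_product_on_end\<close> supplies some derivative with the pullback
  property; the uniqueness premise, available from \<open>end_coords_local\<close>, identifies it
  with \<open>D0\<close>.\<close>

lemma end_metric_pullback:
  assumes c: "c \<in> A" and d: "d \<in> B" and z: "0 < fst z" "snd z \<in> snd d ` fst d" "\<phi> (fst z, chart_inv d (snd z)) \<in> fst c"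
    and D: "\<And>D. (end_coords c d \<phi> has_derivative D) (at z within end_dom c d \<phi>) \<Longrightarrow> D = D0"
  shows "D0 (s, v) \<bullet> (g c (\<phi> (fst z, chart_inv d (snd z))) *v D0 (s', v')) =
    s * s' + (\<Phi> (fst z))\<^sup>2 * (v \<bullet> (h d (chart_inv d (snd z)) *v v'))"
proof -
  have "(fst z, snd z) \<in> end_dom c d \<phi>" using z by (auto simp: end_dom_def)
  then have "\<exists>D. (end_coords c d \<phi> has_derivative D) (at (fst z, snd z) within end_dom c d \<phi>) \<and>
      (\<forall>s v s' v'. D (s, v) \<bullet> (g c (\<phi> (fst z, chart_inv d (snd z))) *v D (s', v')) =
         s * s' + (\<Phi> (fst z))\<^sup>2 * (v \<bullet> (h d (chart_inv d (snd z)) *v v')))"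
    using warped c d unfolding warped_product_on_end_def by blast
  then show ?thesis using D by auto
qed

text \<open>If \<open>v\<close> is the image of (s, w) under the derivative of the end coordinates,
  its squared length is s^2 plus a nonnegative slice term, and s is the derivative of
  \<open>r\<close> along \<open>v\<close>.\<close>

lemma radius_gradient:
  assumes c: "c \<in> A" and d: "d \<in> B" and r: "0 < r" and q: "q \<in> fst d" and p: "\<phi> (r, q) \<in> fst c"
  shows "\<bar>fst (inv (dd (end_coords c d \<phi>) (r, snd d q)) v)\<bar> \<le> sqrt (v \<bullet> (g c (\<phi> (r, q)) *v v))"
proof -
  let ?z = "(r, snd d q)"
  let ?D = "dd (end_coords c d \<phi>) ?z"
  obtain V where V: "?z \<in> V" "\<And>z. z \<in> V \<Longrightarrow> bij (dd (end_coords c d \<phi>) z)"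
    "\<And>z D. z \<in> V \<Longrightarrow> (end_coords c d \<phi> has_derivative D) (at z within end_dom c d \<phi>) \<Longrightarrow> D = dd (end_coords c d \<phi>) z"
    by (rule end_coords_local[OF c d r q p]) blast
  obtain s w where sw: "inv ?D v = (s, w)" by (cases "inv ?D v")
  then have v: "v = ?D (s, w)" using V(2)[OF V(1)] by (metis bij_inv_eq_iff)
  have qi: "chart_inv d (snd d q) = q" by (rule N.chart_inv_simps(1)[OF d q])
  have "v \<bullet> (g c (\<phi> (r, q)) *v v) = s * s + (\<Phi> r)\<^sup>2 * (w \<bullet> (h d q *v w))"
    using end_metric_pullback[OF c d, of ?z ?D s w s w] V(3)[OF V(1)] r q p unfolding v by (simp add: qi)
  also have "\<dots> \<ge> s\<^sup>2" using N.metric_nonneg[OF d q] by (simp add: power2_eq_square)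
  finally show ?thesis using real_sqrt_le_mono[of "s\<^sup>2"] by (simp add: sw)
qed

text \<open>\<open>end_coords\<close> takes the role of \<open>F\<close> in
  \<open>ricci_of_warped_metric\<close>. The Einstein condition makes the Ricci form of the
  cross-section a multiple of \<open>h\<close>, which is what yields a single eigenvalue on the
  slices.\<close>

lemma neg_schouten_eigenvalues:
  fixes i0 :: 'n
  assumes c: "c \<in> A" and r: "0 < r" and q: "q \<in> topspace N" and p: "\<phi> (r, q) \<in> fst c"
    and einstein: "einstein_metric B h ((real CARD('n) - 2) * k)" and dim3: "CARD('n) \<ge> 3"
  shows "eigenvalue_vector (neg_schouten_endo g c (\<phi> (r, q)))
    (\<chi> i. if i = i0 then deriv (deriv \<Phi>) r / \<Phi> r - ((deriv \<Phi> r)\<^sup>2 - k) / (2 * (\<Phi> r)\<^sup>2)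
      else ((deriv \<Phi> r)\<^sup>2 - k) / (2 * (\<Phi> r)\<^sup>2))"
proof -
  obtain d where d: "d \<in> B" "q \<in> fst d" using q unfolding N.topspace_charts by (rule UN_E)
  let ?z = "(r, snd d q)"
  let ?F = "end_coords c d \<phi>"
  let ?D = "dd ?F ?z"
  let ?G = "coord_metric g c" and ?H = "coord_metric h d"
  obtain V where V: "open V" "?z \<in> V" "smooth_open V ?F"
    "V \<subseteq> {(r, y). 0 < r \<and> y \<in> snd d ` fst d \<and> \<phi> (r, chart_inv d y) \<in> fst c}"
    "\<And>z. z \<in> V \<Longrightarrow> bij (dd ?F z)"
    "\<And>z D. z \<in> V \<Longrightarrow> (?F has_derivative D) (at z within end_dom c d \<phi>) \<Longrightarrow> D = dd ?F z"
    by (rule end_coords_local[OF c d(1) r d(2) p]) blast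
  have zV: "0 < fst z" "snd z \<in> snd d ` fst d" "\<phi> (fst z, chart_inv d (snd z)) \<in> fst c" if "z \<in> V" for z
    using V(4) that by auto
  have F: "?F z = snd c (\<phi> (fst z, chart_inv d (snd z)))" for z
    by (simp add: end_coords_def case_prod_unfold)
  have GF: "?G (?F z) = g c (\<phi> (fst z, chart_inv d (snd z)))" if "z \<in> V" for z
    using zV(3)[OF that] by (simp add: coord_metric_def F chart_inv_simps(1)[OF c])
  have pull: "warped_form \<Phi> (metric_form ?H) z U U' = metric_form ?G (?F z) (dd ?F z U) (dd ?F z U')" if z: "z \<in> V" for z U U'
    using end_metric_pullback[OF c d(1) zV[OF z] V(6)[OF z], of "fst U" "snd U" "fst U'" "snd U'"]
    unfolding warped_form_def metric_form_def GF[OF z] by (simp add: coord_metric_def)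
  have qi: "chart_inv d (snd d q) = q" by (rule N.chart_inv_simps(1)[OF d])
  have Fz: "?F ?z = snd c (\<phi> (r, q))" by (simp add: F qi)
  have Gz: "?G (?F ?z) = g c (\<phi> (r, q))" using GF[OF V(2)] by (simp add: qi)
  have Hz: "?H (snd d q) = h d q" by (simp add: coord_metric_def qi)
  have lD: "linear ?D"
    by (rule has_derivative_linear[OF has_derivative_dd[OF smooth_open_differentiable[OF V(3,2)]]])
  have Rh: "ricci ?H (snd d q) = ((real CARD('n) - 2) * k) *\<^sub>R h d q"
    using einstein d by (simp add: einstein_metric_def)
  have RD: "?D (s, v) \<bullet> (ricci ?G (snd c (\<phi> (r, q))) *v ?D (s', v')) =
       (real CARD('n) - 2) * k * (v \<bullet> (h d q *v v')) - real CARD('k) * (deriv (deriv \<Phi>) r / \<Phi> r) * s * s'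
       - ((real CARD('k) - 1) * (deriv \<Phi> r)\<^sup>2 + \<Phi> r * deriv (deriv \<Phi>) r) * (v \<bullet> (h d q *v v'))" for s v s' v'
  proof -
    have "?D (s, v) \<bullet> (ricci ?G (?F ?z) *v ?D (s', v')) =
      snd (s, v) \<bullet> (ricci ?H (snd ?z) *v snd (s', v'))
      - real CARD('k) * (deriv (deriv \<Phi>) (fst ?z) / \<Phi> (fst ?z)) * fst (s, v) * fst (s', v')
      - ((real CARD('k) - 1) * (deriv \<Phi> (fst ?z))\<^sup>2 + \<Phi> (fst ?z) * deriv (deriv \<Phi>) (fst ?z)) * (snd (s, v) \<bullet> (?H (snd ?z) *v snd (s', v')))"
    proof (rule ricci_of_warped_metric[OF V(1,2,3,5) riemannian_coords_chart[OF c] _ N.riemannian_coords_chart[OF d(1)]])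
      show "?F ` V \<subseteq> snd c ` fst c" using zV F by force
      show "snd ` V \<subseteq> snd d ` fst d" using zV by force
    qed (use zV profile_positive profile_differentiable pull in \<open>auto simp: less_imp_le\<close>)
    then show ?thesis
      by (simp add: Fz Rh Hz scaleR_matrix_vector_assoc[symmetric])
  qed
  have gD: "?D (s, v) \<bullet> (g c (\<phi> (r, q)) *v ?D (s', v')) = s * s' + (\<Phi> r)\<^sup>2 * (v \<bullet> (h d q *v v'))" for s v s' v'
    using end_metric_pullback[OF c d(1) zV[OF V(2)] V(6)[OF V(2)], of s v s' v'] by (simp add: qi)
  interpret G: riemannian_coords "snd c ` fst c" ?G by (rule riemannian_coords_chart[OF c])
  have ginv: "invertible (g c (\<phi> (r, q)))"
    using G.metric_invertible[of "snd c (\<phi> (r, q))"] p Gz Fz by simp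
  have Gc: "?G (snd c (\<phi> (r, q))) = g c (\<phi> (r, q))" using Gz Fz by simp
  have "neg_schouten_endo g c (\<phi> (r, q)) *v ?D (s, v) =
     ?D ((deriv (deriv \<Phi>) r / \<Phi> r - ((deriv \<Phi> r)\<^sup>2 - k) / (2 * (\<Phi> r)\<^sup>2)) * s, (((deriv \<Phi> r)\<^sup>2 - k) / (2 * (\<Phi> r)\<^sup>2)) *\<^sub>R v)" for s v
    unfolding neg_schouten_endo_def schouten_def scalar_curvature_def Gc
    by (rule neg_schouten_splitting[OF dim dim3 lD V(5)[OF V(2)] metric_symmetric[OF c p] ginv profile_positive gD RD])
      (use r in simp)
  then show ?thesis
    by (rule eigenvalue_vector_of_splitting[OF lD V(5)[OF V(2)] _ dim])
qed

end

text \<open>A \<open>C\<^sup>1\<close> substitute for \<open>max 0 (r - 1)\<close>: being constant on \<open>{..1}\<close> it extends by \<open>0\<close> across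
  the boundary of an end, where the radius is not differentiable.\<close>

definition soft_radius :: "real \<Rightarrow> real" where
  "soft_radius r = sqrt (1 + (max 0 (r - 1))\<^sup>2) - 1"

lemma soft_radius_eq_0: "r \<le> 1 \<Longrightarrow> soft_radius r = 0"
  by (simp add: soft_radius_def max_def)

text \<open>Growth at infinity: it bounds \<open>r\<close> on the sublevel sets of the radius
  function.\<close>

lemma soft_radius_ge: "r - 2 \<le> soft_radius r"
proof -
  define m where "m = max 0 (r - 1)"
  have "r - 1 \<le> m" "m = sqrt (m\<^sup>2)" by (auto simp: m_def)
  moreover have "sqrt (m\<^sup>2) \<le> sqrt (1 + m\<^sup>2)" by (rule real_sqrt_le_mono) simp
  ultimately show ?thesis by (simp add: soft_radius_def m_def[symmetric])
qed

text \<open>The delicate point is \<open>r = 0\<close>, where the difference quotient is bounded by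
  |h|.\<close>

lemma DERIV_max_0_power2: "((\<lambda>r::real. (max 0 r)\<^sup>2) has_real_derivative 2 * max 0 r) (at r)"
proof -
  consider "r < 0" | "r = 0" | "r > 0" by linarith
  then show ?thesis
  proof cases
    case 1
    have "((\<lambda>r::real. 0) has_real_derivative 0) (at r)" by simp
    then show ?thesis
      using 1 by (subst has_field_derivative_transform_within_open[of _ _ _ "{..<0}"]) auto
  next
    case 3
    have "((\<lambda>r::real. r\<^sup>2) has_real_derivative 2 * r) (at r)" by (auto intro!: derivative_eq_intros)
    then have "((\<lambda>r::real. (max 0 r)\<^sup>2) has_real_derivative 2 * r) (at r)"
      by (rule has_field_derivative_transform_within_open[of _ _ _ "{0<..}"]) (use 3 in auto)
    then show ?thesis using 3 by simp
  next
    case 2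
    have "(\<lambda>h::real. ((max 0 h)\<^sup>2) / h) \<midarrow>0\<rightarrow> 0"
    proof (rule Lim_null_comparison)
      show "\<forall>\<^sub>F h in at 0. norm ((max 0 h)\<^sup>2 / h) \<le> \<bar>h :: real\<bar>"
        by (auto simp: max_def power2_eq_square)
      show "((\<lambda>h::real. \<bar>h\<bar>) \<longlongrightarrow> 0) (at 0)" by (rule tendsto_rabs_zero) simp
    qed
    then show ?thesis using 2 by (simp add: DERIV_def)
  qed
qed

text \<open>With m = max 0 (r - 1) the derivative is m / sqrt (1 + m^2).\<close>

lemma DERIV_soft_radius:
  obtains t where "(soft_radius has_real_derivative t) (at r)" "\<bar>t\<bar> \<le> 1"
proof -
  define m where "m = max 0 (r - 1)"
  define s where "s r = 1 + (max 0 (r - 1 :: real))\<^sup>2" for r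
  have s: "s r > 0" "s r = 1 + m\<^sup>2" by (auto simp: s_def m_def intro: add_pos_nonneg)
  have p: "1 + m\<^sup>2 > 0" using s by simp
  have "((\<lambda>r::real. (max 0 (r - 1))\<^sup>2) has_real_derivative 2 * m * 1) (at r)"
    unfolding m_def
    by (rule DERIV_chain2[OF DERIV_max_0_power2]) (auto intro!: derivative_eq_intros)
  from DERIV_add[OF DERIV_const[of 1] this]
  have "(s has_real_derivative 2 * m) (at r)" by (simp add: s_def[abs_def])
  from DERIV_chain2[OF DERIV_real_sqrt[OF s(1)] this]
  have "((\<lambda>r. sqrt (s r)) has_real_derivative inverse (sqrt (1 + m\<^sup>2)) / 2 * (2 * m)) (at r)"
    by (simp add: s(2))
  from DERIV_diff[OF this DERIV_const[of 1]]
  have D: "(soft_radius has_real_derivative inverse (sqrt (1 + m\<^sup>2)) / 2 * (2 * m)) (at r)"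
    by (simp add: soft_radius_def[abs_def] s_def[abs_def])
  have "\<bar>m\<bar> \<le> sqrt (1 + m\<^sup>2)" using real_sqrt_le_mono[of "m\<^sup>2" "1 + m\<^sup>2"] by simp
  then have "\<bar>inverse (sqrt (1 + m\<^sup>2)) / 2 * (2 * m)\<bar> \<le> 1"
    using p by (simp add: abs_mult divide_simps)
  then show thesis by (rule that[OF D])
qed

context warped_end
begin

text \<open>The definition switches at \<open>r = 0\<close>, but the value is already 0 for
  \<open>r \<le> 1\<close>. Thus the open set \<open>r > 0\<close> and the complement of the closed
  set \<open>r \<ge> 1\<close> overlap, and differentiability can be checked on each.\<close>

definition end_radius :: "'a \<Rightarrow> real" where
  "end_radius p = (if p \<in> end_set {0<..} then soft_radius (fst (end_inv p)) else 0)"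

lemma end_radius_eq: "0 < r \<Longrightarrow> q \<in> topspace N \<Longrightarrow> end_radius (\<phi> (r, q)) = soft_radius r"
  by (auto simp: end_radius_def end_inv_simps)

lemma end_radius_outside: "p \<notin> end_set {1..} \<Longrightarrow> end_radius p = 0"
proof (cases "p \<in> end_set {0<..}")
  case True
  assume n: "p \<notin> end_set {1..}"
  obtain r q where rq: "p = \<phi> (r, q)" "0 < r" "q \<in> topspace N" using True by auto
  then have "r \<le> 1" using n by (metis SigmaI atLeast_iff image_eqI linear)
  then show ?thesis using rq by (simp add: end_radius_eq soft_radius_eq_0)
qed (simp add: end_radius_def)

text \<open>Chain rule for \<open>soft_radius\<close> after \<open>r\<close>;
  \<open>DERIV_soft_radius\<close> and \<open>radius_gradient\<close> bound the two factors.\<close>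

lemma end_radius_gradient:
  assumes c: "c \<in> A" and p: "p \<in> fst c" "p \<in> end_set {0<..}"
  shows "(end_radius \<circ> chart_inv c) differentiable (at (snd c p))"
    and "dd (end_radius \<circ> chart_inv c) (snd c p) v \<le> sqrt (v \<bullet> (g c p *v v))"
proof -
  obtain r q where rq: "p = \<phi> (r, q)" "0 < r" "q \<in> topspace N" using p(2) by auto
  obtain d where d: "d \<in> B" "q \<in> fst d" using rq(3) unfolding N.topspace_charts by (rule UN_E)
  let ?x = "snd c p"
  let ?L = "\<lambda>v. fst (inv (dd (end_coords c d \<phi>) (r, snd d q)) v)"
  obtain t where t: "(soft_radius has_real_derivative t) (at r)" "\<bar>t\<bar> \<le> 1" by (rule DERIV_soft_radius)
  have L: "((\<lambda>x. fst (end_inv (chart_inv c x))) has_derivative ?L) (at ?x)"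
    using end_inv_has_derivative[OF c d(1) rq(2) d(2)] p(1) rq(1) by simp
  have r: "fst (end_inv (chart_inv c ?x)) = r"
    unfolding chart_inv_simps(1)[OF c p(1)] using rq by (simp add: end_inv_simps)
  have "((\<lambda>x. soft_radius (fst (end_inv (chart_inv c x)))) has_derivative (\<lambda>v. t * ?L v)) (at ?x)"
    using has_derivative_compose[OF L, of soft_radius "(*) t"] t(1) by (simp add: r has_field_derivative_def)
  moreover have "open (snd c ` (fst c \<inter> end_set {0<..}))"
    by (intro open_chart_image[OF c] openin_Int chart_domain[OF c] open_end) auto
  moreover have "?x \<in> snd c ` (fst c \<inter> end_set {0<..})" using p by blast
  moreover have "soft_radius (fst (end_inv (chart_inv c x))) = (end_radius \<circ> chart_inv c) x"
    if "x \<in> snd c ` (fst c \<inter> end_set {0<..})" for x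
    using chart_inv_image[OF c _ that] by (simp add: end_radius_def)
  ultimately have D: "((end_radius \<circ> chart_inv c) has_derivative (\<lambda>v. t * ?L v)) (at ?x)"
    by (rule has_derivative_transform_within_open)
  then show "(end_radius \<circ> chart_inv c) differentiable (at ?x)" by (rule differentiableI)
  have "t * ?L v \<le> \<bar>t\<bar> * \<bar>?L v\<bar>" by (metis abs_ge_self abs_mult)
  also have "\<dots> \<le> \<bar>?L v\<bar>" using t(2) by (simp add: mult_left_le_one_le)
  also have "\<dots> \<le> sqrt (v \<bullet> (g c p *v v))"
    using radius_gradient[OF c d(1) rq(2) d(2)] p(1) rq(1) by simp
  finally show "dd (end_radius \<circ> chart_inv c) ?x v \<le> sqrt (v \<bullet> (g c p *v v))"
    by (simp add: dd_eq[OF D])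
qed

end

text \<open>\<Theta> adds up the radii of all ends. Since the ends are disjoint, at most one summand
  is nonzero at a point, so the gradient bound survives summation. Along a Cauchy tail \<Theta> is
  bounded, which confines the tail to the core and bounded pieces of the ends.\<close>

theorem (in riemannian_manifold) complete_metric_warped_ends:
  fixes N :: "'i \<Rightarrow> 'b topology" and B :: "'i \<Rightarrow> ('b, 'k::finite) chart set"
  assumes I: "finite I" and we: "\<And>i. i \<in> I \<Longrightarrow> warped_end X A (N i) (B i) (\<phi> i) g (h i) (\<Phi> i)"
    and disj: "disjoint_family_on (\<lambda>i. \<phi> i ` ({0..} \<times> topspace (N i))) I"
    and core: "compactin X C0" and cover: "topspace X = C0 \<union> (\<Union>i\<in>I. \<phi> i ` ({0..} \<times> topspace (N i)))"
  shows "complete_metric X A g"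
proof -
  define \<rho> where "\<rho> i = warped_end.end_radius (N i) (\<phi> i)" for i
  define E where "E i S = \<phi> i ` (S \<times> topspace (N i))" for i and S :: "real set"
  define \<Theta> where "\<Theta> p = (\<Sum>i\<in>I. \<rho> i p)" for p
  have pe: "product_end X A (N i) (B i) (\<phi> i)" if "i \<in> I" for i
    using we[OF that] by (simp add: warped_end_def)
  note out = warped_end.end_radius_outside[OF we, folded \<rho>_def E_def]
  note radius = warped_end.end_radius_eq[OF we, folded \<rho>_def]
  have sub: "E i S \<subseteq> E i S'" if "S \<subseteq> S'" for i S S' using that unfolding E_def by blast
  have sub1: "E i {0<..} \<subseteq> E i {0..}" "E i {1..} \<subseteq> E i {0..}" "E i {1..} \<subseteq> E i {0<..}" for i
    by (rule sub; auto)+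
  have disjE: "E i {0..} \<inter> E j {0..} = {}" if "i \<in> I" "j \<in> I" "i \<noteq> j" for i j
    using disj that by (auto simp: disjoint_family_on_def E_def)
  have on_end: "\<Theta> p = \<rho> i p" if i: "i \<in> I" and p: "p \<in> E i {0<..}" for i p
  proof -
    have "\<rho> j p = 0" if j: "j \<in> I" "j \<noteq> i" for j
    proof (rule out[OF j(1)])
      have "p \<in> E i {0..}" using p sub1(1) by blast
      then show "p \<notin> E j {1..}" using disjE[OF i j(1)] j(2) sub1(2)[of j] by blast
    qed
    then show ?thesis unfolding \<Theta>_def by (simp add: sum.remove[OF I i])
  qed
  have grad: "(\<Theta> \<circ> chart_inv c) differentiable (at (snd c p)) \<and>
      dd (\<Theta> \<circ> chart_inv c) (snd c p) v \<le> sqrt (v \<bullet> (g c p *v v))" if c: "c \<in> A" and p: "p \<in> fst c" for c p v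
  proof (cases "\<exists>i\<in>I. p \<in> E i {0<..}")
    case True
    then obtain i where i: "i \<in> I" "p \<in> E i {0<..}" by blast
    let ?W = "snd c ` (fst c \<inter> E i {0<..})"
    have W: "open ?W" "snd c p \<in> ?W"
    proof -
      have "openin X (E i {0<..})"
        unfolding E_def by (rule product_end.open_end[OF pe[OF i(1)]]) auto
      then show "open ?W" by (intro open_chart_image[OF c] openin_Int chart_domain[OF c]) auto
    qed (use p i in blast)
    have eq: "(\<rho> i \<circ> chart_inv c) x = (\<Theta> \<circ> chart_inv c) x" if "x \<in> ?W" for x
      using chart_inv_image[OF c _ that] on_end[OF i(1)] by simp
    have \<rho>: "(\<rho> i \<circ> chart_inv c) differentiable (at (snd c p))"
      "dd (\<rho> i \<circ> chart_inv c) (snd c p) v \<le> sqrt (v \<bullet> (g c p *v v))"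
      using warped_end.end_radius_gradient[OF we[OF i(1)] c p] i(2) by (simp_all add: \<rho>_def E_def)
    have "(\<Theta> \<circ> chart_inv c) differentiable (at (snd c p))"
      by (rule differentiable_cong_open[OF W eq \<rho>(1)])
    moreover have "dd (\<rho> i \<circ> chart_inv c) (snd c p) = dd (\<Theta> \<circ> chart_inv c) (snd c p)"
      by (rule dd_cong[OF W eq])
    ultimately show ?thesis using \<rho>(2) by metis
  next
    case False
    \<comment> \<open>Outside the sets \<open>r > 0\<close> the point has the neighbourhood
      \<open>?Z\<close>, on which \<Theta> vanishes; it is open because finitely many closed sets
      are removed.\<close>
    let ?Z = "topspace X - (\<Union>i\<in>I. E i {1..})"
    let ?W = "snd c ` (fst c \<inter> ?Z)"
    have "closedin X (E i {1..})" if "i \<in> I" for i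
      unfolding E_def by (rule product_end.closed_end[OF pe[OF that]]) simp
    then have "closedin X (\<Union>i\<in>I. E i {1..})" using I by (intro closedin_Union) auto
    then have "openin X ?Z" by (simp add: openin_diff)
    then have W: "open ?W" by (intro open_chart_image[OF c] openin_Int chart_domain[OF c]) auto
    have "p \<notin> E i {1..}" if "i \<in> I" for i
      using False that sub1(3)[of i] by blast
    then have x: "snd c p \<in> ?W" using p chart_domain(2)[OF c] by blast
    have eq: "0 = (\<Theta> \<circ> chart_inv c) x" if "x \<in> ?W" for x
      using chart_inv_image[OF c _ that] out by (simp add: \<Theta>_def)
    have "((\<Theta> \<circ> chart_inv c) has_derivative (\<lambda>v. 0)) (at (snd c p))"
      by (rule has_derivative_transform_within_open[OF has_derivative_const W x eq])
    then show ?thesis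
      using metric_nonneg[OF c p] by (simp add: dd_eq differentiableI)
  qed
  show ?thesis
  proof (rule complete_metric_if_compact_tails)
    fix \<sigma> :: "nat \<Rightarrow> 'a"
    assume \<sigma>: "range \<sigma> \<subseteq> topspace X"
      and cauchy: "\<forall>e>0. \<exists>K. \<forall>i\<ge>K. \<forall>j\<ge>K. riemannian_dist X A g (\<sigma> i) (\<sigma> j) < ereal e"
    obtain K where K: "\<And>i j. i \<ge> K \<Longrightarrow> j \<ge> K \<Longrightarrow> riemannian_dist X A g (\<sigma> i) (\<sigma> j) < ereal 1"
      using cauchy zero_less_one by blast
    \<comment> \<open>On the tail \<Theta> stays below its value at \<open>\<sigma> K\<close> plus
      1, and \<open>soft_radius_ge\<close> costs another 2. The 1 inside \<open>max\<close> makes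
      every radius beyond \<open>R\<close> positive.\<close>
    define R where "R = max 1 (\<Theta> (\<sigma> K) + 3)"
    have bd: "\<Theta> (\<sigma> n) < \<Theta> (\<sigma> K) + 1" if n: "n \<ge> K" for n
    proof -
      obtain a b \<gamma> where \<gamma>: "piecewise_smooth_curve X A a b \<gamma>" "\<gamma> a = \<sigma> K" "\<gamma> b = \<sigma> n" "riemannian_length A g a b \<gamma> < 1"
        using K[OF order_refl n] unfolding riemannian_dist_less_iff by blast
      have "\<Theta> (\<gamma> b) - \<Theta> (\<gamma> a) \<le> riemannian_length A g a b \<gamma>"
        by (rule curve_length_lower_bound[OF _ _ \<gamma>(1)]) (use grad in blast)+
      then show ?thesis using \<gamma> by simp
    qed
    let ?C = "C0 \<union> (\<Union>i\<in>I. E i {0..R})"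
    have "compactin X (E i {0..R})" if "i \<in> I" for i
      unfolding E_def by (rule product_end.compact_end[OF pe[OF that]]) auto
    then have "compactin X ?C" using I core by (intro compactin_Un compactin_Union) auto
    moreover have "\<sigma> n \<in> ?C" if n: "n \<ge> K" for n
    proof (rule ccontr)
      assume nC: "\<sigma> n \<notin> ?C"
      have "\<sigma> n \<in> topspace X" using \<sigma> by blast
      then obtain i where i: "i \<in> I" "\<sigma> n \<in> E i {0..}" using nC unfolding cover E_def by blast
      then obtain r q where rq: "\<sigma> n = \<phi> i (r, q)" "0 \<le> r" "q \<in> topspace (N i)" by (auto simp: E_def)
      have "\<not> r \<le> R"
      proof
        assume "r \<le> R"
        then have "\<sigma> n \<in> E i {0..R}" using rq by (auto simp: E_def)
        then show False using nC i(1) by blast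
      qed
      then have r: "R < r" "0 < r" by (auto simp: R_def)
      have "\<sigma> n \<in> E i {0<..}" using rq r(2) by (auto simp: E_def)
      then have "\<Theta> (\<sigma> n) = soft_radius r"
        using on_end[OF i(1)] radius[OF i(1) r(2) rq(3)] rq(1) by simp
      then show False using bd[OF n] soft_radius_ge[of r] r(1) by (simp add: R_def)
    qed
    ultimately show "\<exists>C n0. compactin X C \<and> (\<forall>n\<ge>n0. \<sigma> n \<in> C)" by blast
  qed
qed

section \<open>Completeness and the asymptotic curvature bound combined\<close>

theorem proposition3p1:
  fixes X :: "'a topology" and A :: "('a, 'n::finite) chart set" and g\<^sub>0 :: "('a, 'n) metric"
    and m :: nat and M :: "nat \<Rightarrow> 'a set"
    and N :: "nat \<Rightarrow> 'b topology" and B :: "nat \<Rightarrow> ('b, 'k::finite) chart set"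
    and h :: "nat \<Rightarrow> ('b, 'k) metric" and \<phi> :: "nat \<Rightarrow> real \<times> 'b \<Rightarrow> 'a"
    and \<Phi> :: "nat \<Rightarrow> real \<Rightarrow> real" and k :: "nat \<Rightarrow> real"
    and \<Gamma> :: "(real ^ 'n) set" and f :: "real ^ 'n \<Rightarrow> real" and \<epsilon> \<delta> :: real
  assumes dim: "CARD('n) \<ge> 3" "CARD('n) = CARD('k) + 1"
    \<comment> \<open>the cone and the function\<close>
    and \<Gamma>: "open \<Gamma>" "convex \<Gamma>" "connected \<Gamma>"
      "\<forall>x\<in>\<Gamma>. \<forall>t>0. t *\<^sub>R x \<in> \<Gamma>"
      "\<forall>x\<in>\<Gamma>. \<forall>\<sigma>. bij \<sigma> \<longrightarrow> permute_coords \<sigma> x \<in> \<Gamma>"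
      "positive_cone \<subseteq> \<Gamma>" "\<Gamma> \<subseteq> positive_trace_cone"
    and f: "smooth_on \<Gamma> f" "continuous_on (closure \<Gamma>) f" "concave_on \<Gamma> f"
      "\<forall>x\<in>\<Gamma>. \<forall>t>0. f (t *\<^sub>R x) = t * f x"
      "\<forall>x\<in>\<Gamma>. \<forall>\<sigma>. bij \<sigma> \<longrightarrow> f (permute_coords \<sigma> x) = f x"
      "\<forall>x\<in>\<Gamma>. f x > 0" "\<forall>x\<in>frontier \<Gamma>. f x = 0"
      "\<forall>x\<in>\<Gamma>. \<forall>i. partial i f x > 0"
    \<comment> \<open>the manifold and its ends\<close>
    and M: "smooth_manifold X A" "topspace X = (\<Union>i\<le>m. M i)" "compactin X (M 0)"
      "disjoint_family_on M {1..m}"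
      "\<forall>i\<in>{1..m}. \<not> compactin X (M i)"
      "\<forall>i\<in>{1..m}. M 0 \<inter> M i = X frontier_of M i"
    and N: "\<forall>i\<in>{1..m}. smooth_manifold (N i) (B i) \<and> compact_space (N i)"
      "\<forall>i\<in>{1..m}. k i \<in> {-1, 0, 1} \<and> einstein_metric (B i) (h i) ((real CARD('n) - 2) * k i)"
    and product: "\<forall>i\<in>{1..m}. smooth_end_embedding X A (N i) (B i) (\<phi> i)"
      "\<forall>i\<in>{1..m}. M i = \<phi> i ` ({0..} \<times> topspace (N i))"
      "\<forall>i\<in>{1..m}. X frontier_of M i = \<phi> i ` ({0} \<times> topspace (N i))"
    \<comment> \<open>the metric\<close>
    and \<Phi>: "\<forall>i\<in>{1..m}. smooth_on {0..} (\<Phi> i) \<and> (\<forall>r\<ge>0. \<Phi> i r > 0)"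
    and g\<^sub>0: "riemannian_metric A g\<^sub>0"
      "\<forall>i\<in>{1..m}. warped_product_on_end A g\<^sub>0 (B i) (h i) (\<phi> i) (\<Phi> i)"
    and pos: "\<epsilon> > 0" "\<delta> > 0"
    and growth: "\<forall>i\<in>{1..m}. \<forall>\<^sub>F r in at_top.
        ((deriv (\<Phi> i) r)\<^sup>2 - k i) / (2 * (\<Phi> i r)\<^sup>2) \<ge> \<epsilon> \<and>
        2 * \<Phi> i r * deriv (deriv (\<Phi> i)) r / ((deriv (\<Phi> i) r)\<^sup>2 - k i) \<ge> - mu_plus \<Gamma> + 1 + \<delta>"
  shows "complete_metric X A g\<^sub>0 \<and>
    (\<exists>c>0. \<exists>K\<^sub>0. compactin X K\<^sub>0 \<and>
      (\<forall>U\<in>A. \<forall>p\<in>fst U - K\<^sub>0.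
        \<exists>l. eigenvalue_vector (neg_schouten_endo g\<^sub>0 U p) l \<and> l \<in> \<Gamma> \<and> f l \<ge> c))"
proof -
  let ?I = "{1..m}"
  interpret riemannian_manifold X A g\<^sub>0
    using M(1) g\<^sub>0(1) by unfold_locales
  have we: "warped_end X A (N i) (B i) (\<phi> i) g\<^sub>0 (h i) (\<Phi> i)" if i: "i \<in> ?I" for i
  proof -
    interpret N: riemannian_manifold "N i" "B i" "h i"
      using N i by unfold_locales (auto simp: einstein_metric_def)
    show ?thesis
    proof
      show "X frontier_of \<phi> i ` ({0..} \<times> topspace (N i)) = \<phi> i ` ({0} \<times> topspace (N i))"
        using product(2,3) i by metis
    qed (use i product(1) N(1) dim \<Phi> g\<^sub>0(2) in auto)
  qed
  have pe: "product_end X A (N i) (B i) (\<phi> i)" if "i \<in> ?I" for i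
    using we[OF that] by (simp add: warped_end_def)
  have cover: "topspace X = M 0 \<union> (\<Union>i\<in>?I. \<phi> i ` ({0..} \<times> topspace (N i)))"
  proof -
    have "{..m} = insert 0 ?I" by auto
    then have "topspace X = M 0 \<union> (\<Union>i\<in>?I. M i)" using M(2) by simp
    then show ?thesis using product(2) by simp
  qed
  have "complete_metric X A g\<^sub>0"
  proof (rule complete_metric_warped_ends[OF _ we _ M(3) cover])
    show "disjoint_family_on (\<lambda>i. \<phi> i ` ({0..} \<times> topspace (N i))) ?I"
      using M(4) product(2) by (simp add: disjoint_family_on_def)
  qed auto
  moreover have "\<exists>c>0. \<exists>K\<^sub>0. compactin X K\<^sub>0 \<and> (\<forall>U\<in>A. \<forall>p\<in>fst U - K\<^sub>0.
      \<exists>l. eigenvalue_vector (neg_schouten_endo g\<^sub>0 U p) l \<and> l \<in> \<Gamma> \<and> f l \<ge> c)"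
  proof -
    define Q where "Q i r = ((deriv (\<Phi> i) r)\<^sup>2 - k i) / (2 * (\<Phi> i r)\<^sup>2)" for i r
    \<comment> \<open>Finitely many ends admit one threshold \<open>R0\<close> for all of
      them.\<close>
    have "\<forall>\<^sub>F r in at_top. \<forall>i\<in>?I. Q i r \<ge> \<epsilon> \<and>
        2 * \<Phi> i r * deriv (deriv (\<Phi> i)) r / ((deriv (\<Phi> i) r)\<^sup>2 - k i) \<ge> - mu_plus \<Gamma> + 1 + \<delta>"
      unfolding Q_def using growth by (intro eventually_ball_finite) auto
    then obtain R0 where R0: "\<And>r i. r \<ge> R0 \<Longrightarrow> i \<in> ?I \<Longrightarrow> Q i r \<ge> \<epsilon> \<and>
        2 * \<Phi> i r * deriv (deriv (\<Phi> i)) r / ((deriv (\<Phi> i) r)\<^sup>2 - k i) \<ge> - mu_plus \<Gamma> + 1 + \<delta>"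
      unfolding eventually_at_top_linorder by blast
    \<comment> \<open>At least 1, so that points beyond \<open>R\<close> have \<open>r > 0\<close>,
      where the eigenvalue formula applies.\<close>
    define R where "R = max 1 R0"
    define K\<^sub>0 where "K\<^sub>0 = M 0 \<union> (\<Union>i\<in>?I. \<phi> i ` ({0..R} \<times> topspace (N i)))"
    have "compactin X (\<phi> i ` ({0..R} \<times> topspace (N i)))" if "i \<in> ?I" for i
      by (rule product_end.compact_end[OF pe[OF that]]) auto
    then have K0: "compactin X K\<^sub>0"
      unfolding K\<^sub>0_def using M(3) by (intro compactin_Un compactin_Union) auto
    \<comment> \<open>Any coordinate may carry the radial eigenvalue; it is fixed once so that
      \<open>c\<close> does not depend on the point or the end.\<close>
    obtain i0 :: 'n where True by simp
    define a where "a = - mu_plus \<Gamma> + \<delta>"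
    define c where "c = \<epsilon> * f (\<chi> j. if j = i0 then a else 1)"
    have a: "- mu_plus \<Gamma> < a" using pos(2) by (simp add: a_def)
    note lower = cone_function_lower_bound[of \<Gamma> f \<epsilon> _ a _ i0, OF \<Gamma>(1,2) _ _ \<Gamma>(6,7) f(1) _ _ _ pos(1) _ a]
    have main: "\<exists>l. eigenvalue_vector (neg_schouten_endo g\<^sub>0 U p) l \<and> l \<in> \<Gamma> \<and> f l \<ge> c"
      if U: "U \<in> A" and p: "p \<in> fst U - K\<^sub>0" for U p
    proof -
      have "p \<in> topspace X" using chart_domain(2)[OF U] p by blast
      then obtain i where i: "i \<in> ?I" "p \<in> \<phi> i ` ({0..} \<times> topspace (N i))"
        using p unfolding cover K\<^sub>0_def by blast
      then obtain r q where rq: "p = \<phi> i (r, q)" "0 \<le> r" "q \<in> topspace (N i)" by auto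
      have "\<not> r \<le> R"
      proof
        assume "r \<le> R"
        then have "p \<in> \<phi> i ` ({0..R} \<times> topspace (N i))" using rq by auto
        then show False using p i(1) unfolding K\<^sub>0_def by blast
      qed
      then have r: "0 < r" "R0 \<le> r" by (auto simp: R_def)
      define P where "P = deriv (deriv (\<Phi> i)) r / \<Phi> i r"
      have e: "eigenvalue_vector (neg_schouten_endo g\<^sub>0 U p) (\<chi> j. if j = i0 then P - Q i r else Q i r)"
        unfolding P_def Q_def rq(1)
        by (rule warped_end.neg_schouten_eigenvalues[OF we[OF i(1)] U r(1) rq(3)])
          (use p rq(1) N(2) i(1) dim in auto)
      have pos\<Phi>: "\<Phi> i r > 0" using \<Phi> i(1) rq(2) by blast
      have q: "\<epsilon> \<le> Q i r" "- mu_plus \<Gamma> + 1 + \<delta> \<le> 2 * \<Phi> i r * deriv (deriv (\<Phi> i)) r / ((deriv (\<Phi> i) r)\<^sup>2 - k i)"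
        using R0[OF r(2) i(1)] by auto
      have Q: "Q i r > 0" using q(1) pos(1) by simp
      \<comment> \<open>The denominator of the growth condition is 2 \<Phi>^2 Q, so the quotient
        there is P / Q. Multiplying the bound a + 1 by Q > 0 and subtracting Q bounds the radial
        eigenvalue P - Q below by a Q.\<close>
      have "(deriv (\<Phi> i) r)\<^sup>2 - k i = 2 * (\<Phi> i r)\<^sup>2 * Q i r" using pos\<Phi> by (simp add: Q_def)
      then have ratio: "2 * \<Phi> i r * deriv (deriv (\<Phi> i)) r / ((deriv (\<Phi> i) r)\<^sup>2 - k i) = P / Q i r"
        using pos\<Phi> by (simp add: P_def power2_eq_square)
      have "a + 1 \<le> P / Q i r" using q(2) unfolding ratio a_def by simp
      then have "(a + 1) * Q i r \<le> P" using Q by (simp add: pos_le_divide_eq)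
      then have aq: "a * Q i r \<le> P - Q i r" by (simp add: algebra_simps)
      have "(\<chi> j. if j = i0 then P - Q i r else Q i r) \<in> \<Gamma>"
        "c \<le> f (\<chi> j. if j = i0 then P - Q i r else Q i r)"
        unfolding c_def using lower(1,2)[OF _ _ _ _ _ q(1) aq] \<Gamma>(4,5) f(4,6,8) by auto
      then show ?thesis using e by blast
    qed
    \<comment> \<open>The extremal instance \<open>q = \<epsilon>\<close>,
      \<open>p = a * \<epsilon>\<close> of the cone estimate.\<close>
    have "c > 0" unfolding c_def
      using lower(3)[OF _ _ _ _ _ order_refl order_refl] \<Gamma>(4,5) f(4,6,8) by auto
    then show ?thesis using K0 main by blast
  qed
  ultimately show ?thesis by blast
qed

end
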